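(* Let $m \geq 2$ be a fixed integer, and assume $\mu_1, \ldots, \mu_m \in \mathcal{P}(\mathbb{C})$. Let $\varphi: \mathbb{C} \to \mathbb{C}$ be a smooth function with compact support $\operatorname{supp}(\varphi)$. Assume one of the following conditions: (1) For each $1 \leq k \leq m-1$, the measure $\mu_k$ is not supported on a circle centered in $\operatorname{supp}(\varphi)$. (2) For each $1 \leq k < l \leq m$, the measures $\mu_k, \mu_l$ satisfy the potential gap condition on $\operatorname{supp}(\varphi)$ (defined in the context). Let $\{X_{i,k} : 1 \leq k \leq m, i \geq 1\}$ be a collection of independent random variables so that $X_{i,k}$ has distribution $\mu_k$ for each $i \geq 1$. For each $n \geq 1$, define the degree $n$ polynomials \[ p_{n,k}(z) := \prod_{i=1}^n (z - X_{i,k}), \qquad 1 \leq k \leq m. \] Then there exists a (deterministic) probability measure $\rho$ on $\mathbb{C}$ so that \[ \frac{1}{n} \sum_{i=1}^n \varphi(z_i^{(n)}) \longrightarrow \int_{\mathbb{C}} \varphi \, d\rho \] in probability as $n \to \infty$, where $z_1^{(n)}, \ldots, z_n^{(n)}$ are the zeros (counted with multiplicity) of the sum $\sum_{k=1}^m p_{n,k}$. Here, $\rho$ depends only on $\mu_1, \ldots, \mu_m$ and is uniquely determined by the identity $\rho = \frac{1}{2\pi} \Delta U$, where $U(z) := \max_{1 \leq k \leq m} U_{\mu_k}(z)$ for each $z \in \mathbb{C}$ and the Laplacian is interpreted in the distributional sense, i.e. $\int_{\mathbb{C}} \psi\, d\rho = \frac{1}{2\pi}\int_{\mathbb{C}}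 \Delta\psi(z)\, U(z)\, d\lambda(z)$ for all smooth compactly supported $\psi:\mathbb{C}\to\mathbb{C}$.
   Context: $\mathcal{P}(\mathbb{C})$ is the set of probability measures on $\mathbb{C}$ with compact support. $\lambda$ is Lebesgue measure on $\mathbb{C}$. The logarithmic potential of $\mu\in\mathcal{P}(\mathbb{C})$ is $U_\mu:\mathbb{C}\to[-\infty,+\infty)$, $U_\mu(z) := \int_{\mathbb{C}} \log|z-w|\,d\mu(w)$. For nonempty $K\subset\mathbb{C}$, $\mu\in\mathcal{P}(\mathbb{C})$ is supported on a circle centered in $K$ if there exist $r\ge 0$ and $z\in K$ such that $\operatorname{supp}(\mu)\subset\{w\in\mathbb{C}:|w-z|=r\}$; otherwise $\mu$ is not supported on a circle centered in $K$. Potential gap condition: for compact $K\subset\mathbb{C}$, $\mu,\nu\in\mathcal{P}(\mathbb{C})$ satisfy the potential gap condition on $K$ if there exists a finite constant $C>0$ so that \[ \lambda\left(\left\{z\in K : |U_\mu(z)-U_\nu(z)|\le \frac{\log^2 n}{\sqrt n}\right\}\right)\le \frac{C}{\log^3 n} \] for all integers $n>C$. *)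

theory Defs
  imports "HOL-Probability.Probability" "HOL-Computational_Algebra.Polynomial"
begin

section \<open>Compactly supported probability measures\<close>

definition supp_measure :: "complex measure \<Rightarrow> complex set" where
  "supp_measure \<mu> = {z. \<forall>V. open V \<longrightarrow> z \<in> V \<longrightarrow> emeasure \<mu> V > 0}"

definition borel_prob :: "complex measure \<Rightarrow> bool" where
  "borel_prob \<mu> \<longleftrightarrow> prob_space \<mu> \<and> sets \<mu> = sets borel"

definition compact_prob :: "complex measure \<Rightarrow> bool" where
  "compact_prob \<mu> \<longleftrightarrow> borel_prob \<mu> \<and> compact (supp_measure \<mu>)"

definition supported_on_circle_centered_in :: "complex measure \<Rightarrow> complex set \<Rightarrow> bool" where
  "supported_on_circle_centered_in \<mu> K \<longleftrightarrow>
     (\<exists>r\<ge>0. \<exists>z\<in>K. supp_measure \<mu> \<subseteq> {w. norm (w - z) = r})"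

section \<open>Logarithmic potentials\<close>

definition eln :: "real \<Rightarrow> ereal" where
  "eln x = (if x = 0 then -\<infinity> else ereal (ln x))"

text \<open>
  The integral of \<open>log |z - w|\<close> is taken as the difference of the integrals of its positive
  and negative parts (\<^const>\<open>e2ennreal\<close> sends negative numbers to \<open>0\<close>). If \<open>\<mu>\<close> has compact support,
  the first integral is finite, so that the value lies in \<open>[-\<infinity>, \<infinity>)\<close>.
\<close>

definition log_potential :: "complex measure \<Rightarrow> complex \<Rightarrow> ereal" where
  "log_potential \<mu> z =
     enn2ereal (\<integral>\<^sup>+ w. e2ennreal (eln (norm (z - w))) \<partial>\<mu>)
   - enn2ereal (\<integral>\<^sup>+ w. e2ennreal (- eln (norm (z - w))) \<partial>\<mu>)"

text \<open>
  Two conventions are immaterial here. At points where both potentials are \<open>-\<infinity>\<close> their difference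
  is \<open>\<infinity>\<close> in \<^typ>\<open>ereal\<close>; these points form a Lebesgue null set. For \<open>n = 1\<close> the right-hand side is
  \<open>C / 0 = 0\<close>; but the condition only becomes weaker as \<open>C\<close> grows, so that one may take
  \<open>C \<ge> 1\<close>, and then \<open>n = 1\<close> does not occur.
\<close>

definition potential_gap :: "complex set \<Rightarrow> complex measure \<Rightarrow> complex measure \<Rightarrow> bool" where
  "potential_gap K \<mu> \<nu> \<longleftrightarrow>
     (\<exists>C::real. C > 0 \<and> (\<forall>n::nat. real n > C \<longrightarrow>
        emeasure lborel
          {z \<in> K. \<bar>log_potential \<mu> z - log_potential \<nu> z\<bar> \<le> ereal ((ln (real n))\<^sup>2 / sqrt (real n))}
        \<le> ennreal (C / (ln (real n)) ^ 3)))"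

section \<open>Smooth functions and the distributional Laplacian\<close>

text \<open>
  Differentiability is over \<open>\<real>\<close>: \<^const>\<open>frechet_derivative\<close> is the real derivative of a map of the
  plane, and \<open>frechet_derivative f (at z) v\<close> its derivative in the direction \<open>v\<close>.
\<close>

primrec Ck :: "nat \<Rightarrow> (complex \<Rightarrow> complex) \<Rightarrow> bool" where
  "Ck 0 f \<longleftrightarrow> continuous_on UNIV f"
| "Ck (Suc k) f \<longleftrightarrow>
     (\<forall>z. f differentiable (at z)) \<and> (\<forall>v. Ck k (\<lambda>z. frechet_derivative f (at z) v))"

definition smooth :: "(complex \<Rightarrow> complex) \<Rightarrow> bool" where
  "smooth f \<longleftrightarrow> (\<forall>k. Ck k f)"

definition supp_fun :: "(complex \<Rightarrow> complex) \<Rightarrow> complex set" where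
  "supp_fun f = closure {z. f z \<noteq> 0}"

definition test_function :: "(complex \<Rightarrow> complex) \<Rightarrow> bool" where
  "test_function f \<longleftrightarrow> smooth f \<and> compact (supp_fun f)"

definition laplacian :: "(complex \<Rightarrow> complex) \<Rightarrow> complex \<Rightarrow> complex" where
  "laplacian f z =
     (\<Sum>b\<in>{1, \<i>}. frechet_derivative (\<lambda>w. frechet_derivative f (at w) b) (at z) b)"

text \<open>
  \<open>\<rho> = (1 / 2\<pi>) \<Delta>U\<close> in the sense of distributions. For the functions \<open>U\<close> of interest, maxima of
  logarithmic potentials, \<open>U\<close> is locally integrable, and the set where \<open>U = -\<infinity>\<close>, on which
  \<^const>\<open>real_of_ereal\<close> returns \<open>0\<close>, is a Lebesgue null set.
\<close>

definition is_normalized_laplacian :: "complex measure \<Rightarrow> (complex \<Rightarrow> ereal) \<Rightarrow> bool" where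
  "is_normalized_laplacian \<rho> U \<longleftrightarrow>
     (\<forall>\<psi>. test_function \<psi> \<longrightarrow>
        (LINT z|\<rho>. \<psi> z) =
          complex_of_real (1 / (2 * pi)) *
          (LINT z|lborel. laplacian \<psi> z * complex_of_real (real_of_ereal (U z))))"

definition max_potential :: "nat \<Rightarrow> (nat \<Rightarrow> complex measure) \<Rightarrow> complex \<Rightarrow> ereal" where
  "max_potential m \<mu> z = Max ((\<lambda>k. log_potential (\<mu> k) z) ` {1..m})"

section \<open>Random polynomials\<close>

definition root_poly :: "nat \<Rightarrow> (nat \<Rightarrow> complex) \<Rightarrow> complex poly" where
  "root_poly n x = (\<Prod>i\<in>{1..n}. [:- x i, 1:])"

definition sum_poly :: "nat \<Rightarrow> nat \<Rightarrow> (nat \<Rightarrow> nat \<Rightarrow> complex) \<Rightarrow> complex poly" where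
  "sum_poly m n x = (\<Sum>k\<in>{1..m}. root_poly n (\<lambda>i. x i k))"

text \<open>\<^const>\<open>proots\<close> is the multiset of zeros, counted with multiplicity.\<close>

definition zero_average :: "(complex \<Rightarrow> complex) \<Rightarrow> nat \<Rightarrow> nat \<Rightarrow> (nat \<Rightarrow> nat \<Rightarrow> complex) \<Rightarrow> complex" where
  "zero_average \<phi> m n x = (1 / of_nat n) * (\<Sum>z\<in>#proots (sum_poly m n x). \<phi> z)"

text \<open>
  Measurability of the \<open>Z n\<close> is part of the notion; without it \<^const>\<open>measure\<close> could return \<open>0\<close> for a
  non-measurable event.
\<close>

definition converges_in_prob :: "'a measure \<Rightarrow> (nat \<Rightarrow> 'a \<Rightarrow> complex) \<Rightarrow> complex \<Rightarrow> bool" where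
  "converges_in_prob M Z c \<longleftrightarrow>
     (\<forall>n. Z n \<in> borel_measurable M) \<and>
     (\<forall>\<epsilon>>0. (\<lambda>n. measure M {\<omega> \<in> space M. norm (Z n \<omega> - c) > \<epsilon>}) \<longlonglongrightarrow> 0)"

end

(* The normalized Laplacian of (1/n) log |P_n| is the empirical measure of the zeros of
   P_n = p_{n,1} + ... + p_{n,m}, so it suffices that (1/n) log |P_n| converges to U in L^1 on
   supp phi, in expectation. By the law of large numbers (1/n) log |p_{n,k}(z)| tends to U_k(z) for
   almost every z. If a single index k attains the maximum U(z), then p_{n,k}(z) dominates the sum;
   the potential gap condition makes this hold almost everywhere. Otherwise the maximum is attained
   by some k < m for which log |z - X_{1,k}| is not constant, and by the central limit theorem
   log |p_{n,k}(z)| is too spread out to come within distance 1 of the logarithm of the modulus of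
   the independent sum of the remaining terms. Jensen's formula bounds the zeros, which gives a
   deterministic bound for (1/n) log |P_n| in L^2(supp phi), hence uniform integrability.

   All analysis of the Laplacian goes through circle averages A_r: Delta is the limit of
   4 (A_r - 1) / r^2, and A_r log |.-w| = log max(|.-w|, r). Thus A_r U >= U almost everywhere, and
   rho is obtained as a vague limit of the densities 2 (A_r U - U) / (pi r^2). *)

theory Submission
  imports Defs "HOL-Complex_Analysis.Complex_Analysis" "HOL-Real_Asymp.Real_Asymp"
    "HOL-Computational_Algebra.Fundamental_Theorem_Algebra"
begin

text \<open>The obstacle is cancellation among the summands. About the sum of the terms other than
  the chosen one nothing is known beyond its independence, so the central limit theorem is used in a
  form uniform over all windows of length 2 (\<open>sum_concentration\<close>) and then integrated
  over the other logarithm (\<open>indep_var_concentration\<close>). Potentials are only locally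
  square integrable, while a circle is a Lebesgue null set. Circle averages are therefore controlled
  for almost every centre and moved onto the test function by Fubini, where a Taylor expansion is
  available. The smoothed densities come without a bound on their total mass. Pairing with cutoffs
  bounds the mass on growing discs, and the behaviour U(z) - log |z| -> 0 at infinity shows that the
  limit has mass 1. Second moments of the logarithm serve twice: at almost every z they feed the
  weak law and the central limit theorem, and integrated over z they give uniform
  integrability.\<close>

section \<open>Circle averages of the logarithm\<close>

text \<open>Normalised arc length on the circle of radius \<open>r\<close> about 0. The parameter
  runs over the unit interval, as in \<open>circlepath\<close>, so that Cauchy's formula transfers
  without a change of variables.\<close>

definition circle_measure :: "real \<Rightarrow> complex measure" where
  "circle_measure r = distr (density lborel (\<lambda>t. ennreal (indicator {0..1::real} t))) borel
     (\<lambda>t. complex_of_real r * cis (2 * pi * t))"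

lemma cis_borel [measurable]: "cis \<in> borel_measurable borel"
  by (intro borel_measurable_continuous_onI continuous_intros)

lemma sets_circle_measure [measurable_cong, simp]: "sets (circle_measure r) = sets borel"
  by (simp add: circle_measure_def)

lemma space_circle_measure [simp]: "space (circle_measure r) = UNIV"
  by (simp add: circle_measure_def)

lemma prob_space_circle_measure: "prob_space (circle_measure r)"
  unfolding circle_measure_def
proof (rule prob_space.prob_space_distr)
  show "prob_space (density lborel (\<lambda>t. ennreal (indicator {0..1::real} t)))"
    by (rule prob_spaceI) (simp add: emeasure_density ennreal_indicator)
qed simp

lemma integral_circle_measure:
  fixes f :: "complex \<Rightarrow> 'b::{banach, second_countable_topology}"
  assumes [measurable]: "f \<in> borel_measurable borel"
  shows "(\<integral>\<zeta>. f \<zeta> \<partial>circle_measure r) =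
    (\<integral>t. indicator {0..1} t *\<^sub>R f (complex_of_real r * cis (2 * pi * t)) \<partial>lborel)"
  unfolding circle_measure_def
  by (subst integral_distr, simp, simp, subst integral_density) auto

lemma circle_measure_norm_AE: "r \<ge> 0 \<Longrightarrow> AE \<zeta> in circle_measure r. norm \<zeta> = r"
  unfolding circle_measure_def by (subst AE_distr_iff) (auto simp: norm_mult)

text \<open>Mean value property of \<open>Ln (1 - b * \<zeta>)\<close>, which is holomorphic in the
  unit disc and continuous up to the boundary because |b| < 1. Cauchy's formula at the centre gives
  \<open>Ln 1 = 0\<close>; its factor \<open>1 / u\<close> cancels against the derivative of the
  path, and the real part is the logarithm of the modulus.\<close>

lemma has_integral_ln_circle_0:
  assumes "norm b < 1"
  shows "((\<lambda>t. ln (norm (1 - b * cis (2 * pi * t)))) has_integral 0) {0..1}"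
proof -
  define f where "f = (\<lambda>\<zeta>. Ln (1 - b * \<zeta>))"
  have pos: "1 - b * \<zeta> \<notin> \<real>\<^sub>\<le>\<^sub>0" if "norm \<zeta> \<le> 1" for \<zeta>
  proof -
    have "norm (b * \<zeta>) < 1" using that assms
      by (metis less_le_not_le linorder_le_cases mult.commute mult_left_le_one_le norm_ge_zero norm_mult order_le_less_trans)
    moreover have "Re (b * \<zeta>) \<le> norm (b * \<zeta>)" by (rule complex_Re_le_cmod)
    ultimately have "Re (1 - b * \<zeta>) > 0" by simp
    then show ?thesis by (auto simp: complex_nonpos_Reals_iff)
  qed
  have hol: "f holomorphic_on ball 0 1" unfolding f_def
    by (intro holomorphic_intros) (use pos in auto)
  have cont: "continuous_on (cball 0 1) f" unfolding f_def
    by (intro continuous_intros) (use pos in auto)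
  have "((\<lambda>u. f u / (u - 0)) has_contour_integral 2 * of_real pi * \<i> * f 0) (circlepath 0 1)"
    by (rule Cauchy_integral_circlepath[OF cont hol]) auto
  then have "((\<lambda>x. f (cis (2*pi*x)) / cis (2*pi*x) * (2 * pi * \<i> * cis (2*pi*x))) has_integral 0) {0..1}"
    unfolding has_contour_integral vector_derivative_circlepath
    by (simp add: f_def circlepath cis_conv_exp mult_ac)
  then have "((\<lambda>x. (1/(2*pi*\<i>)) * (f (cis (2*pi*x)) / cis (2*pi*x) * (2 * pi * \<i> * cis (2*pi*x)))) has_integral (1/(2*pi*\<i>)) * 0) {0..1}"
    by (rule has_integral_mult_right)
  then have "((\<lambda>x. f (cis (2*pi*x))) has_integral 0) {0..1}"
    by simp
  then have "((\<lambda>x. Re (f (cis (2*pi*x)))) has_integral Re 0) {0..1}"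
    by (rule has_integral_Re)
  moreover have "Re (f (cis (2*pi*x))) = ln (norm (1 - b * cis (2 * pi * x)))" for x
  proof -
    have "1 - b * cis (2*pi*x) \<noteq> 0" using pos[of "cis (2*pi*x)"] by auto
    then show ?thesis by (simp add: f_def)
  qed
  ultimately show ?thesis by simp
qed

text \<open>Jensen's formula for one linear factor: pulling out the larger of the two moduli leaves
  \<open>1 - b * cis t\<close> with |b| < 1, whose logarithm has mean 0. For |a| = r the integrand
  is unbounded; for each \<open>r\<close> this excludes only a null set of positions
  \<open>a\<close>.\<close>

lemma circle_mean_ln:
  assumes r: "r > 0" and a: "norm a \<noteq> r"
  shows "integrable (circle_measure r) (\<lambda>\<zeta>. ln (norm (a + \<zeta>)))"
    and "(\<integral>\<zeta>. ln (norm (a + \<zeta>)) \<partial>circle_measure r) = ln (max (norm a) r)"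
proof -
  interpret C: prob_space "circle_measure r" by (rule prob_space_circle_measure)
  define c where "c = max (norm a) r"
  define d where "d = \<bar>norm a - r\<bar>"
  have d: "d > 0" using a by (simp add: d_def)
  have bd: "d \<le> norm (a + \<zeta>) \<and> norm (a + \<zeta>) \<le> norm a + r" if "norm \<zeta> = r" for \<zeta>
    using norm_triangle_ineq[of a \<zeta>] norm_triangle_ineq3[of a "-\<zeta>"] that
    by (simp add: d_def)
  have nz: "a + \<zeta> \<noteq> 0" if "norm \<zeta> = r" for \<zeta>
    using bd[OF that] d by auto
  have AEB: "AE \<zeta> in circle_measure r. norm (ln (norm (a + \<zeta>))) \<le> \<bar>ln d\<bar> + \<bar>ln (norm a + r)\<bar>"
  proof (rule AE_mp[OF circle_measure_norm_AE], use r in simp, intro AE_I2 impI)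
    fix \<zeta> :: complex assume "norm \<zeta> = r"
    from bd[OF this] have "ln d \<le> ln (norm (a + \<zeta>))" "ln (norm (a + \<zeta>)) \<le> ln (norm a + r)"
      using d by (auto intro!: ln_mono)
    then show "norm (ln (norm (a + \<zeta>))) \<le> \<bar>ln d\<bar> + \<bar>ln (norm a + r)\<bar>" by auto
  qed
  show int: "integrable (circle_measure r) (\<lambda>\<zeta>. ln (norm (a + \<zeta>)))"
    by (rule C.integrable_const_bound[OF AEB]) measurable
  have nrm: "norm (complex_of_real r * cis t) = r" for t using r by (simp add: norm_mult)
  obtain b where b: "norm b < 1" and eq: "\<And>t. norm (a + complex_of_real r * cis t) = c * norm (1 - b * cis t)"
  proof (cases "norm a < r")
    case True
    \<comment> \<open>For |a| < r the rotating term is the large one. Conjugation keeps the modulus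
      and turns \<open>cis t\<close> into \<open>cis (-t)\<close>; once that factor is pulled out,
      \<open>cis t\<close> is left with a small coefficient.\<close>
    have "norm (a + complex_of_real r * cis t) = c * norm (1 - (- cnj a / r) * cis t)" for t
    proof -
      have "norm (a + complex_of_real r * cis t) = norm (cnj (a + complex_of_real r * cis t))"
        by (simp only: complex_mod_cnj)
      also have "cnj (a + complex_of_real r * cis t) = (r * cis (-t)) * (1 + (cnj a / r) * cis t)"
        using r by (simp add: algebra_simps cis_cnj cis_mult)
      also have "norm \<dots> = r * norm (1 + (cnj a / r) * cis t)"
        using r by (simp add: norm_mult)
      finally show ?thesis using True by (simp add: c_def)
    qed
    moreover have "norm (- cnj a / r) < 1" using True r by (simp add: norm_divide)
    ultimately show ?thesis using that by blast
  next
    case False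
    then have ar: "norm a > r" using a by simp
    then have a0: "a \<noteq> 0" using r by auto
    have "norm (a + complex_of_real r * cis t) = c * norm (1 - (- r / a) * cis t)" for t
    proof -
      have "a + complex_of_real r * cis t = a * (1 - (- r / a) * cis t)"
        using a0 by (simp add: field_simps)
      then show ?thesis using ar by (simp add: c_def norm_mult)
    qed
    moreover have "norm (- r / a) < 1" using ar r a0 by (simp add: norm_divide)
    ultimately show ?thesis using that by blast
  qed
  have c: "c > 0" using r by (simp add: c_def)
  have "((\<lambda>t. ln c + ln (norm (1 - b * cis (2 * pi * t)))) has_integral ln c * (1 - 0) + 0) {0..1}"
    using has_integral_add[OF has_integral_const_real[of "ln c" 0 1] has_integral_ln_circle_0[OF b]]
    by simp
  moreover have "ln c + ln (norm (1 - b * cis (2 * pi * t))) = ln (norm (a + complex_of_real r * cis (2 * pi * t)))" for t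
  proof -
    have "a + complex_of_real r * cis (2 * pi * t) \<noteq> 0" by (rule nz) (simp add: nrm)
    then have "norm (a + complex_of_real r * cis (2 * pi * t)) \<noteq> 0" by (simp only: norm_eq_zero not_False_eq_True)
    then have "norm (1 - b * cis (2 * pi * t)) \<noteq> 0" unfolding eq by auto
    then show ?thesis unfolding eq using c by (subst ln_mult) auto
  qed
  ultimately have HI: "((\<lambda>t. ln (norm (a + complex_of_real r * cis (2 * pi * t)))) has_integral ln c) {0..1}"
    by simp
  have "continuous_on {0..1} (\<lambda>t. ln (norm (a + complex_of_real r * cis (2 * pi * t))))"
  proof (intro continuous_intros ballI)
    fix t :: real
    show "norm (a + complex_of_real r * cis (2 * pi * t)) \<noteq> 0"
      using nz[OF nrm] by (simp only: norm_eq_zero not_False_eq_True)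
  qed
  then have "set_integrable lborel {0..1} (\<lambda>t. ln (norm (a + complex_of_real r * cis (2 * pi * t))))"
    by (rule borel_integrable_atLeastAtMost')
  from has_integral_unique[OF has_integral_set_lebesgue HI]
    set_borel_integral_eq_integral[OF this] HI
  have "(LINT t:{0..1}|lborel. ln (norm (a + complex_of_real r * cis (2 * pi * t)))) = ln c"
    by (simp add: integral_unique)
  then show "(\<integral>\<zeta>. ln (norm (a + \<zeta>)) \<partial>circle_measure r) = ln (max (norm a) r)"
    by (subst integral_circle_measure) (auto simp: set_lebesgue_integral_def c_def)
qed

text \<open>For \<open>r > 0\<close> and \<open>a\<close> other than 0 this is the excess
  \<open>ln (max (norm a) r) - ln (norm a)\<close> of the circle average over the logarithm; with
  \<open>r = 1\<close> it is the negative part of the logarithm. At \<open>a = 0\<close> the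
  conventions for division by 0 and \<open>ln 0\<close> give the value 0, not infinity.\<close>

definition lneg :: "real \<Rightarrow> complex \<Rightarrow> real" where
  "lneg r a = max 0 (ln (r / norm a))"

lemma lneg_measurable [measurable]: "lneg r \<in> borel_measurable borel"
  unfolding lneg_def by measurable

lemma lneg_nonneg [simp]: "0 \<le> lneg r a" by (simp add: lneg_def)

text \<open>Tonelli under the graph: for \<open>t \<ge> 0\<close> the set where
  \<open>lneg r\<close> exceeds \<open>t\<close> is a disc of radius \<open>r * exp (- t)\<close>
  without its centre. The weight \<open>g\<close> is left open because \<open>g = 1\<close> gives
  the integral of \<open>lneg\<close> and \<open>g t = 2 * t\<close> that of its square.\<close>

lemma layer_cake_lneg:
  fixes g :: "real \<Rightarrow> ennreal"
  assumes [measurable]: "g \<in> borel_measurable borel" and r: "r > 0"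
  shows "(\<integral>\<^sup>+a. (\<integral>\<^sup>+t. g t * indicator {0..<lneg r a} t \<partial>lborel) \<partial>lborel) =
    (\<integral>\<^sup>+t. g t * ennreal (pi * r\<^sup>2 * exp (- 2 * t)) * indicator {0..} t \<partial>lborel)"
proof -
  have [measurable]: "Measurable.pred (lborel \<Otimes>\<^sub>M lborel) (\<lambda>(a::complex, t). t \<in> {0..<lneg r a})"
    unfolding atLeastLessThan_iff by measurable
  have "(\<integral>\<^sup>+a. (\<integral>\<^sup>+t. g t * indicator {0..<lneg r a} t \<partial>lborel) \<partial>lborel) =
    (\<integral>\<^sup>+t. (\<integral>\<^sup>+a. g t * indicator {0..<lneg r a} t \<partial>lborel) \<partial>lborel)"
    by (rule lborel_pair.Fubini') (simp add: split_beta, measurable)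
  also have "\<dots> = (\<integral>\<^sup>+t. g t * ennreal (pi * r\<^sup>2 * exp (- 2 * t)) * indicator {0..} t \<partial>lborel)"
  proof (rule nn_integral_cong)
    fix t :: real
    show "(\<integral>\<^sup>+a. g t * indicator {0..<lneg r a} t \<partial>lborel) = g t * ennreal (pi * r\<^sup>2 * exp (- 2 * t)) * indicator {0..} t"
    proof (cases "t \<ge> 0")
      case True
      have iff: "t < lneg r a \<longleftrightarrow> a \<in> ball 0 (r * exp (-t)) - {0}" for a
      proof (cases "a = 0")
        case False
        have "t < lneg r a \<longleftrightarrow> t < ln (r / norm a)" using True by (auto simp: lneg_def)
        also have "\<dots> \<longleftrightarrow> exp t < r / norm a" using False r by (simp add: ln_less_cancel_iff[of "exp t", simplified, symmetric])
        also have "\<dots> \<longleftrightarrow> norm a < r * exp (-t)" using False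
          by (simp add: exp_minus field_simps)
        finally show ?thesis using False by simp
      qed (use True in \<open>simp add: lneg_def\<close>)
      have "(\<integral>\<^sup>+a. g t * indicator {0..<lneg r a} t \<partial>lborel) =
        (\<integral>\<^sup>+a. g t * indicator (ball (0::complex) (r * exp (-t)) - {0}) a \<partial>lborel)"
        by (rule nn_integral_cong) (use True iff in \<open>auto simp: indicator_def\<close>)
      also have "\<dots> = g t * emeasure lborel (ball (0::complex) (r * exp (-t)) - {0})"
        by (subst nn_integral_cmult_indicator) auto
      also have "emeasure lborel (ball (0::complex) (r * exp (-t)) - {0}) = emeasure lborel (ball (0::complex) (r * exp (-t)))"
        by (rule emeasure_Diff_null_set) (auto intro: finite_imp_null_set_lborel)
      also have "\<dots> = ennreal (pi * r\<^sup>2 * exp (- 2 * t))"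
        using r by (subst emeasure_ball) (auto simp: unit_ball_vol_2 power_mult_distrib exp_of_nat_mult[symmetric] power2_eq_square mult_exp_exp)
      finally show ?thesis using True by simp
    qed (auto simp: indicator_def intro!: nn_integral_0_iff_AE[THEN iffD2])
  qed
  finally show ?thesis .
qed

text \<open>Multiplied by the factor \<open>4 / r\<^sup>2\<close> of the Laplacian limit, this value
  becomes the constant 2 pi of the fundamental solution.\<close>

lemma nn_integral_lneg:
  assumes r: "r > 0"
  shows "(\<integral>\<^sup>+a. ennreal (lneg r a) \<partial>lborel) = ennreal (pi * r\<^sup>2 / 2)"
proof -
  have "(\<integral>\<^sup>+a. ennreal (lneg r a) \<partial>lborel) = (\<integral>\<^sup>+a. (\<integral>\<^sup>+t. 1 * indicator {0..<lneg r a} t \<partial>lborel) \<partial>lborel)"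
    by (rule nn_integral_cong) simp
  also have "\<dots> = (\<integral>\<^sup>+t. 1 * ennreal (pi * r\<^sup>2 * exp (- 2 * t)) * indicator {0..} t \<partial>lborel)"
    by (rule layer_cake_lneg[OF _ r]) simp
  also have "\<dots> = (\<integral>\<^sup>+t. ennreal (pi * r\<^sup>2 * exp (- 2 * t)) * indicator {0..} t \<partial>lborel)" by simp
  also have "\<dots> = ennreal (0 - (- (pi * r\<^sup>2 / 2 * exp (- 2 * 0))))"
  proof (rule nn_integral_FTC_atLeast[where F="\<lambda>t. - (pi * r\<^sup>2 / 2 * exp (- 2 * t))"])
    show "((\<lambda>t. - (pi * r\<^sup>2 / 2 * exp (- 2 * t))) \<longlongrightarrow> 0) at_top" by real_asymp
  qed (auto intro!: derivative_eq_intros)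
  finally show ?thesis by simp
qed

text \<open>Source of the L^2 bounds below: the logarithmic singularity is square integrable, with a
  bound that translation does not change.\<close>

lemma nn_integral_lneg_square: "(\<integral>\<^sup>+a. ennreal ((lneg 1 a)\<^sup>2) \<partial>lborel) < \<infinity>"
proof -
  have "(\<integral>\<^sup>+a. ennreal ((lneg 1 a)\<^sup>2) \<partial>lborel) =
    (\<integral>\<^sup>+a. (\<integral>\<^sup>+t. ennreal (2 * max 0 t) * indicator {0..<lneg 1 a} t \<partial>lborel) \<partial>lborel)"
  proof (rule nn_integral_cong)
    fix a
    have "(\<integral>\<^sup>+t. ennreal (2 * max 0 t) * indicator {0..<lneg 1 a} t \<partial>lborel) =
      (\<integral>\<^sup>+t. ennreal (2 * t) * indicator {0..lneg 1 a} t \<partial>lborel)"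
      by (rule nn_integral_cong_AE, rule AE_mp[OF AE_lborel_singleton[of "lneg 1 a"]])
         (auto simp: indicator_def max_def)
    also have "\<dots> = ennreal ((lneg 1 a)\<^sup>2 - 0\<^sup>2)"
      by (rule nn_integral_FTC_Icc) (auto intro!: derivative_eq_intros)
    finally show "ennreal ((lneg 1 a)\<^sup>2) = (\<integral>\<^sup>+t. ennreal (2 * max 0 t) * indicator {0..<lneg 1 a} t \<partial>lborel)"
      by simp
  qed
  also have "\<dots> = (\<integral>\<^sup>+t. ennreal (2 * max 0 t) * ennreal (pi * 1\<^sup>2 * exp (- 2 * t)) * indicator {0..} t \<partial>lborel)"
    by (rule layer_cake_lneg) simp_all
  also have "\<dots> \<le> (\<integral>\<^sup>+t. ennreal (2 * pi * exp (- t)) * indicator {0..} t \<partial>lborel)"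
  proof (rule nn_integral_mono)
    fix t :: real
    show "ennreal (2 * max 0 t) * ennreal (pi * 1\<^sup>2 * exp (- 2 * t)) * indicator {0..} t \<le> ennreal (2 * pi * exp (- t)) * indicator {0..} t"
    proof (cases "t \<ge> 0")
      case True
      have "t \<le> exp t" using exp_ge_add_one_self[of t] by linarith
      then have "t * exp (- t) \<le> 1" by (simp add: exp_minus field_simps)
      then have "t * exp (-t) * exp (-t) \<le> exp (-t)"
        by (metis exp_ge_zero mult_cancel_right1 mult_right_mono mult_1)
      then have "t * exp (-2*t) \<le> exp (-t)" by (simp add: mult_exp_exp mult.assoc)
      then show ?thesis using True by (auto simp: ennreal_mult'[symmetric] indicator_def intro!: ennreal_leI)
    qed (simp add: indicator_def)
  qed
  also have "\<dots> = ennreal (0 - (- (2 * pi * exp (- 0))))"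
  proof (rule nn_integral_FTC_atLeast[where F="\<lambda>t. - (2 * pi * exp (- t))"])
    show "((\<lambda>t. - (2 * pi * exp (- t))) \<longlongrightarrow> 0) at_top" by real_asymp
  qed (auto intro!: derivative_eq_intros)
  finally show ?thesis by (auto simp: less_top[symmetric] top_unique)
qed

section \<open>Calculus of test functions\<close>

lemma smooth_differentiable: "smooth f \<Longrightarrow> f differentiable (at z)"
  unfolding smooth_def by (metis Ck.simps(2))

lemma smooth_continuous_on: "smooth f \<Longrightarrow> continuous_on S f"
  unfolding smooth_def by (metis Ck.simps(1) continuous_on_subset subset_UNIV)

lemma smooth_frechet_derivative: "smooth f \<Longrightarrow> smooth (\<lambda>z. frechet_derivative f (at z) v)"
  unfolding smooth_def
proof (rule allI)
  fix k assume "\<forall>k. Ck k f"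
  then have "Ck (Suc k) f" by blast
  then have "\<forall>v. Ck k (\<lambda>z. frechet_derivative f (at z) v)" unfolding Ck.simps ..
  then show "Ck k (\<lambda>z. frechet_derivative f (at z) v)" ..
qed

lemma eq_0_outside_supp_fun: "z \<notin> supp_fun f \<Longrightarrow> f z = 0"
  unfolding supp_fun_def using closure_subset[of "{z. f z \<noteq> 0}"] by auto

lemma frechet_derivative_outside_supp_fun:
  assumes "z \<notin> supp_fun f"
  shows "frechet_derivative f (at z) v = 0"
proof -
  have "(f has_derivative (\<lambda>_. 0)) (at z)"
  proof (rule has_derivative_transform_within_open[of "\<lambda>_. 0" "\<lambda>_. 0" z UNIV "- supp_fun f" f])
    show "open (- supp_fun f)" by (simp add: supp_fun_def open_Compl)
  qed (use assms eq_0_outside_supp_fun in auto)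
  then show ?thesis by (metis frechet_derivative_at)
qed

lemma supp_fun_frechet_derivative: "supp_fun (\<lambda>z. frechet_derivative f (at z) v) \<subseteq> supp_fun f"
proof -
  have "{z. frechet_derivative f (at z) v \<noteq> 0} \<subseteq> supp_fun f"
    using frechet_derivative_outside_supp_fun by blast
  then show ?thesis unfolding supp_fun_def by (simp add: closure_minimal)
qed

lemma test_function_frechet_derivative:
  assumes "test_function f"
  shows "test_function (\<lambda>z. frechet_derivative f (at z) v)"
proof -
  have "closed (supp_fun (\<lambda>z. frechet_derivative f (at z) v))" by (simp add: supp_fun_def)
  then show ?thesis using assms supp_fun_frechet_derivative[of f v] smooth_frechet_derivative[of f v]
    unfolding test_function_def by (metis compact_Int_closed inf.absorb_iff2)
qed

lemma test_function_continuous: "test_function f \<Longrightarrow> continuous_on S f"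
  by (simp add: test_function_def smooth_continuous_on)

lemma test_function_measurable: "test_function f \<Longrightarrow> f \<in> borel_measurable borel"
  by (simp add: borel_measurable_continuous_onI test_function_continuous)

lemma test_function_support:
  assumes "test_function f"
  obtains R where "R > 0" "\<And>z. norm z > R \<Longrightarrow> f z = 0"
proof -
  have "bounded (supp_fun f)" using assms by (simp add: test_function_def compact_imp_bounded)
  then obtain R where "R > 0" "\<And>z. z \<in> supp_fun f \<Longrightarrow> norm z \<le> R"
    unfolding bounded_pos by blast
  then show ?thesis using that eq_0_outside_supp_fun by (metis linorder_not_less)
qed

lemma test_function_bounded:
  assumes "test_function f"
  obtains B where "B > 0" "\<And>z. norm (f z) \<le> B"
proof -
  have "compact (f ` supp_fun f)"
    using assms by (intro compact_continuous_image test_function_continuous) (auto simp: test_function_def)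
  then obtain B where B: "B > 0" "\<And>z. z \<in> supp_fun f \<Longrightarrow> norm (f z) \<le> B"
    by (metis bounded_pos compact_imp_bounded imageI)
  have "norm (f z) \<le> B" for z
    using B eq_0_outside_supp_fun[of z f] by (cases "z \<in> supp_fun f") auto
  then show ?thesis using that B by blast
qed

lemma test_function_uniformly_continuous:
  assumes f: "test_function f" and e: "e > 0"
  shows "\<exists>d>0. \<forall>x y. dist x y < d \<longrightarrow> dist (f x) (f y) < e"
proof -
  obtain R where R: "R > 0" "\<And>z. norm z > R \<Longrightarrow> f z = 0" using test_function_support[OF f] by blast
  have "uniformly_continuous_on (cball 0 (R+1)) f"
    by (rule compact_uniformly_continuous[OF test_function_continuous[OF f]]) simp
  then obtain d where d: "d > 0"
    "\<And>x y. x \<in> cball 0 (R+1) \<Longrightarrow> y \<in> cball 0 (R+1) \<Longrightarrow> dist y x < d \<Longrightarrow> dist (f y) (f x) < e"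
    using e unfolding uniformly_continuous_on_def by metis
  show ?thesis
  proof (intro exI[of _ "min d 1"] conjI allI impI)
    fix x y :: complex assume xy: "dist x y < min d 1"
    show "dist (f x) (f y) < e"
    proof (cases "x \<in> cball 0 (R+1) \<and> y \<in> cball 0 (R+1)")
      case True then show ?thesis using d(2)[of y x] xy by auto
    next
      case False
      have "norm x \<le> norm y + dist x y" "norm y \<le> norm x + dist x y"
        by (metis dist_0_norm dist_triangle dist_commute add.commute)+
      then have "norm x > R" "norm y > R" using False xy by auto
      then show ?thesis using R e by simp
    qed
  qed (use d in auto)
qed

lemma frechet_derivative_Re_Im:
  assumes "f differentiable (at z)"
  shows "frechet_derivative f (at z) v = Re v *\<^sub>R frechet_derivative f (at z) 1 + Im v *\<^sub>R frechet_derivative f (at z) \<i>"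
proof -
  interpret L: linear "frechet_derivative f (at z)" by (rule linear_frechet_derivative[OF assms])
  have "v = Re v *\<^sub>R 1 + Im v *\<^sub>R \<i>" by (simp add: complex_eq_iff)
  then show ?thesis by (metis L.add L.scaleR)
qed

section \<open>Second-order Taylor expansion, uniform in the base point\<close>

lemma smooth_along_line:
  assumes "smooth f"
  shows "((\<lambda>s. f (z + s *\<^sub>R h)) has_vector_derivative
    (Re h *\<^sub>R frechet_derivative f (at (z + s *\<^sub>R h)) 1 + Im h *\<^sub>R frechet_derivative f (at (z + s *\<^sub>R h)) \<i>)) (at s)"
proof -
  have d: "f differentiable (at (z + s *\<^sub>R h))" using assms by (rule smooth_differentiable)
  have 1: "((\<lambda>s. z + s *\<^sub>R h) has_derivative (\<lambda>t. t *\<^sub>R h)) (at s)"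
    by (auto intro!: derivative_eq_intros)
  have "(f has_derivative frechet_derivative f (at (z + s *\<^sub>R h))) (at (z + s *\<^sub>R h))"
    using d by (simp add: frechet_derivative_works)
  from has_derivative_compose[OF 1 this]
  have "((\<lambda>s. f (z + s *\<^sub>R h)) has_derivative (\<lambda>t. frechet_derivative f (at (z + s *\<^sub>R h)) (t *\<^sub>R h))) (at s)" .
  moreover have "(\<lambda>t. frechet_derivative f (at (z + s *\<^sub>R h)) (t *\<^sub>R h)) = (\<lambda>t. t *\<^sub>R frechet_derivative f (at (z + s *\<^sub>R h)) h)"
    using linear_frechet_derivative[OF d] by (simp add: linear_scale)
  ultimately show ?thesis
    unfolding has_vector_derivative_def frechet_derivative_Re_Im[OF d, of h, symmetric] by simp
qed

text \<open>The derivative in direction \<open>h\<close>, expanded in the coordinate directions. The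
  remainder estimate has to be uniform in \<open>h\<close>; in this form only the derivatives along
  1 and \<open>\<i>\<close> have to be controlled, whatever \<open>h\<close> is.\<close>

definition dir_deriv :: "(complex \<Rightarrow> complex) \<Rightarrow> complex \<Rightarrow> complex \<Rightarrow> complex" where
  "dir_deriv f z h = Re h *\<^sub>R frechet_derivative f (at z) 1 + Im h *\<^sub>R frechet_derivative f (at z) \<i>"

definition dir_deriv2 :: "(complex \<Rightarrow> complex) \<Rightarrow> complex \<Rightarrow> complex \<Rightarrow> complex" where
  "dir_deriv2 f z h = Re h *\<^sub>R dir_deriv (\<lambda>w. frechet_derivative f (at w) 1) z h + Im h *\<^sub>R dir_deriv (\<lambda>w. frechet_derivative f (at w) \<i>) z h"

lemma mvt_norm_bound:
  fixes f :: "real \<Rightarrow> complex"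
  assumes "a \<le> b" "\<And>x. (f has_vector_derivative f' x) (at x)" "\<And>x. a \<le> x \<Longrightarrow> x \<le> b \<Longrightarrow> norm (f' x) \<le> B"
  shows "norm (f b - f a) \<le> B * (b - a)"
proof (cases "a = b")
  case False
  have "\<exists>x\<in>{a<..<b}. norm (f b - f a) \<le> norm ((b - a) *\<^sub>R f' x)"
  proof (rule mvt_general)
    show "continuous_on {a..b} f"
      using assms(2) by (meson continuous_at_imp_continuous_on has_vector_derivative_continuous)
  qed (use False assms in \<open>auto simp: has_vector_derivative_def\<close>)
  then obtain x where x: "a < x" "x < b" "norm (f b - f a) \<le> norm ((b - a) *\<^sub>R f' x)" by auto
  have "norm ((b - a) *\<^sub>R f' x) \<le> B * (b - a)"
    using assms(1) assms(3)[of x] x by (simp add: mult.commute mult_left_mono)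
  then show ?thesis using x(3) by linarith
qed simp

text \<open>Compact support makes the second derivatives uniformly continuous, so one
  \<open>d\<close> serves all base points \<open>z\<close>. The mean value inequality is applied
  twice along the segment from \<open>z\<close> to \<open>z + h\<close>: first to the derivative,
  then to the function.\<close>

lemma taylor2:
  assumes f: "test_function f" and e: "e > 0"
  obtains d where "d > 0" "\<And>z h. norm h < d \<Longrightarrow> norm (f (z + h) - f z - dir_deriv f z h - (1/2) *\<^sub>R dir_deriv2 f z h) \<le> e * (norm h)\<^sup>2"
proof -
  have sm: "smooth f" using f by (simp add: test_function_def)
  define g where "g = (\<lambda>a b z. frechet_derivative (\<lambda>w. frechet_derivative f (at w) a) (at z) b)"
  have tg: "test_function (g a b)" for a b
    unfolding g_def using f by (simp add: test_function_frechet_derivative)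
  \<comment> \<open>\<open>dir_deriv2\<close> has four terms with coefficients at most
    \<open>(norm h)\<^sup>2\<close> in modulus; each receives the share \<open>e/4\<close>.\<close>
  have "\<exists>d>0. \<forall>x y. dist x y < d \<longrightarrow> dist (g a b x) (g a b y) < e/4" for a b
    by (rule test_function_uniformly_continuous[OF tg]) (use e in simp)
  then have "\<forall>a. \<exists>d. \<forall>b. d b > 0 \<and> (\<forall>x y. dist x y < d b \<longrightarrow> dist (g a b x) (g a b y) < e/4)"
    by (intro allI choice) auto
  from choice[OF this] obtain d where d': "\<forall>a b. d a b > 0 \<and> (\<forall>x y. dist x y < d a b \<longrightarrow> dist (g a b x) (g a b y) < e/4)" ..
  have d: "d a b > 0" "dist x y < d a b \<Longrightarrow> dist (g a b x) (g a b y) < e/4" for a b x y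
    using d'[THEN spec, THEN spec, of a b] by simp_all
  define d0 where "d0 = min (min (d 1 1) (d 1 \<i>)) (min (d \<i> 1) (d \<i> \<i>))"
  have d0: "d0 > 0" using d by (auto simp: d0_def)
  have D2g: "dir_deriv2 f z h = (Re h * Re h) *\<^sub>R g 1 1 z + (Re h * Im h) *\<^sub>R g 1 \<i> z + (Im h * Re h) *\<^sub>R g \<i> 1 z + (Im h * Im h) *\<^sub>R g \<i> \<i> z" for z h
    by (simp add: dir_deriv2_def dir_deriv_def g_def algebra_simps)
  have D2diff: "norm (dir_deriv2 f (z + s *\<^sub>R h) h - dir_deriv2 f z h) \<le> e * (norm h)\<^sup>2" if "norm h < d0" "0 \<le> s" "s \<le> 1" for z h s
  proof -
    have "norm (s *\<^sub>R h) \<le> norm h" using that by (simp add: mult_left_le_one_le)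
    then have "dist (z + s *\<^sub>R h) z < d0" using that by (simp add: dist_norm)
    then have G: "norm (g a b (z + s *\<^sub>R h) - g a b z) \<le> e/4" if "a \<in> {1,\<i>}" "b \<in> {1,\<i>}" for a b
      using d(2)[of "z + s *\<^sub>R h" z a b] that unfolding d0_def by (auto simp: dist_norm)
    have P: "norm (c *\<^sub>R (g a b (z + s *\<^sub>R h) - g a b z)) \<le> (norm h)\<^sup>2 * (e/4)" if "a \<in> {1,\<i>}" "b \<in> {1,\<i>}" "\<bar>c\<bar> \<le> (norm h)\<^sup>2" for a b c
      using G[OF that(1,2)] that(3) by (simp only: norm_scaleR) (intro mult_mono, auto)
    have c: "\<bar>Re h * Re h\<bar> \<le> (norm h)\<^sup>2" "\<bar>Re h * Im h\<bar> \<le> (norm h)\<^sup>2" "\<bar>Im h * Re h\<bar> \<le> (norm h)\<^sup>2" "\<bar>Im h * Im h\<bar> \<le> (norm h)\<^sup>2"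
      unfolding abs_mult power2_eq_square by (intro mult_mono abs_Re_le_cmod abs_Im_le_cmod; simp)+
    have "dir_deriv2 f (z + s *\<^sub>R h) h - dir_deriv2 f z h =
       (Re h * Re h) *\<^sub>R (g 1 1 (z + s *\<^sub>R h) - g 1 1 z) + (Re h * Im h) *\<^sub>R (g 1 \<i> (z + s *\<^sub>R h) - g 1 \<i> z)
     + (Im h * Re h) *\<^sub>R (g \<i> 1 (z + s *\<^sub>R h) - g \<i> 1 z) + (Im h * Im h) *\<^sub>R (g \<i> \<i> (z + s *\<^sub>R h) - g \<i> \<i> z)"
      unfolding D2g by (simp add: algebra_simps)
    also have "norm \<dots> \<le> (norm h)\<^sup>2 * (e/4) + (norm h)\<^sup>2 * (e/4) + (norm h)\<^sup>2 * (e/4) + (norm h)\<^sup>2 * (e/4)"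
      by (intro norm_triangle_le add_mono P c) auto
    finally show ?thesis by (simp add: mult.commute)
  qed
  have "norm (f (z + h) - f z - dir_deriv f z h - (1/2) *\<^sub>R dir_deriv2 f z h) \<le> e * (norm h)\<^sup>2" if h: "norm h < d0" for z h
  proof -
    define E where "E = e * (norm h)\<^sup>2"
    have v1: "((\<lambda>s. f (z + s *\<^sub>R h)) has_vector_derivative dir_deriv f (z + s *\<^sub>R h) h) (at s)" for s
      unfolding dir_deriv_def by (rule smooth_along_line[OF sm])
    have v2: "((\<lambda>s. dir_deriv f (z + s *\<^sub>R h) h) has_vector_derivative dir_deriv2 f (z + s *\<^sub>R h) h) (at s)" for s
    proof -
      have "((\<lambda>s. frechet_derivative f (at (z + s *\<^sub>R h)) a) has_vector_derivative dir_deriv (\<lambda>w. frechet_derivative f (at w) a) (z + s *\<^sub>R h) h) (at s)" for a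
        unfolding dir_deriv_def by (rule smooth_along_line[OF smooth_frechet_derivative[OF sm, of a]])
      from has_vector_derivative_add[OF bounded_linear.has_vector_derivative[OF bounded_linear_scaleR_right this]
          bounded_linear.has_vector_derivative[OF bounded_linear_scaleR_right this], of "Re h" 1 "Im h" \<i>]
      show ?thesis unfolding dir_deriv2_def dir_deriv_def[of f] .
    qed
    have lin: "((\<lambda>s. s *\<^sub>R c) has_vector_derivative c) (at x)" for c :: complex and x :: real
      by (rule has_vector_derivative_eq_rhs[OF has_vector_derivative_scaleR[OF DERIV_ident has_vector_derivative_const]]) simp
    have quad: "((\<lambda>s. (s\<^sup>2/2) *\<^sub>R c) has_vector_derivative x *\<^sub>R c) (at x)" for c :: complex and x :: real
    proof -
      have "((\<lambda>s. s\<^sup>2/2) has_real_derivative x) (at x)" by (auto intro!: derivative_eq_intros)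
      from has_vector_derivative_eq_rhs[OF has_vector_derivative_scaleR[OF this has_vector_derivative_const]] show ?thesis by simp
    qed
    have b1: "norm (dir_deriv f (z + s *\<^sub>R h) h - dir_deriv f z h - s *\<^sub>R dir_deriv2 f z h) \<le> E" if s: "0 \<le> s" "s \<le> 1" for s
    proof -
      have "norm ((dir_deriv f (z + s *\<^sub>R h) h - s *\<^sub>R dir_deriv2 f z h) - (dir_deriv f (z + 0 *\<^sub>R h) h - 0 *\<^sub>R dir_deriv2 f z h)) \<le> E * (s - 0)"
      proof (rule mvt_norm_bound[OF s(1), where f'="\<lambda>s. dir_deriv2 f (z + s *\<^sub>R h) h - dir_deriv2 f z h"])
        show "((\<lambda>s. dir_deriv f (z + s *\<^sub>R h) h - s *\<^sub>R dir_deriv2 f z h) has_vector_derivative dir_deriv2 f (z + x *\<^sub>R h) h - dir_deriv2 f z h) (at x)" for x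
          by (rule has_vector_derivative_diff[OF v2 lin])
        show "0 \<le> x \<Longrightarrow> x \<le> s \<Longrightarrow> norm (dir_deriv2 f (z + x *\<^sub>R h) h - dir_deriv2 f z h) \<le> E" for x
          unfolding E_def using D2diff[OF h] s by auto
      qed
      also have "\<dots> \<le> E" using s e by (simp add: E_def mult_left_le)
      finally show ?thesis by (simp add: algebra_simps)
    qed
    have "norm ((f (z + 1 *\<^sub>R h) - 1 *\<^sub>R dir_deriv f z h - (1\<^sup>2/2) *\<^sub>R dir_deriv2 f z h) - (f (z + 0 *\<^sub>R h) - 0 *\<^sub>R dir_deriv f z h - (0\<^sup>2/2) *\<^sub>R dir_deriv2 f z h)) \<le> E * (1 - 0)"
    proof (rule mvt_norm_bound[where f'="\<lambda>s. dir_deriv f (z + s *\<^sub>R h) h - dir_deriv f z h - s *\<^sub>R dir_deriv2 f z h"])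
      show "((\<lambda>s. f (z + s *\<^sub>R h) - s *\<^sub>R dir_deriv f z h - (s\<^sup>2/2) *\<^sub>R dir_deriv2 f z h) has_vector_derivative
          dir_deriv f (z + x *\<^sub>R h) h - dir_deriv f z h - x *\<^sub>R dir_deriv2 f z h) (at x)" for x
        by (rule has_vector_derivative_diff[OF has_vector_derivative_diff[OF v1 lin] quad])
    qed (use b1 in auto)
    then show ?thesis by (simp add: E_def algebra_simps)
  qed
  with d0 that show ?thesis by blast
qed

section \<open>Moments of the circle measure\<close>

lemma circle_moments:
  shows "(\<integral>\<zeta>. Re \<zeta> \<partial>circle_measure r) = 0" "(\<integral>\<zeta>. Im \<zeta> \<partial>circle_measure r) = 0"
    "(\<integral>\<zeta>. Re \<zeta> * Re \<zeta> \<partial>circle_measure r) = r\<^sup>2 / 2" "(\<integral>\<zeta>. Im \<zeta> * Im \<zeta> \<partial>circle_measure r) = r\<^sup>2 / 2"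
    "(\<integral>\<zeta>. Re \<zeta> * Im \<zeta> \<partial>circle_measure r) = 0"
proof -
  have I: "(\<integral>\<zeta>. f \<zeta> \<partial>circle_measure r) = F 1 - F 0"
    if [measurable]: "f \<in> borel_measurable borel"
      and F: "\<And>t. (F has_real_derivative f (complex_of_real r * cis (2 * pi * t))) (at t)"
      and c: "continuous_on {0..1} (\<lambda>t. f (complex_of_real r * cis (2 * pi * t)))" for f F :: "_ \<Rightarrow> real"
    unfolding integral_circle_measure[OF that(1)]
    by (rule integral_FTC_Icc) (use F c in \<open>auto intro: has_vector_derivative_at_within simp: has_real_derivative_iff_has_vector_derivative\<close>)
  have sq: "cos x * cos x = 1/2 + cos (2 * x) / 2" "sin x * sin x = 1/2 - cos (2 * x) / 2" for x :: real
    using cos_double_cos[of x] cos_double_sin[of x] unfolding power2_eq_square by linarith+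
  show "(\<integral>\<zeta>. Re \<zeta> \<partial>circle_measure r) = 0"
    by (subst I[where F="\<lambda>t. r * sin (2*pi*t) / (2*pi)"]) (auto intro!: derivative_eq_intros continuous_intros)
  show "(\<integral>\<zeta>. Im \<zeta> \<partial>circle_measure r) = 0"
    by (subst I[where F="\<lambda>t. - r * cos (2*pi*t) / (2*pi)"]) (auto intro!: derivative_eq_intros continuous_intros)
  show "(\<integral>\<zeta>. Re \<zeta> * Re \<zeta> \<partial>circle_measure r) = r\<^sup>2 / 2"
    by (subst I[where F="\<lambda>t. r\<^sup>2 * (t/2 + sin (2*(2*pi*t)) / (8*pi))"])
       (auto intro!: derivative_eq_intros continuous_intros simp: power2_eq_square sq algebra_simps)
  show "(\<integral>\<zeta>. Im \<zeta> * Im \<zeta> \<partial>circle_measure r) = r\<^sup>2 / 2"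
    by (subst I[where F="\<lambda>t. r\<^sup>2 * (t/2 - sin (2*(2*pi*t)) / (8*pi))"])
       (auto intro!: derivative_eq_intros continuous_intros simp: power2_eq_square sq algebra_simps)
  show "(\<integral>\<zeta>. Re \<zeta> * Im \<zeta> \<partial>circle_measure r) = 0"
    by (subst I[where F="\<lambda>t. r\<^sup>2 * (sin (2*pi*t))\<^sup>2 / (4*pi)"])
       (auto intro!: derivative_eq_intros continuous_intros simp: power2_eq_square)
qed

section \<open>Circle averages and the Laplacian\<close>

lemma norm_integral_le:
  fixes f :: "'a \<Rightarrow> 'b::{banach, second_countable_topology}"
  assumes "integrable M f" "integrable M g" "\<And>x. norm (f x) \<le> g x"
  shows "norm (integral\<^sup>L M f) \<le> integral\<^sup>L M g"
proof -
  have "norm (integral\<^sup>L M f) \<le> (\<integral>x. norm (f x) \<partial>M)" by (rule integral_norm_bound)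
  also have "\<dots> \<le> integral\<^sup>L M g" using assms by (intro integral_mono) auto
  finally show ?thesis .
qed

definition loc_integrable :: "(complex \<Rightarrow> real) \<Rightarrow> bool" where
  "loc_integrable f \<longleftrightarrow> (\<forall>R. integrable lborel (\<lambda>z. indicator (cball 0 R) z *\<^sub>R f z))"

lemma loc_integrable_measurable [measurable_dest]:
  assumes "loc_integrable f" shows "f \<in> borel_measurable borel"
proof (rule borel_measurable_LIMSEQ_real)
  show "(\<lambda>n::nat. indicator (cball 0 (real n)) z *\<^sub>R f z) \<longlonglongrightarrow> f z" for z
  proof (rule tendsto_eventually)
    obtain N where "norm z \<le> real N" using real_arch_simple by blast
    then show "\<forall>\<^sub>F n in sequentially. indicator (cball 0 (real n)) z *\<^sub>R f z = f z"
      by (intro eventually_sequentiallyI[of N]) auto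
  qed
  show "(\<lambda>z. indicator (cball 0 (real n)) z *\<^sub>R f z) \<in> borel_measurable borel" for n
  proof -
    have "integrable lborel (\<lambda>z. indicator (cball 0 (real n)) z *\<^sub>R f z)"
      using assms unfolding loc_integrable_def by blast
    from borel_measurable_integrable[OF this] show ?thesis by simp
  qed
qed

lemma loc_integrable_mult:
  fixes p :: "complex \<Rightarrow> complex"
  assumes f: "loc_integrable f" and [measurable]: "p \<in> borel_measurable borel"
    and p: "\<And>z. norm (p z) \<le> B" "\<And>z. norm z > R \<Longrightarrow> p z = 0"
  shows "integrable lborel (\<lambda>z. p z * complex_of_real (f z))"
proof (rule Bochner_Integration.integrable_bound)
  have [measurable]: "f \<in> borel_measurable borel" using f by measurable
  show "integrable lborel (\<lambda>z. B *\<^sub>R (indicator (cball 0 R) z *\<^sub>R f z))"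
    using f unfolding loc_integrable_def by (intro integrable_scaleR_right) auto
  show "(\<lambda>z. p z * complex_of_real (f z)) \<in> borel_measurable lborel" by measurable
  have "0 \<le> B" using p(1)[of 0] norm_ge_zero order_trans by blast
  then show "AE z in lborel. norm (p z * complex_of_real (f z)) \<le> norm (B *\<^sub>R (indicator (cball 0 R) z *\<^sub>R f z))"
    using p by (intro AE_I2) (auto simp: norm_mult abs_mult indicator_def intro!: mult_right_mono)
qed

lemma lborel_translation:
  fixes f :: "complex \<Rightarrow> 'b::{banach, second_countable_topology}"
  assumes [measurable]: "f \<in> borel_measurable borel"
  shows "(\<integral>z. f (z + c) \<partial>lborel) = (\<integral>z. f z \<partial>lborel)"
    and "integrable lborel (\<lambda>z. f (z + c)) \<longleftrightarrow> integrable lborel f"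
proof -
  have d: "lborel = distr lborel borel ((+) c)" by (rule lborel_distr_plus[symmetric])
  show "(\<integral>z. f (z + c) \<partial>lborel) = (\<integral>z. f z \<partial>lborel)"
    by (subst (2) d, subst integral_distr) (auto simp: add.commute)
  show "integrable lborel (\<lambda>z. f (z + c)) \<longleftrightarrow> integrable lborel f"
    by (subst (2) d, subst integrable_distr_eq) (auto simp: add.commute)
qed

text \<open>The circle measure averages translations, and each translation can be moved from
  \<open>f\<close> to \<open>p\<close> by invariance of Lebesgue measure. As \<open>f\<close> is
  only locally integrable and circles are null sets, integrability on a circle can be expected only
  for almost every centre; the third claim records this.\<close>

lemma circle_average_Fubini:
  fixes p :: "complex \<Rightarrow> complex" and f :: "complex \<Rightarrow> real"
  assumes f: "loc_integrable f" and [measurable]: "p \<in> borel_measurable borel" and r: "r > 0"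
    and p: "\<And>z. norm (p z) \<le> B" "\<And>z. norm z > R \<Longrightarrow> p z = 0"
  shows "integrable lborel (\<lambda>z. p z * complex_of_real (\<integral>\<zeta>. f (z + \<zeta>) \<partial>circle_measure r))"
    and "(\<integral>z. p z * complex_of_real (\<integral>\<zeta>. f (z + \<zeta>) \<partial>circle_measure r) \<partial>lborel) =
      (\<integral>z. (\<integral>\<zeta>. p (z - \<zeta>) \<partial>circle_measure r) * complex_of_real (f z) \<partial>lborel)"
    and "AE z in lborel. integrable (circle_measure r) (\<lambda>\<zeta>. p z * complex_of_real (f (z + \<zeta>)))"
proof -
  have [measurable]: "f \<in> borel_measurable borel" using f by measurable
  interpret C: prob_space "circle_measure r" by (rule prob_space_circle_measure)
  interpret P: pair_sigma_finite lborel "circle_measure r" by standard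
  interpret Q: pair_sigma_finite "circle_measure r" lborel by standard
  define G where "G = (\<lambda>(z, \<zeta>). p (z - \<zeta>) * complex_of_real (f z))"
  define F where "F = (\<lambda>(z, \<zeta>). p z * complex_of_real (f (z + \<zeta>)))"
  have [measurable]: "G \<in> borel_measurable (lborel \<Otimes>\<^sub>M circle_measure r)" "F \<in> borel_measurable (lborel \<Otimes>\<^sub>M circle_measure r)"
    unfolding G_def F_def by measurable
  have B: "0 \<le> B" using p(1)[of 0] norm_ge_zero order_trans by blast
  have pint: "integrable (circle_measure r) (\<lambda>\<zeta>. p (z - \<zeta>))" for z
    by (rule C.integrable_const_bound[of _ B]) (use p in auto)
  \<comment> \<open>\<open>G\<close> is dominated by \<open>B * \<bar>f z\<bar>\<close> on a disc
    enlarged by \<open>r\<close>, a bound that does not involve the point of the circle.\<close>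
  have Gint: "integrable (lborel \<Otimes>\<^sub>M circle_measure r) G"
  proof (rule P.Fubini_integrable)
    show "AE z in lborel. integrable (circle_measure r) (\<lambda>\<zeta>. G (z, \<zeta>))"
      unfolding G_def using pint by (intro AE_I2) auto
    show "integrable lborel (\<lambda>z. \<integral>\<zeta>. norm (G (z, \<zeta>)) \<partial>circle_measure r)"
    proof (rule Bochner_Integration.integrable_bound)
      show "integrable lborel (\<lambda>z. B *\<^sub>R (indicator (cball 0 (R + r)) z *\<^sub>R f z))"
        using f unfolding loc_integrable_def by (intro integrable_scaleR_right) auto
      show "AE z in lborel. norm (\<integral>\<zeta>. norm (G (z, \<zeta>)) \<partial>circle_measure r) \<le> norm (B *\<^sub>R (indicator (cball 0 (R + r)) z *\<^sub>R f z))"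
      proof (rule AE_I2)
        fix z
        have "(\<integral>\<zeta>. norm (G (z, \<zeta>)) \<partial>circle_measure r) \<le> (\<integral>\<zeta>. B * indicator (cball 0 (R + r)) z * \<bar>f z\<bar> \<partial>circle_measure r)"
        proof (rule integral_mono_AE)
          show "integrable (circle_measure r) (\<lambda>\<zeta>. norm (G (z, \<zeta>)))"
            unfolding G_def using pint by auto
          show "AE \<zeta> in circle_measure r. norm (G (z, \<zeta>)) \<le> B * indicator (cball 0 (R + r)) z * \<bar>f z\<bar>"
          proof (rule AE_mp[OF circle_measure_norm_AE], use r in simp, intro AE_I2 impI)
            fix \<zeta> :: complex assume n: "norm \<zeta> = r"
            have "norm (p (z - \<zeta>)) \<le> B * indicator (cball 0 (R + r)) z"
            proof (cases "norm z \<le> R + r")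
              case False
              then have "norm (z - \<zeta>) > R" using norm_triangle_ineq2[of z \<zeta>] n by linarith
              then show ?thesis using p(2) False by simp
            qed (use p in simp)
            then show "norm (G (z, \<zeta>)) \<le> B * indicator (cball 0 (R + r)) z * \<bar>f z\<bar>"
              by (simp add: G_def norm_mult mult_right_mono)
          qed
        qed auto
        then show "norm (\<integral>\<zeta>. norm (G (z, \<zeta>)) \<partial>circle_measure r) \<le> norm (B *\<^sub>R (indicator (cball 0 (R + r)) z *\<^sub>R f z))"
          using B C.prob_space by (auto simp: abs_mult indicator_def)
      qed
    qed simp
  qed simp
  \<comment> \<open>For fixed \<open>\<zeta>\<close> the two integrands are translates of each
    other, so integrability and integrals in \<open>z\<close> pass from \<open>G\<close> to
    \<open>F\<close>.\<close>
  have shift: "F (z, \<zeta>) = G (z + \<zeta>, \<zeta>)" for z \<zeta> by (simp add: F_def G_def)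
  have Gswap: "integrable (circle_measure r \<Otimes>\<^sub>M lborel) (\<lambda>(\<zeta>, z). G (z, \<zeta>))"
    using P.integrable_product_swap[OF Gint] .
  have Fswap: "integrable (circle_measure r \<Otimes>\<^sub>M lborel) (\<lambda>(\<zeta>, z). F (z, \<zeta>))"
  proof (rule Q.Fubini_integrable)
    have "integrable (circle_measure r) (\<lambda>\<zeta>. \<integral>z. norm (G (z, \<zeta>)) \<partial>lborel)"
      using Q.integrable_fst'[OF integrable_norm[OF Gswap]] by simp
    moreover have "(\<integral>z. norm (F (z, \<zeta>)) \<partial>lborel) = (\<integral>z. norm (G (z, \<zeta>)) \<partial>lborel)" for \<zeta>
      unfolding shift by (rule lborel_translation(1)) measurable
    ultimately show "integrable (circle_measure r) (\<lambda>\<zeta>. \<integral>z. norm (case (\<zeta>, z) of (\<zeta>, z) \<Rightarrow> F (z, \<zeta>)) \<partial>lborel)"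
      by simp
    have "AE \<zeta> in circle_measure r. integrable lborel (\<lambda>z. G (z, \<zeta>))"
      using Q.AE_integrable_fst'[OF Gswap] by simp
    moreover have "integrable lborel (\<lambda>z. F (z, \<zeta>)) \<longleftrightarrow> integrable lborel (\<lambda>z. G (z, \<zeta>))" for \<zeta>
      unfolding shift by (rule lborel_translation(2)) measurable
    ultimately show "AE \<zeta> in circle_measure r. integrable lborel (\<lambda>z. case (\<zeta>, z) of (\<zeta>, z) \<Rightarrow> F (z, \<zeta>))"
      by simp
  qed measurable
  have Fint: "integrable (lborel \<Otimes>\<^sub>M circle_measure r) F"
    using Q.integrable_product_swap[OF Fswap] by (simp add: split_beta)
  have inF: "(\<integral>\<zeta>. F (z, \<zeta>) \<partial>circle_measure r) = p z * complex_of_real (\<integral>\<zeta>. f (z + \<zeta>) \<partial>circle_measure r)" for z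
    by (simp add: F_def)
  have inG: "(\<integral>\<zeta>. G (z, \<zeta>) \<partial>circle_measure r) = (\<integral>\<zeta>. p (z - \<zeta>) \<partial>circle_measure r) * complex_of_real (f z)" for z
    by (simp add: G_def)
  show "integrable lborel (\<lambda>z. p z * complex_of_real (\<integral>\<zeta>. f (z + \<zeta>) \<partial>circle_measure r))"
    using P.integrable_fst'[OF Fint] unfolding inF .
  show "AE z in lborel. integrable (circle_measure r) (\<lambda>\<zeta>. p z * complex_of_real (f (z + \<zeta>)))"
    using P.AE_integrable_fst'[OF Fint] by (simp add: F_def)
  have "(\<integral>z. (\<integral>\<zeta>. F (z, \<zeta>) \<partial>circle_measure r) \<partial>lborel) = (\<integral>\<zeta>. (\<integral>z. F (z, \<zeta>) \<partial>lborel) \<partial>circle_measure r)"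
    using P.Fubini_integral[of "\<lambda>z \<zeta>. F (z, \<zeta>)"] Fint by simp
  also have "\<dots> = (\<integral>\<zeta>. (\<integral>z. G (z, \<zeta>) \<partial>lborel) \<partial>circle_measure r)"
  proof (rule Bochner_Integration.integral_cong[OF refl])
    fix \<zeta> show "(\<integral>z. F (z, \<zeta>) \<partial>lborel) = (\<integral>z. G (z, \<zeta>) \<partial>lborel)"
      unfolding shift by (rule lborel_translation(1)) measurable
  qed
  also have "\<dots> = (\<integral>z. (\<integral>\<zeta>. G (z, \<zeta>) \<partial>circle_measure r) \<partial>lborel)"
    using P.Fubini_integral[of "\<lambda>z \<zeta>. G (z, \<zeta>)"] Gint by simp
  finally show "(\<integral>z. p z * complex_of_real (\<integral>\<zeta>. f (z + \<zeta>) \<partial>circle_measure r) \<partial>lborel) =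
      (\<integral>z. (\<integral>\<zeta>. p (z - \<zeta>) \<partial>circle_measure r) * complex_of_real (f z) \<partial>lborel)"
    unfolding inF inG .
qed

lemma measure_circle_measure_UNIV [simp]: "measure (circle_measure r) UNIV = 1"
  using prob_space.prob_space[OF prob_space_circle_measure[of r]] by simp

lemma circle_measure_bounded_integrable:
  fixes f :: "complex \<Rightarrow> 'b::{banach, second_countable_topology}"
  assumes [measurable]: "f \<in> borel_measurable borel" and r: "r \<ge> 0" and "\<And>\<zeta>. norm \<zeta> = r \<Longrightarrow> norm (f \<zeta>) \<le> B"
  shows "integrable (circle_measure r) f"
proof -
  interpret C: prob_space "circle_measure r" by (rule prob_space_circle_measure)
  show ?thesis
    by (rule C.integrable_const_bound[of _ B])
       (rule AE_mp[OF circle_measure_norm_AE[OF r]], use assms in auto)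
qed

text \<open>Integrates the Taylor polynomial over the circle: the first moments and the mixed second
  moment vanish, the pure second moments are \<open>r\<^sup>2 / 2\<close>, and the factor 1/2 of the
  expansion turns this into \<open>r\<^sup>2 / 4\<close>. The points are written
  \<open>z - \<zeta>\<close> to match \<open>circle_average_Fubini\<close>.\<close>

lemma circle_average_expansion:
  assumes p: "test_function p" and e: "e > 0"
  obtains d where "d > 0" "\<And>r z. 0 < r \<Longrightarrow> r < d \<Longrightarrow>
     norm ((\<integral>\<zeta>. p (z - \<zeta>) \<partial>circle_measure r) - p z - (r\<^sup>2/4) *\<^sub>R laplacian p z) \<le> e * r\<^sup>2"
proof -
  obtain d where d: "d > 0" "\<And>z h. norm h < d \<Longrightarrow> norm (p (z + h) - p z - dir_deriv p z h - (1/2) *\<^sub>R dir_deriv2 p z h) \<le> e * (norm h)\<^sup>2"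
    using taylor2[OF p e] by metis
  have [measurable]: "p \<in> borel_measurable borel" by (rule test_function_measurable[OF p])
  have "norm ((\<integral>\<zeta>. p (z - \<zeta>) \<partial>circle_measure r) - p z - (r\<^sup>2/4) *\<^sub>R laplacian p z) \<le> e * r\<^sup>2" if r: "0 < r" "r < d" for r z
  proof -
    interpret C: prob_space "circle_measure r" by (rule prob_space_circle_measure)
    define a b c1 c2 c3 c4 where
      "a = frechet_derivative p (at z) 1" "b = frechet_derivative p (at z) \<i>"
      "c1 = frechet_derivative (\<lambda>w. frechet_derivative p (at w) 1) (at z) 1"
      "c2 = frechet_derivative (\<lambda>w. frechet_derivative p (at w) 1) (at z) \<i>"
      "c3 = frechet_derivative (\<lambda>w. frechet_derivative p (at w) \<i>) (at z) 1"
      "c4 = frechet_derivative (\<lambda>w. frechet_derivative p (at w) \<i>) (at z) \<i>"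
    note defs = this
    define T where "T = (\<lambda>\<zeta>. p z - (Re \<zeta> *\<^sub>R a + Im \<zeta> *\<^sub>R b) + (1/2) *\<^sub>R
        ((Re \<zeta> * Re \<zeta>) *\<^sub>R c1 + (Re \<zeta> * Im \<zeta>) *\<^sub>R (c2 + c3) + (Im \<zeta> * Im \<zeta>) *\<^sub>R c4))"
    have T: "norm (p (z - \<zeta>) - T \<zeta>) \<le> e * r\<^sup>2" if "norm \<zeta> = r" for \<zeta>
    proof -
      have "p (z - \<zeta>) - T \<zeta> = p (z + - \<zeta>) - p z - dir_deriv p z (-\<zeta>) - (1/2) *\<^sub>R dir_deriv2 p z (-\<zeta>)"
        unfolding T_def dir_deriv_def dir_deriv2_def defs by (simp add: algebra_simps)
      show ?thesis unfolding \<open>p (z - \<zeta>) - T \<zeta> = _\<close> using d(2)[of "-\<zeta>" z] that r by simp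
    qed
    have le: "\<bar>Re \<zeta>\<bar> \<le> r" "\<bar>Im \<zeta>\<bar> \<le> r" if "norm \<zeta> = r" for \<zeta>
      using that abs_Re_le_cmod[of \<zeta>] abs_Im_le_cmod[of \<zeta>] by auto
    have i1: "integrable (circle_measure r) (\<lambda>\<zeta>. Re \<zeta>)" "integrable (circle_measure r) (\<lambda>\<zeta>. Im \<zeta>)"
      using le r by (auto intro!: circle_measure_bounded_integrable[where B=r])
    have i2: "integrable (circle_measure r) (\<lambda>\<zeta>. Re \<zeta> * Re \<zeta>)" "integrable (circle_measure r) (\<lambda>\<zeta>. Re \<zeta> * Im \<zeta>)" "integrable (circle_measure r) (\<lambda>\<zeta>. Im \<zeta> * Im \<zeta>)"
    proof -
      have *: "integrable (circle_measure r) (\<lambda>\<zeta>. f \<zeta> * g \<zeta>)"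
        if [measurable]: "f \<in> borel_measurable borel" "g \<in> borel_measurable borel"
          and "\<And>\<zeta>. norm \<zeta> = r \<Longrightarrow> \<bar>f \<zeta>\<bar> \<le> r" "\<And>\<zeta>. norm \<zeta> = r \<Longrightarrow> \<bar>g \<zeta>\<bar> \<le> r" for f g :: "complex \<Rightarrow> real"
      proof (rule circle_measure_bounded_integrable[where B="r*r"])
        show "norm (f \<zeta> * g \<zeta>) \<le> r * r" if "norm \<zeta> = r" for \<zeta>
          unfolding real_norm_def abs_mult using that r \<open>\<And>\<zeta>. norm \<zeta> = r \<Longrightarrow> \<bar>f \<zeta>\<bar> \<le> r\<close> \<open>\<And>\<zeta>. norm \<zeta> = r \<Longrightarrow> \<bar>g \<zeta>\<bar> \<le> r\<close>
          by (intro mult_mono) auto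
      qed (use r in auto)
      show "integrable (circle_measure r) (\<lambda>\<zeta>. Re \<zeta> * Re \<zeta>)" "integrable (circle_measure r) (\<lambda>\<zeta>. Re \<zeta> * Im \<zeta>)" "integrable (circle_measure r) (\<lambda>\<zeta>. Im \<zeta> * Im \<zeta>)"
        by (rule *; use le in simp)+
    qed
    have iT: "integrable (circle_measure r) T"
      unfolding T_def using i1 i2 by auto
    have m5: "(\<integral>\<zeta>. Im \<zeta> * Re \<zeta> \<partial>circle_measure r) = 0"
      by (subst mult.commute) (rule circle_moments(5))
    have eT: "(\<integral>\<zeta>. T \<zeta> \<partial>circle_measure r) = p z + (r\<^sup>2/4) *\<^sub>R laplacian p z"
      unfolding T_def using i1 i2
      by (simp add: circle_moments m5 C.prob_space laplacian_def defs algebra_simps)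
    obtain B where B: "\<And>z. norm (p z) \<le> B" using test_function_bounded[OF p] by metis
    have ip: "integrable (circle_measure r) (\<lambda>\<zeta>. p (z - \<zeta>))"
      using B r by (intro circle_measure_bounded_integrable[where B=B]) auto
    have "(\<integral>\<zeta>. p (z - \<zeta>) \<partial>circle_measure r) - p z - (r\<^sup>2/4) *\<^sub>R laplacian p z = (\<integral>\<zeta>. p (z - \<zeta>) - T \<zeta> \<partial>circle_measure r)"
      using ip iT by (simp add: eT)
    also have "norm \<dots> \<le> (\<integral>\<zeta>. norm (p (z - \<zeta>) - T \<zeta>) \<partial>circle_measure r)" by (rule integral_norm_bound)
    also have "\<dots> \<le> (\<integral>\<zeta>. e * r\<^sup>2 \<partial>circle_measure r)"
    proof (rule integral_mono_AE)
      show "integrable (circle_measure r) (\<lambda>\<zeta>. norm (p (z - \<zeta>) - T \<zeta>))" using ip iT by auto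
      show "AE \<zeta> in circle_measure r. norm (p (z - \<zeta>) - T \<zeta>) \<le> e * r\<^sup>2"
        by (rule AE_mp[OF circle_measure_norm_AE]) (use T r in simp_all)
    qed simp
    finally show ?thesis by (simp add: C.prob_space)
  qed
  then show ?thesis using that d(1) by blast
qed

section \<open>The distributional Laplacian as a limit of circle averages\<close>

lemma laplacian_test_function:
  assumes p: "test_function p"
  shows "laplacian p \<in> borel_measurable borel" "\<exists>B. \<forall>z. norm (laplacian p z) \<le> B"
    "\<And>z. z \<notin> supp_fun p \<Longrightarrow> laplacian p z = 0"
proof -
  define g where "g = (\<lambda>a z. frechet_derivative (\<lambda>w. frechet_derivative p (at w) a) (at z) a)"
  have l: "laplacian p = (\<lambda>z. g 1 z + g \<i> z)" by (simp add: laplacian_def g_def fun_eq_iff)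
  have t: "test_function (g a)" for a unfolding g_def by (intro test_function_frechet_derivative p)
  show "laplacian p \<in> borel_measurable borel" unfolding l
    by (intro borel_measurable_add test_function_measurable t)
  obtain A B where "\<And>z. norm (g 1 z) \<le> A" "\<And>z. norm (g \<i> z) \<le> B"
    using test_function_bounded[OF t[of 1]] test_function_bounded[OF t[of \<i>]] by metis
  then have "norm (laplacian p z) \<le> A + B" for z
    unfolding l by (intro norm_triangle_le add_mono) auto
  then show "\<exists>B. \<forall>z. norm (laplacian p z) \<le> B" by blast
  have s: "supp_fun (\<lambda>w. frechet_derivative p (at w) a) \<subseteq> supp_fun p" for a
    by (rule supp_fun_frechet_derivative)
  show "laplacian p z = 0" if "z \<notin> supp_fun p" for z
  proof -
    have "g a z = 0" for a
      unfolding g_def by (rule frechet_derivative_outside_supp_fun) (use that s[of a] in auto)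
    then show ?thesis by (simp add: l)
  qed
qed

text \<open>The average is moved onto \<open>p\<close>, where the expansion applies with an error
  uniform in \<open>z\<close>. It is used with \<open>f = 1\<close>, with translated logarithms and
  with the maximum of the potentials.\<close>

lemma laplacian_limit:
  assumes f: "loc_integrable f" and p: "test_function p"
  shows "((\<lambda>r. complex_of_real (4/r\<^sup>2) * (\<integral>z. p z * complex_of_real ((\<integral>\<zeta>. f (z + \<zeta>) \<partial>circle_measure r) - f z) \<partial>lborel))
     \<longlongrightarrow> (\<integral>z. laplacian p z * complex_of_real (f z) \<partial>lborel)) (at_right 0)"
proof (rule tendstoI)
  fix \<epsilon> :: real assume \<epsilon>: "\<epsilon> > 0"
  have [measurable]: "f \<in> borel_measurable borel" "p \<in> borel_measurable borel" "laplacian p \<in> borel_measurable borel"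
    using f test_function_measurable[OF p] laplacian_test_function(1)[OF p] by measurable
  obtain R where R: "R > 0" "\<And>z. norm z > R \<Longrightarrow> p z = 0" "supp_fun p \<subseteq> cball 0 R"
  proof -
    have "bounded (supp_fun p)" using p by (simp add: test_function_def compact_imp_bounded)
    then obtain R where "R > 0" and Rb: "\<forall>x\<in>supp_fun p. norm x \<le> R" unfolding bounded_pos by blast
    moreover have "supp_fun p \<subseteq> cball 0 R" using Rb by auto
    moreover have "p z = 0" if "norm z > R" for z
      using Rb that by (intro eq_0_outside_supp_fun) auto
    ultimately show ?thesis using that by blast
  qed
  obtain B where B: "\<And>z. norm (p z) \<le> B" using test_function_bounded[OF p] by metis
  obtain L where L: "\<And>z. norm (laplacian p z) \<le> L" using laplacian_test_function(2)[OF p] by metis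
  have L0: "laplacian p z = 0" if "norm z > R" for z
    using R(3) that by (intro laplacian_test_function(3)[OF p]) auto
  \<comment> \<open>For \<open>r < 1\<close> the averages of \<open>p\<close> vanish off the disc of
    radius \<open>R + 1\<close>, so the mass of |f| on that disc controls the error.\<close>
  define I where "I = (\<integral>z. indicator (cball 0 (R+1)) z * \<bar>f z\<bar> \<partial>lborel)"
  have fint: "integrable lborel (\<lambda>z. indicator (cball 0 (R+1)) z * \<bar>f z\<bar>)"
  proof -
    have "integrable lborel (\<lambda>z. norm (indicator (cball 0 (R+1)) z *\<^sub>R f z))"
      using f unfolding loc_integrable_def by (intro integrable_norm) auto
    then show ?thesis by (simp add: abs_mult)
  qed
  have I: "I \<ge> 0" unfolding I_def by (rule integral_nonneg_AE) simp
  \<comment> \<open>The expansion error \<open>e * r\<^sup>2\<close> is multiplied by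
    \<open>4/r\<^sup>2\<close>; the total error \<open>4 * e * I\<close> is then at most half of
    \<open>\<epsilon>\<close>.\<close>
  define e where "e = \<epsilon> / (8 * (I + 1))"
  have e: "e > 0" using \<epsilon> I by (simp add: e_def)
  obtain d where d: "d > 0" "\<And>r z. 0 < r \<Longrightarrow> r < d \<Longrightarrow>
     norm ((\<integral>\<zeta>. p (z - \<zeta>) \<partial>circle_measure r) - p z - (r\<^sup>2/4) *\<^sub>R laplacian p z) \<le> e * r\<^sup>2"
    using circle_average_expansion[OF p e] by metis
  have "dist (complex_of_real (4/r\<^sup>2) * (\<integral>z. p z * complex_of_real ((\<integral>\<zeta>. f (z + \<zeta>) \<partial>circle_measure r) - f z) \<partial>lborel))
     (\<integral>z. laplacian p z * complex_of_real (f z) \<partial>lborel) < \<epsilon>" if r: "0 < r" "r < min d 1" for r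
  proof -
    interpret C: prob_space "circle_measure r" by (rule prob_space_circle_measure)
    define q where "q = (\<lambda>z. \<integral>\<zeta>. p (z - \<zeta>) \<partial>circle_measure r)"
    have [measurable]: "q \<in> borel_measurable borel" unfolding q_def by measurable
    have qb: "norm (q z) \<le> B" for z
    proof -
      have "norm (q z) \<le> (\<integral>\<zeta>. norm (p (z - \<zeta>)) \<partial>circle_measure r)" unfolding q_def by (rule integral_norm_bound)
      also have "\<dots> \<le> (\<integral>\<zeta>. B \<partial>circle_measure r)"
        by (rule integral_mono) (use B r in \<open>auto intro!: circle_measure_bounded_integrable[where B=B]\<close>)
      finally show ?thesis by (simp add: C.prob_space)
    qed
    have q0: "q z = 0" if z: "norm z > R + 1" for z
    proof -
      have "AE \<zeta> in circle_measure r. p (z - \<zeta>) = 0"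
      proof (rule AE_mp[OF circle_measure_norm_AE], use r in simp, intro AE_I2 impI)
        fix \<zeta> :: complex assume "norm \<zeta> = r"
        then have "norm (z - \<zeta>) > R" using norm_triangle_ineq2[of z \<zeta>] z r by simp
        then show "p (z - \<zeta>) = 0" by (rule R)
      qed
      then show ?thesis unfolding q_def by (subst integral_cong_AE[where g="\<lambda>_. 0"]) auto
    qed
    have i1: "integrable lborel (\<lambda>z. p z * complex_of_real (\<integral>\<zeta>. f (z + \<zeta>) \<partial>circle_measure r))"
      by (rule circle_average_Fubini(1)[OF f _ r(1) B R(2)]) measurable
    have i2: "integrable lborel (\<lambda>z. p z * complex_of_real (f z))"
      by (rule loc_integrable_mult[OF f _ B R(2)]) measurable
    have i3: "integrable lborel (\<lambda>z. q z * complex_of_real (f z))"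
      by (rule loc_integrable_mult[OF f _ qb q0]) measurable
    have i4: "integrable lborel (\<lambda>z. laplacian p z * complex_of_real (f z))"
      by (rule loc_integrable_mult[OF f _ L L0]) measurable
    define h where "h = (\<lambda>z. complex_of_real (4/r\<^sup>2) * (q z - p z) - laplacian p z)"
    have h: "norm (h z) \<le> 4 * e * indicator (cball 0 (R+1)) z" for z
    proof (cases "norm z > R + 1")
      case True
      then show ?thesis using q0 R(2) L0 e by (simp add: h_def)
    next
      case False
      have "h z = complex_of_real (4/r\<^sup>2) * (q z - p z - (r\<^sup>2/4) *\<^sub>R laplacian p z)"
        using r by (simp add: h_def scaleR_conv_of_real field_simps)
      also have "norm \<dots> = 4/r\<^sup>2 * norm (q z - p z - (r\<^sup>2/4) *\<^sub>R laplacian p z)"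
        by (simp only: norm_mult norm_of_real) simp
      also have "\<dots> \<le> 4/r\<^sup>2 * (e * r\<^sup>2)"
        using d(2)[of r z] r unfolding q_def by (intro mult_left_mono) auto
      finally show ?thesis using r False by simp
    qed
    have "complex_of_real (4/r\<^sup>2) * (\<integral>z. p z * complex_of_real ((\<integral>\<zeta>. f (z + \<zeta>) \<partial>circle_measure r) - f z) \<partial>lborel)
        - (\<integral>z. laplacian p z * complex_of_real (f z) \<partial>lborel)
      = complex_of_real (4/r\<^sup>2) * ((\<integral>z. p z * complex_of_real (\<integral>\<zeta>. f (z + \<zeta>) \<partial>circle_measure r) \<partial>lborel) - (\<integral>z. p z * complex_of_real (f z) \<partial>lborel))
        - (\<integral>z. laplacian p z * complex_of_real (f z) \<partial>lborel)"
      using i1 i2 by (simp add: right_diff_distrib)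
    also have "(\<integral>z. p z * complex_of_real (\<integral>\<zeta>. f (z + \<zeta>) \<partial>circle_measure r) \<partial>lborel) = (\<integral>z. q z * complex_of_real (f z) \<partial>lborel)"
      unfolding q_def by (rule circle_average_Fubini(2)[OF f _ r(1) B R(2)]) measurable
    also have "complex_of_real (4/r\<^sup>2) * ((\<integral>z. q z * complex_of_real (f z) \<partial>lborel) - (\<integral>z. p z * complex_of_real (f z) \<partial>lborel))
        - (\<integral>z. laplacian p z * complex_of_real (f z) \<partial>lborel) = (\<integral>z. h z * complex_of_real (f z) \<partial>lborel)"
      unfolding h_def using i2 i3 i4 by (simp add: left_diff_distrib right_diff_distrib mult.assoc)
    also have "norm \<dots> \<le> (\<integral>z. 4 * e * (indicator (cball 0 (R+1)) z * \<bar>f z\<bar>) \<partial>lborel)"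
    proof (rule norm_integral_le)
      show "integrable lborel (\<lambda>z. h z * complex_of_real (f z))"
        unfolding h_def using i2 i3 i4 by (simp add: left_diff_distrib right_diff_distrib mult.assoc)
      show "integrable lborel (\<lambda>z. 4 * e * (indicator (cball 0 (R+1)) z * \<bar>f z\<bar>))" using fint by (intro integrable_mult_right)
      show "norm (h z * complex_of_real (f z)) \<le> 4 * e * (indicator (cball 0 (R+1)) z * \<bar>f z\<bar>)" for z
        using h[of z] by (simp add: norm_mult mult.assoc[symmetric] mult_right_mono)
    qed
    also have "\<dots> = 4 * e * I" by (simp add: I_def)
    also have "\<dots> < \<epsilon>" unfolding e_def using \<epsilon> I by (simp add: field_simps add_pos_nonneg)
    finally show ?thesis by (simp add: dist_norm)
  qed
  then show "\<forall>\<^sub>F r in at_right 0. dist (complex_of_real (4/r\<^sup>2) * (\<integral>z. p z * complex_of_real ((\<integral>\<zeta>. f (z + \<zeta>) \<partial>circle_measure r) - f z) \<partial>lborel))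
     (\<integral>z. laplacian p z * complex_of_real (f z) \<partial>lborel) < \<epsilon>"
    using d(1) by (intro eventually_at_rightI[of 0 "min d 1"]) auto
qed

section \<open>The logarithm as fundamental solution\<close>

lemma abs_ln_norm_le: "\<bar>ln (norm a)\<bar> \<le> lneg 1 a + norm (a :: complex)"
proof (cases "a = 0")
  case False
  then have "ln (norm a) \<le> norm a" using ln_le_minus_one[of "norm a"] by simp
  moreover have "lneg 1 a = max 0 (- ln (norm a))" using False by (simp add: lneg_def ln_div)
  ultimately show ?thesis using norm_ge_zero[of a] by linarith
qed simp

lemma nn_integral_lborel_translation:
  fixes w :: complex
  assumes [measurable]: "f \<in> borel_measurable borel"
  shows "(\<integral>\<^sup>+z. f (z - w) \<partial>lborel) = (\<integral>\<^sup>+z. f z \<partial>lborel)"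
  by (subst (2) lborel_distr_plus[symmetric, of "-w"], subst nn_integral_distr) auto

lemma integrable_lneg: "r > 0 \<Longrightarrow> integrable lborel (\<lambda>z. lneg r (z - w))"
  by (rule integrableI_nonneg) (auto simp: nn_integral_lborel_translation[of "\<lambda>z. ennreal (lneg r z)"] nn_integral_lneg)

lemma integral_lneg: "r > 0 \<Longrightarrow> (\<integral>z. lneg r (z - w) \<partial>lborel) = pi * r\<^sup>2 / 2"
  by (subst integral_eq_nn_integral) (auto simp: nn_integral_lborel_translation[of "\<lambda>z. ennreal (lneg r z)"] nn_integral_lneg)

lemma loc_integrable_ln: "loc_integrable (\<lambda>z. ln (norm (z - w)))"
  unfolding loc_integrable_def
proof
  fix R
  show "integrable lborel (\<lambda>z. indicator (cball 0 R) z *\<^sub>R ln (norm (z - w)))"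
  proof (rule Bochner_Integration.integrable_bound)
    have "emeasure lborel (cball 0 R :: complex set) < \<infinity>" using emeasure_bounded_finite[of "cball (0::complex) R"] by simp
    then have "integrable lborel (\<lambda>z::complex. indicator (cball 0 R) z * (R + norm w))"
      by (intro integrable_mult_left) (auto simp: integrable_indicator_iff)
    then show "integrable lborel (\<lambda>z. lneg 1 (z - w) + indicator (cball 0 R) z * (R + norm w))"
      using integrable_lneg[of 1 w] by auto
    show "AE z in lborel. norm (indicator (cball 0 R) z *\<^sub>R ln (norm (z - w))) \<le> norm (lneg 1 (z - w) + indicator (cball 0 R) z * (R + norm w))"
    proof (rule AE_I2)
      fix z :: complex
      show "norm (indicator (cball 0 R) z *\<^sub>R ln (norm (z - w))) \<le> norm (lneg 1 (z - w) + indicator (cball 0 R) z * (R + norm w))"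
      proof (cases "norm z \<le> R")
        case True
        then have "norm (z - w) \<le> R + norm w" using norm_triangle_ineq4[of z w] by linarith
        then show ?thesis using abs_ln_norm_le[of "z - w"] True by (auto simp: abs_if)
      qed simp
    qed
  qed (intro borel_measurable_scaleR borel_measurable_indicator, auto)
qed

lemma AE_norm_diff_neq: "AE z in lborel. norm (z - w) \<noteq> (r::real)" for w :: complex
proof -
  have "sphere w r \<in> null_sets lborel"
    using negligible_sphere[of w r] by (simp add: negligible_iff_null_sets null_sets_completion_iff)
  then have "AE z in lborel. z \<notin> sphere w r" by (rule AE_not_in)
  then show ?thesis by (auto simp: dist_norm norm_minus_commute)
qed

text \<open>The kernel \<open>4/r\<^sup>2 * lneg r (z - w)\<close> is an approximate identity: it is
  nonnegative, vanishes off the disc of radius \<open>r\<close> about \<open>w\<close>, and has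
  total mass 2 pi by \<open>integral_lneg\<close>.\<close>

lemma poisson:
  assumes p: "test_function p"
  shows "(\<integral>z. laplacian p z * complex_of_real (ln (norm (z - w))) \<partial>lborel) = complex_of_real (2 * pi) * p w"
proof (rule tendsto_unique[OF _ laplacian_limit[OF loc_integrable_ln p, of w]])
  have [measurable]: "p \<in> borel_measurable borel" by (rule test_function_measurable[OF p])
  obtain B where B: "\<And>z. norm (p z) \<le> B" using test_function_bounded[OF p] by metis
  have eq: "(\<integral>z. p z * complex_of_real ((\<integral>\<zeta>. ln (norm (z + \<zeta> - w)) \<partial>circle_measure r) - ln (norm (z - w))) \<partial>lborel)
    = (\<integral>z. p z * complex_of_real (lneg r (z - w)) \<partial>lborel)" if r: "r > 0" for r
  proof (rule integral_cong_AE)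
    interpret C: prob_space "circle_measure r" by (rule prob_space_circle_measure)
    show "(\<lambda>z. p z * complex_of_real ((\<integral>\<zeta>. ln (norm (z + \<zeta> - w)) \<partial>circle_measure r) - ln (norm (z - w)))) \<in> borel_measurable lborel"
      by measurable
    show "AE z in lborel. p z * complex_of_real ((\<integral>\<zeta>. ln (norm (z + \<zeta> - w)) \<partial>circle_measure r) - ln (norm (z - w))) = p z * complex_of_real (lneg r (z - w))"
      using AE_norm_diff_neq[of w r] AE_norm_diff_neq[of w 0]
    proof eventually_elim
      case (elim z)
      have "(\<integral>\<zeta>. ln (norm (z + \<zeta> - w)) \<partial>circle_measure r) = (\<integral>\<zeta>. ln (norm ((z - w) + \<zeta>)) \<partial>circle_measure r)"
        by (simp add: algebra_simps)
      also have "\<dots> = ln (max (norm (z - w)) r)" by (rule circle_mean_ln(2)[OF r elim(1)])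
      also have "\<dots> - ln (norm (z - w)) = lneg r (z - w)"
        using elim r by (auto simp: lneg_def ln_div max_def)
      finally show ?case by simp
    qed
  qed measurable
  have "((\<lambda>r. complex_of_real (4/r\<^sup>2) * (\<integral>z. p z * complex_of_real (lneg r (z - w)) \<partial>lborel)) \<longlongrightarrow> complex_of_real (2*pi) * p w) (at_right 0)"
  proof (rule tendstoI)
    fix \<epsilon> :: real assume \<epsilon>: "\<epsilon> > 0"
    \<comment> \<open>Mass 2 pi times oscillation \<open>e\<close> is half of
      \<open>\<epsilon>\<close>.\<close>
    define e where "e = \<epsilon> / (4 * pi)"
    have e: "e > 0" using \<epsilon> by (simp add: e_def)
    obtain d where d: "d > 0" "\<And>x y. dist x y < d \<Longrightarrow> dist (p x) (p y) < e"
      using test_function_uniformly_continuous[OF p e] by blast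
    have "dist (complex_of_real (4/r\<^sup>2) * (\<integral>z. p z * complex_of_real (lneg r (z - w)) \<partial>lborel)) (complex_of_real (2*pi) * p w) < \<epsilon>"
      if r: "0 < r" "r < d" for r
    proof -
      have il: "integrable lborel (\<lambda>z. complex_of_real (lneg r (z - w)))" using integrable_lneg[OF r(1)] by simp
      have ip: "integrable lborel (\<lambda>z. p z * complex_of_real (lneg r (z - w)))"
      proof (rule Bochner_Integration.integrable_bound)
        show "integrable lborel (\<lambda>z. B * lneg r (z - w))" using integrable_lneg[OF r(1)] by simp
        have "B \<ge> 0" using B[of 0] norm_ge_zero order_trans by blast
        then show "AE z in lborel. norm (p z * complex_of_real (lneg r (z - w))) \<le> norm (B * lneg r (z - w))"
          using B by (intro AE_I2) (auto simp: norm_mult intro!: mult_right_mono)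
      qed measurable
      have "complex_of_real (4/r\<^sup>2) * (\<integral>z. p z * complex_of_real (lneg r (z - w)) \<partial>lborel) - complex_of_real (2*pi) * p w
        = complex_of_real (4/r\<^sup>2) * ((\<integral>z. p z * complex_of_real (lneg r (z - w)) \<partial>lborel) - p w * (\<integral>z. complex_of_real (lneg r (z - w)) \<partial>lborel))"
        using r(1) by (simp add: integral_lneg[OF r(1)] field_simps)
      also have "(\<integral>z. p z * complex_of_real (lneg r (z - w)) \<partial>lborel) - p w * (\<integral>z. complex_of_real (lneg r (z - w)) \<partial>lborel)
        = (\<integral>z. (p z - p w) * complex_of_real (lneg r (z - w)) \<partial>lborel)"
        using il ip by (simp add: left_diff_distrib del: integral_complex_of_real)
      also have "norm (complex_of_real (4/r\<^sup>2) * \<dots>) = 4/r\<^sup>2 * norm (\<integral>z. (p z - p w) * complex_of_real (lneg r (z - w)) \<partial>lborel)"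
        by (simp only: norm_mult norm_of_real) simp
      also have "\<dots> \<le> 4/r\<^sup>2 * (\<integral>z. e * lneg r (z - w) \<partial>lborel)"
      proof (rule mult_left_mono)
        show "norm (\<integral>z. (p z - p w) * complex_of_real (lneg r (z - w)) \<partial>lborel) \<le> (\<integral>z. e * lneg r (z - w) \<partial>lborel)"
        proof (rule norm_integral_le)
          show "integrable lborel (\<lambda>z. (p z - p w) * complex_of_real (lneg r (z - w)))"
            using il ip by (simp add: left_diff_distrib)
          show "integrable lborel (\<lambda>z. e * lneg r (z - w))" using integrable_lneg[OF r(1)] by simp
          fix z
          show "norm ((p z - p w) * complex_of_real (lneg r (z - w))) \<le> e * lneg r (z - w)"
          proof (cases "norm (z - w) < r")
            case True
            then have "norm (p z - p w) \<le> e" using d(2)[of z w] r by (simp add: dist_norm)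
            then show ?thesis by (simp add: norm_mult mult_right_mono)
          next
            case False
            then have "ln (r / norm (z - w)) \<le> ln 1" using r(1) by (intro ln_mono) (auto simp: divide_simps)
            then have "lneg r (z - w) = 0" by (simp add: lneg_def)
            then show ?thesis by simp
          qed
        qed
      qed simp
      also have "\<dots> = 2 * pi * e" using r(1) by (simp add: integral_lneg[OF r(1)])
      also have "\<dots> < \<epsilon>" using \<epsilon> by (simp add: e_def)
      finally show ?thesis by (simp add: dist_norm)
    qed
    then show "\<forall>\<^sub>F r in at_right 0. dist (complex_of_real (4/r\<^sup>2) * (\<integral>z. p z * complex_of_real (lneg r (z - w)) \<partial>lborel)) (complex_of_real (2*pi) * p w) < \<epsilon>"
      using d(1) by (intro eventually_at_rightI[of 0 d]) auto
  qed
  then show "((\<lambda>r. complex_of_real (4/r\<^sup>2) * (\<integral>z. p z * complex_of_real ((\<integral>\<zeta>. ln (norm (z + \<zeta> - w)) \<partial>circle_measure r) - ln (norm (z - w))) \<partial>lborel))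
    \<longlongrightarrow> complex_of_real (2*pi) * p w) (at_right 0)"
  proof (rule Lim_transform_eventually)
    show "\<forall>\<^sub>F r in at_right 0. complex_of_real (4/r\<^sup>2) * (\<integral>z. p z * complex_of_real (lneg r (z - w)) \<partial>lborel) =
      complex_of_real (4/r\<^sup>2) * (\<integral>z. p z * complex_of_real ((\<integral>\<zeta>. ln (norm (z + \<zeta> - w)) \<partial>circle_measure r) - ln (norm (z - w))) \<partial>lborel)"
    proof (rule eventually_at_rightI[of 0 1])
      fix r :: real assume "r \<in> {0<..<1}"
      then have "r > 0" by simp
      show "complex_of_real (4/r\<^sup>2) * (\<integral>z. p z * complex_of_real (lneg r (z - w)) \<partial>lborel) =
        complex_of_real (4/r\<^sup>2) * (\<integral>z. p z * complex_of_real ((\<integral>\<zeta>. ln (norm (z + \<zeta> - w)) \<partial>circle_measure r) - ln (norm (z - w))) \<partial>lborel)"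
        unfolding eq[OF \<open>r > 0\<close>] ..
    qed simp
  qed
qed simp

text \<open>The case \<open>f = 1\<close> of the limit: a constant equals its circle averages. It
  later removes the leading coefficient \<open>m\<close> from the logarithm of the
  polynomial.\<close>

lemma integral_laplacian:
  assumes p: "test_function p"
  shows "(\<integral>z. laplacian p z \<partial>lborel) = 0"
proof -
  have c: "loc_integrable (\<lambda>_. 1)"
    unfolding loc_integrable_def using emeasure_lborel_cball_finite[of "0::complex"]
    by (auto simp: integrable_indicator_iff)
  have "(\<integral>\<zeta>. (1::real) \<partial>circle_measure r) = 1" for r
    using prob_space.prob_space[OF prob_space_circle_measure[of r]] by simp
  then have "((\<lambda>r. 0) \<longlongrightarrow> (\<integral>z. laplacian p z \<partial>lborel)) (at_right (0::real))"
    using laplacian_limit[OF c p] by simp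
  then show ?thesis by (simp add: tendsto_const_iff)
qed

section \<open>Smooth bump functions and uniqueness\<close>

text \<open>The classical flat function \<open>exp (- (1/x))\<close> divided by powers of
  \<open>x\<close>. The span of this family is closed under differentiation, see
  \<open>DERIV_flat\<close>.\<close>

definition flat :: "nat \<Rightarrow> real \<Rightarrow> real" where
  "flat j x = (if x > 0 then exp (- (1/x)) / x ^ j else 0)"

lemma flat_nonneg: "0 \<le> flat j x" by (simp add: flat_def)

lemma flat_0_le_1: "flat 0 x \<le> 1" by (simp add: flat_def)

text \<open>Exponential decay beats every power of \<open>1 / h\<close>; this is differentiability
  at 0, where the two branches of \<open>flat\<close> meet.\<close>

lemma flat_quotient_tendsto_0: "((\<lambda>h. flat j h / h) \<longlongrightarrow> 0) (at 0)"
proof -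
  have "((\<lambda>h. exp (- inverse h) * inverse h ^ Suc j) \<longlongrightarrow> 0) (at_right (0::real))"
  proof -
    have "((\<lambda>t::real. t ^ Suc j / exp t) \<longlongrightarrow> 0) at_top" by (rule tendsto_power_div_exp_0)
    from filterlim_compose[OF this filterlim_inverse_at_top_right]
    show ?thesis by (simp add: exp_minus field_simps)
  qed
  then have "((\<lambda>h. flat j h / h) \<longlongrightarrow> 0) (at_right 0)"
    by (rule Lim_transform_eventually)
       (auto intro!: eventually_at_rightI[of 0 1] simp: flat_def field_simps)
  moreover have "((\<lambda>h. flat j h / h) \<longlongrightarrow> 0) (at_left 0)"
    by (rule tendsto_eventually) (auto intro!: eventually_at_leftI[of "-1"] simp: flat_def)
  ultimately show ?thesis by (simp add: filterlim_split_at)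
qed

lemma DERIV_flat: "(flat j has_real_derivative flat (j+2) x - real j * flat (j+1) x) (at x)"
proof (cases x "0::real" rule: linorder_cases)
  case less
  have "((\<lambda>_. 0) has_real_derivative 0) (at x)" by simp
  then have "(flat j has_real_derivative 0) (at x)"
    by (rule has_field_derivative_transform_within_open[of _ _ _ "{..<0}"]) (use less in \<open>auto simp: flat_def\<close>)
  then show ?thesis using less by (simp add: flat_def)
next
  case equal
  have "((\<lambda>h. (flat j (0 + h) - flat j 0) / h) \<longlongrightarrow> 0) (at 0)"
    using flat_quotient_tendsto_0[of j] by (simp add: flat_def[of j 0])
  then show ?thesis using equal by (simp add: DERIV_def flat_def[of _ 0])
next
  case greater
  have flat_eq: "flat i y = exp (- (1/y)) * (1/y) ^ i" if "y > 0" for i y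
    using that by (simp add: flat_def power_one_over)
  have d: "((\<lambda>x. - (1/x)) has_real_derivative (1/x)\<^sup>2) (at x)"
    using greater by (auto intro!: derivative_eq_intros simp: power2_eq_square)
  have d': "((\<lambda>x. 1/x) has_real_derivative - ((1/x)\<^sup>2)) (at x)"
    using greater by (auto intro!: derivative_eq_intros simp: power2_eq_square)
  have "((\<lambda>x. exp (- (1/x)) * (1/x) ^ j) has_real_derivative
      exp (- (1/x)) * (1/x)\<^sup>2 * (1/x) ^ j + (real j * (- ((1/x)\<^sup>2) * (1/x) ^ (j - 1))) * exp (- (1/x))) (at x)"
    using DERIV_mult[OF DERIV_chain2[OF DERIV_exp d] DERIV_power[OF d', of j]] by simp
  also have "exp (- (1/x)) * (1/x)\<^sup>2 * (1/x) ^ j + (real j * (- ((1/x)\<^sup>2) * (1/x) ^ (j - 1))) * exp (- (1/x)) =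
      flat (j+2) x - real j * flat (j+1) x"
    unfolding flat_eq[OF greater]
    by (cases j) (simp_all add: power_add power2_eq_square algebra_simps del: power_one_over power_divide)
  finally have "((\<lambda>x. exp (- (1/x)) * (1/x) ^ j) has_real_derivative flat (j+2) x - real j * flat (j+1) x) (at x)" .
  then show ?thesis
    by (rule has_field_derivative_transform_within_open[of _ _ _ "{0<..}"]) (use greater flat_eq in auto)
qed

text \<open>\<open>Ck\<close> recurses through all directional derivatives, and differentiating a
  product produces sums of new products. A class generated by sums and products that contains its
  own derivatives lets the induction on the order go through.\<close>

inductive flat_expr :: "(complex \<Rightarrow> complex) \<Rightarrow> bool" where
  const: "flat_expr (\<lambda>_. c)"
| flat: "flat_expr (\<lambda>z. complex_of_real (flat j (a * Re z + b * Im z + c)))"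
| add: "flat_expr f \<Longrightarrow> flat_expr g \<Longrightarrow> flat_expr (\<lambda>z. f z + g z)"
| mult: "flat_expr f \<Longrightarrow> flat_expr g \<Longrightarrow> flat_expr (\<lambda>z. f z * g z)"

text \<open>Closure under directional derivatives makes every member of the class smooth.\<close>

lemma flat_expr_derivative:
  "flat_expr f \<Longrightarrow> \<exists>f'. (\<forall>z. (f has_derivative f' z) (at z)) \<and> (\<forall>v. flat_expr (\<lambda>z. f' z v))"
proof (induction rule: flat_expr.induct)
  case (const c)
  show ?case by (intro exI[of _ "\<lambda>z v. 0"]) (auto intro: flat_expr.const)
next
  case (flat j a b c)
  define L where "L = (\<lambda>v. a * Re v + b * Im v)"
  define D where "D = (\<lambda>z v. complex_of_real ((flat (j+2) (L z + c) - real j * flat (j+1) (L z + c)) * L v))"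
  have "((\<lambda>z. complex_of_real (flat j (L z + c))) has_derivative D z) (at z)" for z
  proof -
    have 1: "((\<lambda>z. L z + c) has_derivative L) (at z)" unfolding L_def by (auto intro!: derivative_eq_intros)
    have "(flat j has_derivative (\<lambda>t. (flat (j+2) (L z + c) - real j * flat (j+1) (L z + c)) * t)) (at (L z + c))"
      using DERIV_flat[of j "L z + c"] by (simp add: has_field_derivative_def)
    from has_derivative_of_real[OF has_derivative_compose[OF 1 this]]
    show ?thesis unfolding D_def .
  qed
  moreover have "flat_expr (\<lambda>z. D z v)" for v
  proof -
    have "flat_expr (\<lambda>z. complex_of_real (flat (j+2) (a * Re z + b * Im z + c)) * complex_of_real (L v)
      + complex_of_real (flat (j+1) (a * Re z + b * Im z + c)) * complex_of_real (- real j * L v))"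
      by (intro flat_expr.intros)
    then show ?thesis by (simp add: D_def L_def algebra_simps)
  qed
  ultimately show ?case unfolding L_def by blast
next
  case (add f g)
  then obtain f' g' where "\<forall>z. (f has_derivative f' z) (at z)" "\<forall>v. flat_expr (\<lambda>z. f' z v)"
    "\<forall>z. (g has_derivative g' z) (at z)" "\<forall>v. flat_expr (\<lambda>z. g' z v)" by blast
  then show ?case
    by (intro exI[of _ "\<lambda>z v. f' z v + g' z v"]) (auto intro: flat_expr.add has_derivative_add)
next
  case (mult f g)
  then obtain f' g' where "\<forall>z. (f has_derivative f' z) (at z)" "\<forall>v. flat_expr (\<lambda>z. f' z v)"
    "\<forall>z. (g has_derivative g' z) (at z)" "\<forall>v. flat_expr (\<lambda>z. g' z v)" by blast
  with mult.hyps show ?case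
    by (intro exI[of _ "\<lambda>z v. f z * g' z v + f' z v * g z"]) (auto intro!: flat_expr.add flat_expr.mult has_derivative_mult)
qed

lemma flat_expr_smooth: "flat_expr f \<Longrightarrow> smooth f"
  unfolding smooth_def
proof (rule allI)
  fix k assume "flat_expr f"
  then show "Ck k f"
  proof (induction k arbitrary: f)
    case 0
    then obtain f' where "\<And>z. (f has_derivative f' z) (at z)" using flat_expr_derivative by blast
    then have "continuous_on UNIV f" by (meson continuous_at_imp_continuous_on has_derivative_continuous)
    then show ?case by simp
  next
    case (Suc k)
    then obtain f' where f': "\<And>z. (f has_derivative f' z) (at z)" "\<And>v. flat_expr (\<lambda>z. f' z v)"
      using flat_expr_derivative by blast
    have "frechet_derivative f (at z) = f' z" for z
      using f'(1) frechet_derivative_at by metis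
    moreover have "f differentiable (at z)" for z using f'(1) by (rule differentiableI)
    ultimately show ?case using Suc.IH[OF f'(2)] by (simp only: Ck.simps simp_thms)
  qed
qed

text \<open>The parameter \<open>n\<close> is a steepness: large values approximate the indicator of
  the open box and yield uniqueness of measures, small values give slowly varying cutoffs on large
  squares.\<close>

definition box_bump :: "real \<Rightarrow> complex \<Rightarrow> complex \<Rightarrow> complex \<Rightarrow> real" where
  "box_bump n a b z = flat 0 (n * (Re z - Re a)) * flat 0 (n * (Re b - Re z)) *
     (flat 0 (n * (Im z - Im a)) * flat 0 (n * (Im b - Im z)))"

lemma box_bump_bounds: "0 \<le> box_bump n a b z" "box_bump n a b z \<le> 1"
  unfolding box_bump_def by (simp_all add: flat_nonneg flat_0_le_1 mult_le_one)

lemma box_bump_eq_0: "n > 0 \<Longrightarrow> z \<notin> box a b \<Longrightarrow> box_bump n a b z = 0"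
  by (auto simp: box_bump_def flat_def in_box_complex_iff zero_less_mult_iff)

lemma test_function_box_bump:
  assumes "n > 0" shows "test_function (\<lambda>z. complex_of_real (box_bump n a b z))"
proof -
  have "flat_expr (\<lambda>z. complex_of_real (flat 0 (n * Re z + 0 * Im z + - n * Re a)) * complex_of_real (flat 0 (- n * Re z + 0 * Im z + n * Re b)) *
     (complex_of_real (flat 0 (0 * Re z + n * Im z + - n * Im a)) * complex_of_real (flat 0 (0 * Re z + - n * Im z + n * Im b))))"
    by (intro flat_expr.intros)
  then have "flat_expr (\<lambda>z. complex_of_real (box_bump n a b z))"
    by (simp add: box_bump_def algebra_simps)
  moreover have "supp_fun (\<lambda>z. complex_of_real (box_bump n a b z)) \<subseteq> cbox a b"
    unfolding supp_fun_def using box_bump_eq_0[OF assms, of _ a b] box_subset_cbox[of a b]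
    by (intro closure_minimal) auto
  then have "compact (supp_fun (\<lambda>z. complex_of_real (box_bump n a b z)))"
    by (metis closed_closure compact_Int_closed compact_cbox inf.absorb_iff2 supp_fun_def)
  ultimately show ?thesis using flat_expr_smooth by (simp add: test_function_def)
qed

lemma flat_0_tendsto: "(\<lambda>n. flat 0 (real n * t)) \<longlonglongrightarrow> (if t > 0 then 1 else 0)"
proof (cases "t > 0")
  case True
  have "(\<lambda>n. exp (- (1 / t) * (1 / real n))) \<longlonglongrightarrow> exp (- (1 / t) * 0)"
    by (intro tendsto_intros lim_1_over_n)
  then have "(\<lambda>n. exp (- (1 / t) * (1 / real n))) \<longlonglongrightarrow> 1" by simp
  moreover have "\<forall>\<^sub>F n in sequentially. exp (- (1 / t) * (1 / real n)) = flat 0 (real n * t)"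
    using True by (intro eventually_sequentiallyI[of 1]) (auto simp: flat_def field_simps)
  ultimately show ?thesis using True by (simp add: Lim_transform_eventually)
next
  case False
  then have "flat 0 (real n * t) = 0" for n by (auto simp: flat_def zero_less_mult_iff)
  then show ?thesis using False by simp
qed

lemma box_bump_tendsto: "(\<lambda>n. box_bump (real n) a b z) \<longlonglongrightarrow> indicator (box a b) z"
proof -
  have "(\<lambda>n. box_bump (real n) a b z) \<longlonglongrightarrow> ((if Re z - Re a > 0 then 1 else 0) * (if Re b - Re z > 0 then 1 else 0) *
     ((if Im z - Im a > 0 then 1 else 0) * (if Im b - Im z > 0 then 1 else 0)))"
    unfolding box_bump_def by (intro tendsto_mult flat_0_tendsto)
  moreover have "(if Re z - Re a > 0 then 1 else 0) * (if Re b - Re z > 0 then 1 else 0) *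
     ((if Im z - Im a > 0 then 1 else 0) * (if Im b - Im z > 0 then 1 else 0)) = (indicator (box a b) z :: real)"
    by (auto simp: in_box_complex_iff indicator_def)
  ultimately show ?thesis by simp
qed

text \<open>Bumps converge pointwise to indicators of open boxes, and these boxes form an
  intersection-stable generator of the Borel sets. The finite total mass makes the constant 1 an
  integrable dominating function.\<close>

lemma borel_prob_eqI:
  assumes r: "borel_prob \<rho>" "borel_prob \<rho>'" and eq: "\<And>\<psi>. test_function \<psi> \<Longrightarrow> (LINT z|\<rho>. \<psi> z) = (LINT z|\<rho>'. \<psi> z)"
  shows "\<rho> = \<rho>'"
proof -
  have lim: "(\<lambda>n. LINT z|\<sigma>. complex_of_real (box_bump (real (Suc n)) a b z)) \<longlonglongrightarrow> complex_of_real (measure \<sigma> (box a b))"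
    if "borel_prob \<sigma>" for \<sigma> a b
  proof -
    have s: "sets \<sigma> = sets borel" and "prob_space \<sigma>" using that by (auto simp: borel_prob_def)
    interpret S: prob_space \<sigma> by fact
    have m[measurable]: "(\<lambda>z. complex_of_real (box_bump (real (Suc n)) a b z)) \<in> borel_measurable \<sigma>" for n
      using test_function_measurable[OF test_function_box_bump[of "real (Suc n)" a b]] measurable_cong_sets[OF s refl] by auto
    have "(\<lambda>n. LINT z|\<sigma>. complex_of_real (box_bump (real (Suc n)) a b z)) \<longlonglongrightarrow> (LINT z|\<sigma>. complex_of_real (indicator (box a b) z))"
    proof (rule integral_dominated_convergence[where w="\<lambda>_. 1"])
      show "AE z in \<sigma>. (\<lambda>n. complex_of_real (box_bump (real (Suc n)) a b z)) \<longlonglongrightarrow> complex_of_real (indicator (box a b) z)"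
        by (intro AE_I2 tendsto_of_real LIMSEQ_Suc[OF box_bump_tendsto])
      show "AE z in \<sigma>. norm (complex_of_real (box_bump (real (Suc n)) a b z)) \<le> 1" for n
        using box_bump_bounds by (intro AE_I2) auto
      show "(\<lambda>x. complex_of_real (indicat_real (box a b) x)) \<in> borel_measurable \<sigma>"
        unfolding measurable_cong_sets[OF s refl] by measurable
    qed (auto intro: m simp del: of_nat_Suc)
    also have "(LINT z|\<sigma>. complex_of_real (indicator (box a b) z)) = complex_of_real (measure \<sigma> (box a b))"
      using s by (subst integral_complex_of_real) (simp add: sets_eq_imp_space_eq[OF s])
    finally show ?thesis .
  qed
  have meq: "measure \<rho> (box a b) = measure \<rho>' (box a b)" for a b
  proof -
    have f: "(\<lambda>n. LINT z|\<rho>. complex_of_real (box_bump (real (Suc n)) a b z)) = (\<lambda>n. LINT z|\<rho>'. complex_of_real (box_bump (real (Suc n)) a b z))"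
      by (intro ext eq test_function_box_bump) simp
    have "complex_of_real (measure \<rho> (box a b)) = complex_of_real (measure \<rho>' (box a b))"
      by (rule LIMSEQ_unique[OF lim[OF r(1), of a b, unfolded f] lim[OF r(2)]])
    then show ?thesis by simp
  qed
  interpret R: prob_space \<rho> using r by (simp add: borel_prob_def)
  interpret R': prob_space \<rho>' using r by (simp add: borel_prob_def)
  define A where "A = (\<lambda>n::nat. box (Complex (- real n) (- real n)) (Complex (real n) (real n)))"
  show ?thesis
  proof (rule measure_eqI_generator_eq)
    let ?E = "range (\<lambda>(a, b). box a b :: complex set)"
    show "Int_stable ?E" by (auto simp: Int_stable_def box_Int_box)
    show "?E \<subseteq> Pow UNIV" "sets \<rho> = sigma_sets UNIV ?E" "sets \<rho>' = sigma_sets UNIV ?E"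
      using r by (simp_all add: borel_prob_def borel_eq_box)
    show "range A \<subseteq> ?E" by (auto simp: A_def)
    show "(\<Union>i. A i) = UNIV"
    proof -
      have "\<exists>n. z \<in> A n" for z
      proof -
        obtain n where "norm z < real n" using reals_Archimedean2 by blast
        then show ?thesis using abs_Re_le_cmod[of z] abs_Im_le_cmod[of z]
          by (intro exI[of _ n]) (auto simp: A_def in_box_complex_iff)
      qed
      then show ?thesis by auto
    qed
    show "emeasure \<rho> (A i) \<noteq> \<infinity>" for i by simp
    show "emeasure \<rho> X = emeasure \<rho>' X" if "X \<in> ?E" for X
      using that meq by (auto simp: R.emeasure_eq_measure R'.emeasure_eq_measure)
  qed
qed

section \<open>Logarithmic potentials\<close>

lemma cball_borel [measurable]: "cball (a :: 'a :: euclidean_space) r \<in> sets borel"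
  by (simp add: borel_closed)

text \<open>The complement of the support is the union of all open null sets; the Lindelof property
  reduces it to a countable union.\<close>

lemma AE_supp_measure:
  assumes "sets \<mu> = sets borel"
  shows "AE w in \<mu>. w \<in> supp_measure \<mu>"
proof -
  define V where "V = {A. open A \<and> emeasure \<mu> A = 0}"
  obtain W where W: "W \<subseteq> V" "countable W" "\<Union>W = \<Union>V"
    using Lindelof[of V] unfolding V_def by auto
  have "A \<in> null_sets \<mu>" if "A \<in> W" for A
  proof -
    have "A \<in> V" using that W(1) by blast
    then have "open A" "emeasure \<mu> A = 0" by (simp_all add: V_def)
    then show ?thesis by (intro null_setsI) (simp_all add: assms)
  qed
  then have "\<Union>W \<in> null_sets \<mu>" using W(2) null_sets_UN'[of W "\<lambda>A. A" \<mu>] by simp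
  then have "AE w in \<mu>. w \<notin> \<Union>W" by (rule AE_not_in)
  then show ?thesis
  proof eventually_elim
    case (elim w)
    show ?case
    proof (rule ccontr)
      assume "w \<notin> supp_measure \<mu>"
      then obtain A where A: "open A" "w \<in> A" "\<not> emeasure \<mu> A > 0" unfolding supp_measure_def by blast
      then have "A \<in> V" by (simp add: V_def)
      then show False using W(3) A(2) elim by blast
    qed
  qed
qed

lemma compact_prob_bounded:
  assumes "compact_prob \<mu>"
  obtains R where "R > 0" "AE w in \<mu>. norm w \<le> R"
proof -
  have "bounded (supp_measure \<mu>)" using assms by (simp add: compact_prob_def compact_imp_bounded)
  then obtain R where R: "R > 0" "\<forall>w\<in>supp_measure \<mu>. norm w \<le> R" unfolding bounded_pos by blast
  have "AE w in \<mu>. norm w \<le> R"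
    using AE_supp_measure[of \<mu>] assms R(2) by (auto simp: compact_prob_def borel_prob_def elim: eventually_mono)
  then show ?thesis using that R(1) by blast
qed

text \<open>A circle is closed, so its complement is an open null set and misses the support. This
  turns degeneracy of \<open>norm (w - z)\<close> into the geometric condition that the first
  hypothesis excludes.\<close>

lemma supp_measure_subset_circle:
  assumes s: "sets \<mu> = sets borel" and ae: "AE w in \<mu>. norm (w - z) = r"
  shows "supp_measure \<mu> \<subseteq> {w. norm (w - z) = r}"
proof
  fix w assume w: "w \<in> supp_measure \<mu>"
  show "w \<in> {w. norm (w - z) = r}"
  proof (rule ccontr)
    assume n: "w \<notin> {w. norm (w - z) = r}"
    define A where "A = {w. norm (w - z) \<noteq> r}"
    have "open A" unfolding A_def by (intro open_Collect_neq continuous_intros)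
    moreover from this have "A \<in> sets \<mu>" by (simp add: s)
    then have "emeasure \<mu> A = 0" using ae AE_iff_measurable[of A \<mu> "\<lambda>w. norm (w - z) = r"] sets_eq_imp_space_eq[OF s]
      by (simp add: A_def)
    ultimately show False using w n unfolding supp_measure_def A_def by auto
  qed
qed

text \<open>A real-valued stand-in for \<open>log_potential\<close>, with \<open>ln 0 = 0\<close>
  and the value 0 where the integral does not exist. By \<open>AE_log_potential\<close> the two
  agree almost everywhere for measures of bounded support.\<close>

definition pot :: "complex measure \<Rightarrow> complex \<Rightarrow> real" where
  "pot \<mu> z = (\<integral>w. ln (norm (z - w)) \<partial>\<mu>)"

definition loc_square_integrable :: "(complex \<Rightarrow> real) \<Rightarrow> bool" where
  "loc_square_integrable f \<longleftrightarrow> f \<in> borel_measurable borel \<and>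
     (\<forall>R. (\<integral>\<^sup>+z. indicator (cball 0 R) z * ennreal ((f z)\<^sup>2) \<partial>lborel) < \<infinity>)"

lemma loc_square_integrable_imp_loc_integrable:
  assumes "loc_square_integrable f" shows "loc_integrable f"
  unfolding loc_integrable_def
proof
  fix R
  have [measurable]: "f \<in> borel_measurable borel" using assms by (simp add: loc_square_integrable_def)
  show "integrable lborel (\<lambda>z. indicator (cball 0 R) z *\<^sub>R f z)"
  proof (rule integrableI_bounded)
    have "(\<integral>\<^sup>+z. ennreal (norm (indicator (cball 0 R) z *\<^sub>R f z)) \<partial>lborel)
      \<le> (\<integral>\<^sup>+z. indicator (cball 0 R) z + indicator (cball 0 R) z * ennreal ((f z)\<^sup>2) \<partial>lborel)"
    proof (rule nn_integral_mono)
      fix z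
      have "\<bar>f z\<bar> \<le> 1 + (f z)\<^sup>2"
        using sum_squares_ge_zero[of "\<bar>f z\<bar> - 1/2" 0] by (simp add: power2_eq_square algebra_simps)
      then have "ennreal \<bar>f z\<bar> \<le> 1 + ennreal ((f z)\<^sup>2)"
        by (metis ennreal_1 ennreal_leI ennreal_plus zero_le_one zero_le_power2)
      then show "ennreal (norm (indicator (cball 0 R) z *\<^sub>R f z)) \<le> indicator (cball 0 R) z + indicator (cball 0 R) z * ennreal ((f z)\<^sup>2)"
        by (auto simp: indicator_def)
    qed
    also have "\<dots> = emeasure lborel (cball 0 R :: complex set) + (\<integral>\<^sup>+z. indicator (cball 0 R) z * ennreal ((f z)\<^sup>2) \<partial>lborel)"
      by (subst nn_integral_add) auto
    also have "\<dots> < \<infinity>"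
      using assms emeasure_bounded_finite[of "cball (0::complex) R"] by (simp add: loc_square_integrable_def)
    finally show "(\<integral>\<^sup>+z. ennreal (norm (indicator (cball 0 R) z *\<^sub>R f z)) \<partial>lborel) < \<infinity>" .
  qed (intro borel_measurable_scaleR borel_measurable_indicator, auto)
qed

text \<open>The singular part \<open>lneg 1\<close> has a square integral that does not depend on
  \<open>w\<close>, and the rest is at most \<open>R + S\<close> on the disc; hence one constant for
  all \<open>w\<close> in a bounded set.\<close>

lemma nn_integral_ln_square_bound:
  "\<exists>C<\<infinity>. \<forall>w::complex. norm w \<le> S \<longrightarrow> (\<integral>\<^sup>+z. indicator (cball 0 R) z * ennreal ((ln (norm (z - w)))\<^sup>2) \<partial>lborel) \<le> C"
proof -
  let ?C = "2 * (\<integral>\<^sup>+a. ennreal ((lneg 1 a)\<^sup>2) \<partial>lborel) + ennreal (2 * (R + S)\<^sup>2) * emeasure lborel (cball (0::complex) R)"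
  have fin: "?C < \<infinity>"
    using nn_integral_lneg_square emeasure_bounded_finite[of "cball (0::complex) R"]
    by (auto simp: ennreal_mult_less_top)
  have "(\<integral>\<^sup>+z. indicator (cball 0 R) z * ennreal ((ln (norm (z - w)))\<^sup>2) \<partial>lborel) \<le> ?C" if w: "norm w \<le> S" for w :: complex
  proof -
  have "(\<integral>\<^sup>+z. indicator (cball 0 R) z * ennreal ((ln (norm (z - w)))\<^sup>2) \<partial>lborel)
    \<le> (\<integral>\<^sup>+z. 2 * ennreal ((lneg 1 (z - w))\<^sup>2) + ennreal (2 * (R + S)\<^sup>2) * indicator (cball 0 R) z \<partial>lborel)"
  proof (rule nn_integral_mono)
    fix z :: complex
    show "indicator (cball 0 R) z * ennreal ((ln (norm (z - w)))\<^sup>2) \<le> 2 * ennreal ((lneg 1 (z - w))\<^sup>2) + ennreal (2 * (R + S)\<^sup>2) * indicator (cball 0 R) z"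
    proof (cases "norm z \<le> R")
      case True
      then have n: "norm (z - w) \<le> R + S" using norm_triangle_ineq4[of z w] w by linarith
      define x y where "x = lneg 1 (z - w)" and "y = norm (z - w)"
      have xy: "0 \<le> x" "0 \<le> y" "y \<le> R + S" using n by (auto simp: x_def y_def)
      have "(ln (norm (z - w)))\<^sup>2 \<le> (x + y)\<^sup>2"
        using abs_ln_norm_le[of "z - w"] xy by (intro abs_le_square_iff[THEN iffD1]) (simp add: x_def y_def)
      also have "\<dots> \<le> 2 * x\<^sup>2 + 2 * y\<^sup>2"
        using sum_squares_bound[of x y] by (simp add: power2_sum)
      also have "\<dots> \<le> 2 * x\<^sup>2 + 2 * (R + S)\<^sup>2" using xy by (simp add: power_mono)
      finally have "ennreal ((ln (norm (z - w)))\<^sup>2) \<le> ennreal (2 * x\<^sup>2 + 2 * (R + S)\<^sup>2)" by (rule ennreal_leI)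
      then show ?thesis using True by (simp add: x_def ennreal_plus ennreal_mult)
    qed simp
  qed
  also have "\<dots> = ?C"
    by (subst nn_integral_add)
       (auto simp: nn_integral_cmult nn_integral_lborel_translation[of "\<lambda>z. ennreal ((lneg 1 z)\<^sup>2)"] nn_integral_cmult_indicator)
  finally show ?thesis .
  qed
  with fin show ?thesis by blast
qed

lemma AE_cball_imp_AE:
  assumes "\<And>n::nat. AE z in lborel. z \<in> cball (0::complex) (real n) \<longrightarrow> P z"
  shows "AE z in lborel. P z"
proof -
  have "AE z in lborel. \<forall>n::nat. z \<in> cball (0::complex) (real n) \<longrightarrow> P z"
    by (subst AE_all_countable) (use assms in blast)
  then show ?thesis
  proof eventually_elim
    case (elim z)
    obtain n where "norm z \<le> real n" using real_arch_simple by blast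
    then show ?case using elim by auto
  qed
qed

text \<open>Compactness of the support is used as an almost sure bound on the modulus, with
  \<open>S\<close> a parameter so that several measures can share it.\<close>

locale bounded_prob = prob_space \<mu> for \<mu> :: "complex measure" +
  fixes S :: real
  assumes sets_eq [measurable_cong, simp]: "sets \<mu> = sets borel"
    and S_pos: "S > 0"
    and AE_norm_le: "AE w in \<mu>. norm w \<le> S"
begin

lemma space_eq [simp]: "space \<mu> = UNIV"
  using sets_eq_imp_space_eq[OF sets_eq] by simp

sublocale L: pair_sigma_finite lborel \<mu> by standard
sublocale L': pair_sigma_finite \<mu> lborel by standard

text \<open>Fubini, since for fixed \<open>w\<close> the circle of radius \<open>r\<close> about
  \<open>w\<close> is a null set. With \<open>r > 0\<close> this discards the excluded case of
  \<open>circle_mean_ln\<close>, with \<open>r = 0\<close> the singularity.\<close>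

lemma AE_AE_norm_neq: "AE z in lborel. AE w in \<mu>. norm (z - w) \<noteq> r"
proof (subst L.AE_commute)
  show "{x \<in> space (lborel \<Otimes>\<^sub>M \<mu>). norm (fst x - snd x) \<noteq> r} \<in> sets (lborel \<Otimes>\<^sub>M \<mu>)" by measurable
  show "AE w in \<mu>. AE z in lborel. norm (z - w) \<noteq> r" by (intro AE_I2 AE_norm_diff_neq)
qed

lemma nn_integral_ln_square:
  "(\<integral>\<^sup>+z. indicator (cball 0 R) z * (\<integral>\<^sup>+w. ennreal ((ln (norm (z - w)))\<^sup>2) \<partial>\<mu>) \<partial>lborel) < \<infinity>"
proof -
  obtain C where C: "C < \<infinity>" "\<And>w::complex. norm w \<le> S \<Longrightarrow> (\<integral>\<^sup>+z. indicator (cball 0 R) z * ennreal ((ln (norm (z - w)))\<^sup>2) \<partial>lborel) \<le> C"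
    using nn_integral_ln_square_bound[of S R] by blast
  have "(\<integral>\<^sup>+z. indicator (cball 0 R) z * (\<integral>\<^sup>+w. ennreal ((ln (norm (z - w)))\<^sup>2) \<partial>\<mu>) \<partial>lborel)
    = (\<integral>\<^sup>+z. (\<integral>\<^sup>+w. indicator (cball 0 R) z * ennreal ((ln (norm (z - w)))\<^sup>2) \<partial>\<mu>) \<partial>lborel)"
    by (intro nn_integral_cong nn_integral_cmult[symmetric]) measurable
  also have "\<dots> = (\<integral>\<^sup>+w. (\<integral>\<^sup>+z. indicator (cball 0 R) z * ennreal ((ln (norm (z - w)))\<^sup>2) \<partial>lborel) \<partial>\<mu>)"
    by (rule L.Fubini'[symmetric]) measurable
  also have "\<dots> \<le> (\<integral>\<^sup>+w. C \<partial>\<mu>)"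
    using AE_norm_le by (intro nn_integral_mono_AE) (auto elim!: eventually_mono intro: C)
  also have "\<dots> = C" using emeasure_space_1 by simp
  finally show ?thesis using C(1) by (rule le_less_trans)
qed

text \<open>For almost every \<open>z\<close> the logarithm of |z - w| thus has finite variance
  under \<open>\<mu>\<close>, the input of both the weak law and the central limit theorem.\<close>

lemma AE_integrable_ln_square: "AE z in lborel. integrable \<mu> (\<lambda>w. (ln (norm (z - w)))\<^sup>2)"
proof (rule AE_cball_imp_AE)
  fix n :: nat
  have "AE z in lborel. indicator (cball 0 (real n)) z * (\<integral>\<^sup>+w. ennreal ((ln (norm (z - w)))\<^sup>2) \<partial>\<mu>) \<noteq> \<infinity>"
    using nn_integral_ln_square[of "real n"] by (intro nn_integral_noteq_infinite) auto
  then show "AE z in lborel. z \<in> cball (0::complex) (real n) \<longrightarrow> integrable \<mu> (\<lambda>w. (ln (norm (z - w)))\<^sup>2)"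
    by eventually_elim (auto intro!: integrableI_nonneg simp: less_top)
qed

lemma integrable_ln: "integrable \<mu> (\<lambda>w. (ln (norm (z - w)))\<^sup>2) \<Longrightarrow> integrable \<mu> (\<lambda>w. ln (norm (z - w)))"
  by (rule square_integrable_imp_integrable) auto

lemma pot_measurable [measurable]: "pot \<mu> \<in> borel_measurable borel"
  unfolding pot_def by measurable

lemma abs_pot_measurable [measurable]: "(\<lambda>z. \<integral>w. \<bar>ln (norm (z - w))\<bar> \<partial>\<mu>) \<in> borel_measurable borel"
  by measurable

text \<open>The square of a mean is at most the mean of the square, here as nonnegativity of the
  variance. Signed and absolute logarithms are treated together; the absolute version supplies the
  Fubini criterion in \<open>AE_pot_le_circle_average\<close>.\<close>

lemma loc_square_integrable_aux:
  assumes f: "\<And>z. f z = (\<integral>w. g z w \<partial>\<mu>)" and fm: "f \<in> borel_measurable borel"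
    and gm: "\<And>z. g z \<in> borel_measurable borel" and g: "\<And>z w. (g z w)\<^sup>2 = (ln (norm (z - w)))\<^sup>2"
  shows "loc_square_integrable f"
  unfolding loc_square_integrable_def
proof (intro conjI allI fm)
  fix R
  have "AE z in lborel. ennreal ((f z)\<^sup>2) \<le> (\<integral>\<^sup>+w. ennreal ((ln (norm (z - w)))\<^sup>2) \<partial>\<mu>)"
    using AE_integrable_ln_square
  proof eventually_elim
    case (elim z)
    have i2: "integrable \<mu> (\<lambda>w. (g z w)\<^sup>2)" using elim by (simp add: g)
    have i1: "integrable \<mu> (g z)" by (rule square_integrable_imp_integrable[OF _ i2]) (use gm[of z] in simp)
    have "(expectation (g z))\<^sup>2 \<le> expectation (\<lambda>w. (g z w)\<^sup>2)"
      using variance_positive[of "g z"] variance_eq[OF i1 i2] by simp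
    then have "ennreal ((f z)\<^sup>2) \<le> ennreal (expectation (\<lambda>w. (ln (norm (z - w)))\<^sup>2))"
      by (intro ennreal_leI) (simp add: f g)
    also have "\<dots> = (\<integral>\<^sup>+w. ennreal ((ln (norm (z - w)))\<^sup>2) \<partial>\<mu>)"
      by (rule nn_integral_eq_integral[OF elim, symmetric]) simp
    finally show ?case .
  qed
  note ae = this
  have "(\<integral>\<^sup>+z. indicator (cball 0 R) z * ennreal ((f z)\<^sup>2) \<partial>lborel)
     \<le> (\<integral>\<^sup>+z. indicator (cball 0 R) z * (\<integral>\<^sup>+w. ennreal ((ln (norm (z - w)))\<^sup>2) \<partial>\<mu>) \<partial>lborel)"
  proof (rule nn_integral_mono_AE)
    show "AE z in lborel. indicator (cball 0 R) z * ennreal ((f z)\<^sup>2) \<le>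
        indicator (cball 0 R) z * (\<integral>\<^sup>+w. ennreal ((ln (norm (z - w)))\<^sup>2) \<partial>\<mu>)"
      using ae by eventually_elim (rule mult_left_mono, simp_all)
  qed
  also have "\<dots> < \<infinity>" by (rule nn_integral_ln_square)
  finally show "(\<integral>\<^sup>+z. indicator (cball 0 R) z * ennreal ((f z)\<^sup>2) \<partial>lborel) < \<infinity>" .
qed

lemma loc_square_integrable_pot: "loc_square_integrable (pot \<mu>)"
  by (rule loc_square_integrable_aux[where g="\<lambda>z w. ln (norm (z - w))"]) (auto simp: pot_def)

lemma loc_square_integrable_abs_pot: "loc_square_integrable (\<lambda>z. \<integral>w. \<bar>ln (norm (z - w))\<bar> \<partial>\<mu>)"
  by (rule loc_square_integrable_aux[where g="\<lambda>z w. \<bar>ln (norm (z - w))\<bar>"]) auto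

lemma AE_log_potential: "AE z in lborel. log_potential \<mu> z = ereal (pot \<mu> z)"
  using AE_integrable_ln_square AE_AE_norm_neq[of 0]
proof eventually_elim
  case (elim z)
  have i: "integrable \<mu> (\<lambda>w. ln (norm (z - w)))" by (rule integrable_ln[OF elim(1)])
  have 1: "(\<integral>\<^sup>+w. e2ennreal (eln (norm (z - w))) \<partial>\<mu>) = (\<integral>\<^sup>+w. ennreal (ln (norm (z - w))) \<partial>\<mu>)"
    by (rule nn_integral_cong_AE) (use elim(2) in \<open>eventually_elim, simp add: eln_def\<close>)
  have 2: "(\<integral>\<^sup>+w. e2ennreal (- eln (norm (z - w))) \<partial>\<mu>) = (\<integral>\<^sup>+w. ennreal (- ln (norm (z - w))) \<partial>\<mu>)"
    by (rule nn_integral_cong_AE) (use elim(2) in \<open>eventually_elim, simp add: eln_def\<close>)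
  have fin: "(\<integral>\<^sup>+w. ennreal (ln (norm (z - w))) \<partial>\<mu>) < \<top>" "(\<integral>\<^sup>+w. ennreal (- ln (norm (z - w))) \<partial>\<mu>) < \<top>"
    using i unfolding real_integrable_def by (auto simp: less_top)
  have er: "enn2ereal x = ereal (enn2real x)" if "x < \<top>" for x
    using that by (cases x) auto
  show ?case unfolding log_potential_def 1 2 pot_def real_lebesgue_integral_def[OF i]
    using fin by (simp add: er)
qed

text \<open>For each fixed translation the property holds almost everywhere. Exchanging the
  quantifiers gives it almost everywhere on the circle about almost every centre, although every
  single circle is a null set.\<close>

lemma AE_circle_measure_translate:
  assumes "AE z in lborel. P z" and [measurable]: "Measurable.pred borel P"
  shows "AE z in lborel. AE \<zeta> in circle_measure r. P (z + \<zeta>)"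
proof -
  interpret C: prob_space "circle_measure r" by (rule prob_space_circle_measure)
  interpret P: pair_sigma_finite lborel "circle_measure r" by standard
  have "AE z in lborel. P (z + \<zeta>)" for \<zeta>
    using assms by (subst (asm) lborel_distr_plus[symmetric, of \<zeta>], subst (asm) AE_distr_iff) (auto simp: add.commute)
  moreover have "{x \<in> space (lborel \<Otimes>\<^sub>M circle_measure r). P (fst x + snd x)} \<in> sets (lborel \<Otimes>\<^sub>M circle_measure r)"
    by measurable
  ultimately show ?thesis by (subst P.AE_commute) auto
qed

text \<open>For one logarithm the circle mean is \<open>ln (max (norm (z - w)) r)\<close>, which off
  the singularity is not below \<open>ln (norm (z - w))\<close>; integrate in \<open>w\<close>.
  Exchanging the circle with \<open>\<mu>\<close> requires absolute integrability on the product,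
  available for almost every centre.\<close>

lemma AE_pot_le_circle_average:
  assumes r: "r > 0"
  shows "AE z in lborel. integrable (circle_measure r) (\<lambda>\<zeta>. pot \<mu> (z + \<zeta>)) \<and>
    pot \<mu> z \<le> (\<integral>\<zeta>. pot \<mu> (z + \<zeta>) \<partial>circle_measure r)"
proof -
  interpret C: prob_space "circle_measure r" by (rule prob_space_circle_measure)
  interpret P: pair_sigma_finite "circle_measure r" \<mu> by standard
  have av: "AE z in lborel. integrable (circle_measure r) (\<lambda>\<zeta>. f (z + \<zeta>))" if f: "loc_integrable f" for f
  proof (rule AE_cball_imp_AE)
    fix n :: nat
    have "AE z in lborel. integrable (circle_measure r) (\<lambda>\<zeta>. indicator (cball 0 (real n)) z * complex_of_real (f (z + \<zeta>)))"
      by (rule circle_average_Fubini(3)[OF f _ r, where B=1 and R="real n"]) (auto simp: indicator_def)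
    then show "AE z in lborel. z \<in> cball 0 (real n) \<longrightarrow> integrable (circle_measure r) (\<lambda>\<zeta>. f (z + \<zeta>))"
      by eventually_elim (auto simp: complex_of_real_integrable_eq)
  qed
  have gd: "AE z in lborel. AE \<zeta> in circle_measure r. integrable \<mu> (\<lambda>w. (ln (norm (z + \<zeta> - w)))\<^sup>2)"
    by (rule AE_circle_measure_translate[OF AE_integrable_ln_square]) measurable
  show ?thesis
    using av[OF loc_square_integrable_imp_loc_integrable[OF loc_square_integrable_pot]]
      av[OF loc_square_integrable_imp_loc_integrable[OF loc_square_integrable_abs_pot]]
      gd AE_AE_norm_neq[of r] AE_AE_norm_neq[of 0] AE_integrable_ln_square
  proof eventually_elim
    case (elim z)
    have Fi: "integrable (circle_measure r \<Otimes>\<^sub>M \<mu>) (\<lambda>(\<zeta>, w). ln (norm (z + \<zeta> - w)))"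
    proof (rule P.Fubini_integrable)
      show "integrable (circle_measure r) (\<lambda>\<zeta>. \<integral>w. norm (case (\<zeta>, w) of (\<zeta>, w) \<Rightarrow> ln (norm (z + \<zeta> - w))) \<partial>\<mu>)"
        using elim(2) by simp
      show "AE \<zeta> in circle_measure r. integrable \<mu> (\<lambda>w. case (\<zeta>, w) of (\<zeta>, w) \<Rightarrow> ln (norm (z + \<zeta> - w)))"
        using elim(3) by eventually_elim (simp add: integrable_ln)
    qed measurable
    have eq: "(\<integral>\<zeta>. ln (norm (z + \<zeta> - w)) \<partial>circle_measure r) = ln (max (norm (z - w)) r)" if "norm (z - w) \<noteq> r" for w
      using circle_mean_ln(2)[OF r that] by (simp add: algebra_simps)
    have "pot \<mu> z \<le> (\<integral>w. (\<integral>\<zeta>. ln (norm (z + \<zeta> - w)) \<partial>circle_measure r) \<partial>\<mu>)"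
      unfolding pot_def
    proof (rule integral_mono_AE)
      show "integrable \<mu> (\<lambda>w. ln (norm (z - w)))" by (rule integrable_ln[OF elim(6)])
      show "integrable \<mu> (\<lambda>w. \<integral>\<zeta>. ln (norm (z + \<zeta> - w)) \<partial>circle_measure r)"
        using P.integrable_snd[OF Fi] .
      show "AE w in \<mu>. ln (norm (z - w)) \<le> (\<integral>\<zeta>. ln (norm (z + \<zeta> - w)) \<partial>circle_measure r)"
        using elim(4,5)
      proof eventually_elim
        case (elim w)
        then show ?case using eq[OF elim(1)] by (simp add: ln_mono)
      qed
    qed
    also have "\<dots> = (\<integral>\<zeta>. pot \<mu> (z + \<zeta>) \<partial>circle_measure r)"
      unfolding pot_def by (rule P.Fubini_integral[OF Fi])
    finally show ?case using elim(1) by blast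
  qed
qed

text \<open>\<open>norm (z - w) / norm z\<close> tends to 1 uniformly for \<open>w\<close> in the
  disc of radius \<open>S\<close>. The coefficient 1 of \<open>ln (norm z)\<close> reflects total
  mass 1 and later fixes the mass of the limit measure.\<close>

lemma pot_asymptotic:
  assumes "\<epsilon> > 0"
  obtains R where "R > 0" "\<And>z. norm z \<ge> R \<Longrightarrow> \<bar>pot \<mu> z - ln (norm z)\<bar> \<le> \<epsilon>"
proof -
  have "isCont ln (1::real)" by (rule isCont_ln) simp
  then obtain d where d: "d > 0" "\<And>x. \<bar>x - 1\<bar> < d \<Longrightarrow> \<bar>ln x\<bar> < \<epsilon>"
    unfolding continuous_at_eps_delta dist_real_def using assms by (metis ln_one diff_zero)
  \<comment> \<open>The first entry makes the ratio differ from 1 by at most \<open>d / 2\<close>;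
    the second keeps \<open>z\<close> off the disc that carries \<open>\<mu>\<close>.\<close>
  define R where "R = max (2 * S / d) (2 * S)"
  have R: "R > 0" using S_pos by (simp add: R_def)
  have "\<bar>pot \<mu> z - ln (norm z)\<bar> \<le> \<epsilon>" if z: "norm z \<ge> R" for z
  proof -
    have z0: "norm z > 0" using z R by linarith
    have b: "\<bar>ln (norm (z - w)) - ln (norm z)\<bar> \<le> \<epsilon>" if w: "norm w \<le> S" for w
    proof -
      have False: "z \<noteq> w" using z w S_pos by (auto simp: R_def)
      have "\<bar>norm (z - w) - norm z\<bar> \<le> S" using norm_triangle_ineq3[of "z - w" z] w by simp
      then have "\<bar>norm (z - w) / norm z - 1\<bar> \<le> S / norm z" using z0 by (simp add: field_simps abs_le_iff)
      also have "\<dots> \<le> S / R" using z R S_pos by (intro divide_left_mono mult_pos_pos) auto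
      also have "\<dots> \<le> S / (2 * S / d)" using S_pos d R by (intro divide_left_mono mult_pos_pos) (auto simp: R_def)
      also have "\<dots> < d" using S_pos d by simp
      finally have "\<bar>ln (norm (z - w) / norm z)\<bar> < \<epsilon>" by (rule d(2))
      then show ?thesis using False z0 by (simp add: ln_div)
    qed
    have i: "integrable \<mu> (\<lambda>w. ln (norm (z - w)))"
      by (rule integrable_const_bound[of _ "\<epsilon> + \<bar>ln (norm z)\<bar>"])
         (use AE_norm_le b in \<open>force elim!: eventually_mono\<close>, measurable)
    have "\<bar>pot \<mu> z - ln (norm z)\<bar> = norm (\<integral>w. ln (norm (z - w)) - ln (norm z) \<partial>\<mu>)"
      unfolding pot_def using i prob_space by simp
    also have "\<dots> \<le> (\<integral>w. norm (ln (norm (z - w)) - ln (norm z)) \<partial>\<mu>)" by (rule integral_norm_bound)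
    also have "\<dots> \<le> (\<integral>w. \<epsilon> \<partial>\<mu>)"
      by (rule integral_mono_AE) (use i AE_norm_le b in \<open>auto elim!: eventually_mono\<close>)
    also have "\<dots> = \<epsilon>" using prob_space by simp
    finally show ?thesis .
  qed
  then show ?thesis using that R by blast
qed

end

section \<open>Vague compactness of probability measures on the plane\<close>

lemma sums_ternary_tail: "(\<lambda>n. 1 / 3 ^ (n + k) :: real) sums (3 / (2 * 3 ^ k))"
proof -
  have "(\<lambda>n. (1/3) ^ n :: real) sums (1 / (1 - 1/3))" by (rule geometric_sums) simp
  then have "(\<lambda>n. (1/3) ^ n * (1 / 3 ^ k) :: real) sums (1 / (1 - 1/3) * (1 / 3 ^ k))" by (rule sums_mult2)
  then show ?thesis by (simp add: power_add power_one_over field_simps)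
qed

text \<open>Base 3 with digits 0 and 1 has the gaps of the Cantor set: in contrast to binary
  expansions, close values force equal leading digits.\<close>

definition ternary :: "(nat \<Rightarrow> real) \<Rightarrow> real" where
  "ternary h = (\<Sum>n. h n / 3 ^ (n + 1))"

lemma summable_ternary:
  fixes h :: "nat \<Rightarrow> real"
  assumes "\<And>n. \<bar>h n\<bar> \<le> 1"
  shows "summable (\<lambda>n. h n / 3 ^ (n + k))"
proof (rule summable_comparison_test'[where N=0])
  show "summable (\<lambda>n. 1 / 3 ^ (n + k) :: real)" using sums_ternary_tail by (rule sums_summable)
  show "norm (h n / 3 ^ (n + k)) \<le> 1 / 3 ^ (n + k)" for n
    using assms[of n] by (simp add: divide_right_mono)
qed

text \<open>At the first index \<open>k\<close> of disagreement the digits contribute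
  \<open>1 / 3 ^ (k + 1)\<close>, and the tail can cancel at most half of it.\<close>

lemma ternary_digits_eq:
  assumes x: "\<And>n. x n \<in> {0, 1}" and y: "\<And>n. y n \<in> {0, 1}"
    and d: "\<bar>ternary x - ternary y\<bar> < 1 / (2 * 3 ^ (N + 1))" and n: "n \<le> N"
  shows "x n = y n"
proof (rule ccontr)
  assume ne: "x n \<noteq> y n"
  define k where "k = (LEAST n. x n \<noteq> y n)"
  have k: "x k \<noteq> y k" unfolding k_def using ne by (rule LeastI)
  have kn: "k \<le> N" using Least_le[of "\<lambda>n. x n \<noteq> y n", OF ne] n by (simp add: k_def)
  have lt: "x j = y j" if "j < k" for j using not_less_Least[of j "\<lambda>n. x n \<noteq> y n"] that by (auto simp: k_def)
  define e where "e = (\<lambda>n. x n - y n)"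
  have e1: "\<bar>e n\<bar> \<le> 1" for n using x[of n] y[of n] by (auto simp: e_def)
  have s: "summable (\<lambda>n. e n / 3 ^ (n + 1))" by (rule summable_ternary[OF e1])
  have xb: "\<bar>x n\<bar> \<le> 1" "\<bar>y n\<bar> \<le> 1" for n using x[of n] y[of n] by auto
  have "ternary x - ternary y = (\<Sum>n. e n / 3 ^ (n + 1))"
    unfolding ternary_def e_def diff_divide_distrib by (rule suminf_diff[OF summable_ternary summable_ternary]) (use xb in auto)
  also have "\<dots> = (\<Sum>n. e (n + Suc k) / 3 ^ (n + Suc k + 1)) + (\<Sum>n<Suc k. e n / 3 ^ (n + 1))"
    by (rule suminf_split_initial_segment[OF s])
  also have "(\<Sum>n<Suc k. e n / 3 ^ (n + 1)) = e k / 3 ^ (k + 1)"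
    using lt by (simp add: e_def)
  finally have eq: "ternary x - ternary y = (\<Sum>n. e (n + Suc k) / 3 ^ (n + Suc k + 1)) + e k / 3 ^ (k + 1)" .
  have st: "summable (\<lambda>n. \<bar>e (n + Suc k) / 3 ^ (n + Suc k + 1)\<bar>)"
    using summable_ternary[of "\<lambda>n. \<bar>e (n + Suc k)\<bar>" "k + 2"] e1 by (simp add: ac_simps)
  have "\<bar>\<Sum>n. e (n + Suc k) / 3 ^ (n + Suc k + 1)\<bar> \<le> (\<Sum>n. \<bar>e (n + Suc k) / 3 ^ (n + Suc k + 1)\<bar>)"
    by (rule summable_rabs[OF st])
  also have "\<dots> \<le> (\<Sum>n. 1 / 3 ^ (n + (k + 2)))"
  proof (rule suminf_le[OF _ st sums_summable[OF sums_ternary_tail]])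
    show "\<bar>e (n + Suc k) / 3 ^ (n + Suc k + 1)\<bar> \<le> 1 / 3 ^ (n + (k + 2))" for n
      using e1[of "n + Suc k"] by (simp add: divide_right_mono)
  qed
  also have "\<dots> = 3 / (2 * 3 ^ (k + 2))" by (rule sums_unique[OF sums_ternary_tail, symmetric])
  also have "\<dots> = 1 / (2 * 3 ^ (k + 1))" by simp
  finally have t: "\<bar>\<Sum>n. e (n + Suc k) / 3 ^ (n + Suc k + 1)\<bar> \<le> 1 / (2 * 3 ^ (k + 1))" .
  have "\<bar>e k\<bar> = 1" using x[of k] y[of k] k by (auto simp: e_def)
  then have ek: "\<bar>e k / 3 ^ (k + 1)\<bar> = 2 * (1 / (2 * 3 ^ (k + 1)))" by simp
  have "\<bar>ternary x - ternary y\<bar> \<ge> 1 / (2 * 3 ^ (k + 1))"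
    using t ek unfolding eq by linarith
  also have "1 / (2 * 3 ^ (k + 1)) \<ge> (1 / (2 * 3 ^ (N + 1)) :: real)"
    using kn by (intro divide_left_mono mult_left_mono power_increasing) auto
  finally (xtrans) show False using d by linarith
qed

text \<open>
  To apply Helly's theorem on the line, the plane is squashed into the unit disc and coded into \<open>\<real>\<close> by a
  Borel injection: the ternary digits of the code of \<open>z\<close> record on which side of each rational vertical
  or horizontal line the squashed point lies. The code is not continuous, but its inverse is uniformly
  continuous, which is all that weak convergence needs.
\<close>

definition squash :: "complex \<Rightarrow> complex" where
  "squash z = z /\<^sub>R (1 + norm z)"

definition unsquash :: "complex \<Rightarrow> complex" where
  "unsquash w = w /\<^sub>R (1 - norm w)"

lemma one_plus_norm_pos: "1 + norm (z::complex) > 0"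
  using norm_ge_zero[of z] by linarith

lemma norm_squash: "norm (squash z) = norm z / (1 + norm z)"
  using one_plus_norm_pos[of z] by (simp add: squash_def field_simps)

lemma norm_squash_less_1: "norm (squash z) < 1"
  using one_plus_norm_pos[of z] by (simp add: norm_squash field_simps)

lemma unsquash_squash [simp]: "unsquash (squash z) = z"
proof -
  have "1 - norm (squash z) = 1 / (1 + norm z)"
    using one_plus_norm_pos[of z] by (simp add: norm_squash field_simps)
  then show ?thesis using one_plus_norm_pos[of z] by (simp add: unsquash_def squash_def)
qed

lemma squash_measurable [measurable]: "squash \<in> borel_measurable borel"
  unfolding squash_def by measurable

lemma unsquash_measurable [measurable]: "unsquash \<in> borel_measurable borel"
  unfolding unsquash_def by measurable

definition code_digit :: "nat \<Rightarrow> complex \<Rightarrow> real" where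
  "code_digit n w = (case from_nat n of (q :: rat, b) \<Rightarrow> of_bool ((if b then Re w else Im w) < of_rat q))"

lemma code_digit_measurable [measurable]: "code_digit n \<in> borel_measurable borel"
  unfolding code_digit_def by (cases "from_nat n :: rat \<times> bool") (auto simp: of_bool_def)

definition code :: "complex \<Rightarrow> real" where
  "code z = ternary (\<lambda>n. code_digit n (squash z))"

lemma code_digit_values: "code_digit n w \<in> {0, 1}"
  by (auto simp: code_digit_def split: prod.split)

lemma code_measurable [measurable]: "code \<in> borel_measurable borel"
  unfolding code_def ternary_def by measurable

lemma code_bounds: "0 \<le> code z" "code z \<le> 1"
proof -
  have v: "0 \<le> code_digit n w" "code_digit n w \<le> 1" "\<bar>code_digit n w\<bar> \<le> 1" for n w using code_digit_values[of n w] by auto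
  show "0 \<le> code z" unfolding code_def ternary_def
    by (rule suminf_nonneg[OF summable_ternary]) (use v in auto)
  have "code z \<le> (\<Sum>n. 1 / 3 ^ (n + 1))" unfolding code_def ternary_def
    by (rule suminf_le[OF _ summable_ternary sums_summable[OF sums_ternary_tail]]) (use v in \<open>auto intro: divide_right_mono\<close>)
  also have "\<dots> = 3 / (2 * 3 ^ 1)" by (rule sums_unique[OF sums_ternary_tail, symmetric])
  finally show "code z \<le> 1" by simp
qed

lemma grid_point_between:
  assumes "-1 < x" "x < 1" "0 < M" "x + 1 / real M < y"
  obtains k :: int where "\<bar>k\<bar> \<le> int M" "x < real_of_int k / real M" "real_of_int k / real M \<le> y"
\<comment> \<open>The first grid point strictly to the right of \<open>x\<close>; strictness matters
  because the digits compare with \<open><\<close>.\<close>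
proof (rule that[of "\<lfloor>real M * x\<rfloor> + 1"])
  let ?k = "\<lfloor>real M * x\<rfloor> + 1"
  have k: "real M * x < real_of_int ?k" "real_of_int ?k \<le> real M * x + 1" by linarith+
  have M: "real M > 0" using assms by simp
  show "x < real_of_int ?k / real M" using k(1) M by (simp add: field_simps)
  have "real_of_int ?k / real M \<le> x + 1 / real M" using k(2) M by (simp add: field_simps)
  then show "real_of_int ?k / real M \<le> y" using assms by linarith
  have "real M * x < real M * 1" "real M * (-1) < real M * x" using assms M by (intro mult_strict_left_mono; simp)+
  then have "\<lfloor>real M * x\<rfloor> < int M" "\<lfloor>real M * x\<rfloor> \<ge> - int M" by linarith+
  then show "\<bar>?k\<bar> \<le> int M" by linarith
qed

text \<open>A grid of mesh \<open>1 / real M'\<close> uses finitely many rational lines, hence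
  finitely many digits. Codes closer than the separation of \<open>ternary_digits_eq\<close> agree
  in all of these, so both points lie on the same side of every grid line.\<close>

lemma squash_code_uniformly_continuous:
  assumes e: "e > 0"
  shows "\<exists>d>0. \<forall>z z'. \<bar>code z - code z'\<bar> < d \<longrightarrow> dist (squash z) (squash z') < e"
proof -
  obtain M where M: "inverse (real (Suc M)) < e / 2" using reals_Archimedean[of "e/2"] e by auto
  define M' where "M' = Suc M"
  have M': "M' > 0" "1 / real M' < e / 2" using M by (simp_all add: M'_def field_simps)
  \<comment> \<open>Indices of the digits that test the grid lines within [-1, 1]; \<open>N\<close>
    bounds them all.\<close>
  define F where "F = (\<lambda>(k, b). to_nat (Fract k (int M'), b)) ` ({- int M'..int M'} \<times> (UNIV :: bool set))"
  define N where "N = Max F"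
  have fin: "finite F" by (simp add: F_def)
  have inF: "to_nat (Fract k (int M'), b) \<le> N" if "\<bar>k\<bar> \<le> int M'" for k and b :: bool
    unfolding N_def
  proof (rule Max_ge[OF fin])
    show "to_nat (Fract k (int M'), b) \<in> F"
      unfolding F_def by (rule image_eqI[of _ _ "(k, b)"]) (use that in auto)
  qed
  have dig: "code_digit (to_nat (Fract k (int M'), b)) w = of_bool ((if b then Re w else Im w) < real_of_int k / real M')" for k b w
    using M' by (simp add: code_digit_def of_rat_rat)
  define d :: real where "d = 1 / (2 * 3 ^ (N + 1))"
  have "dist (squash z) (squash z') < e" if cd: "\<bar>code z - code z'\<bar> < d" for z z'
  proof -
    have deq: "code_digit n (squash z) = code_digit n (squash z')" if "n \<le> N" for n
      by (rule ternary_digits_eq[OF code_digit_values code_digit_values _ that]) (use cd in \<open>simp add: code_def d_def\<close>)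
    have b: "\<bar>Re (squash z)\<bar> < 1" "\<bar>Im (squash z)\<bar> < 1" for z
      using abs_Re_le_cmod[of "squash z"] abs_Im_le_cmod[of "squash z"] norm_squash_less_1[of z] by auto
    define p where "p = (\<lambda>b w. if b then Re w else Im w)"
    have pb: "-1 < p b (squash z)" "p b (squash z) < 1" for b z using b[of z] by (auto simp: p_def abs_less_iff)
    have half: "p b (squash u') \<le> p b (squash u) + 1 / real M'"
      if ueq: "\<And>n. n \<le> N \<Longrightarrow> code_digit n (squash u) = code_digit n (squash u')" for b u u'
    proof (rule ccontr)
      assume "\<not> ?thesis"
      then have lt: "p b (squash u) + 1 / real M' < p b (squash u')" by simp
      obtain k where k: "\<bar>k\<bar> \<le> int M'" "p b (squash u) < real_of_int k / real M'" "real_of_int k / real M' \<le> p b (squash u')"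
        using grid_point_between[OF pb M'(1) lt] by metis
      have "(of_bool (p b (squash u) < real_of_int k / real M') :: real) = of_bool (p b (squash u') < real_of_int k / real M')"
        using ueq[OF inF[OF k(1), of b]] unfolding dig p_def .
      then show False using k by simp
    qed
    have "\<bar>p b (squash z) - p b (squash z')\<bar> \<le> 1 / real M'" for b
      using half[of z z' b] half[of z' z b] deq by (simp add: abs_le_iff)
    from this[of True] this[of False]
    have "\<bar>Re (squash z - squash z')\<bar> \<le> 1 / real M'" "\<bar>Im (squash z - squash z')\<bar> \<le> 1 / real M'" by (simp_all add: p_def)
    then have "norm (squash z - squash z') \<le> 1 / real M' + 1 / real M'"
      using cmod_le[of "squash z - squash z'"] by linarith
    also have "\<dots> < e" using M'(2) by simp
    finally show ?thesis by (simp add: dist_norm)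
  qed
  moreover have "d > 0" by (simp add: d_def)
  ultimately show ?thesis by blast
qed

text \<open>The inverse of the code is uniformly continuous on the range, so it extends to the
  closure and, by Tietze, to the line. Off the range the values of \<open>\<Phi>\<close> may leave
  the open unit disc.\<close>

lemma code_inverse:
  obtains \<Phi> :: "real \<Rightarrow> complex" where "continuous_on UNIV \<Phi>" "\<And>z. \<Phi> (code z) = squash z"
proof -
  have inj: "z = z'" if "code z = code z'" for z z'
  proof -
    have "dist (squash z) (squash z') < e" if "e > 0" for e
      using squash_code_uniformly_continuous[OF that] \<open>code z = code z'\<close> by auto
    then have "squash z = squash z'" by (metis dist_eq_0_iff less_irrefl zero_less_dist_iff)
    then show ?thesis by (metis unsquash_squash)
  qed
  define g where "g = (\<lambda>t. squash (SOME z. code z = t))"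
  have g: "g (code z) = squash z" for z
    unfolding g_def by (rule arg_cong[where f=squash], rule some_equality) (use inj in auto)
  have "uniformly_continuous_on (range code) g"
    unfolding uniformly_continuous_on_def
  proof (intro allI impI)
    fix e :: real assume "e > 0"
    from squash_code_uniformly_continuous[OF this] obtain d where "d > 0"
      "\<forall>z z'. \<bar>code z - code z'\<bar> < d \<longrightarrow> dist (squash z) (squash z') < e" by blast
    then show "\<exists>d>0. \<forall>x\<in>range code. \<forall>x'\<in>range code. dist x' x < d \<longrightarrow> dist (g x') (g x) < e"
      by (intro exI[of _ d]) (auto simp: g dist_real_def)
  qed
  then obtain g' where g': "uniformly_continuous_on (closure (range code)) g'" "\<And>t. t \<in> range code \<Longrightarrow> g t = g' t"
    using uniformly_continuous_on_extension_on_closure[of "range code" g] by metis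
  obtain \<Phi> where \<Phi>: "continuous_on UNIV \<Phi>" "\<And>t. t \<in> closure (range code) \<Longrightarrow> \<Phi> t = g' t"
    using Tietze_unbounded[of "closure (range code)" g' UNIV] uniformly_continuous_imp_continuous[OF g'(1)]
    by (metis closed_closedin closed_closure subtopology_UNIV)
  have "\<Phi> (code z) = squash z" for z
    using \<Phi>(2)[of "code z"] g'(2)[of "code z"] g[of z] closure_subset[of "range code"] by auto
  then show ?thesis using that \<Phi>(1) by blast
qed

text \<open>Codes lie in a bounded interval, so tightness on the line is automatic. The limit may
  charge parameters that decode to no point of the plane; dropping them loses mass, hence an
  inequality for \<open>emeasure \<rho> UNIV\<close>.\<close>

theorem vague_compactness:
  fixes \<nu> :: "nat \<Rightarrow> complex measure"
  assumes \<nu>: "\<And>j. borel_prob (\<nu> j)"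
  shows "\<exists>s \<rho>. strict_mono s \<and> sets \<rho> = sets borel \<and> emeasure \<rho> UNIV \<le> 1 \<and>
    (\<forall>\<psi>. test_function \<psi> \<longrightarrow> (\<lambda>j. LINT z|\<nu> (s j). \<psi> z) \<longlonglongrightarrow> (LINT z|\<rho>. \<psi> z))"
proof -
  obtain \<Phi> where \<Phi>: "continuous_on UNIV \<Phi>" "\<And>z. \<Phi> (code z) = squash z" using code_inverse by blast
  have [measurable]: "\<Phi> \<in> borel_measurable borel" by (rule borel_measurable_continuous_onI[OF \<Phi>(1)])
  have sets: "sets (\<nu> j) = sets borel" and ps: "prob_space (\<nu> j)" for j using \<nu>[of j] by (auto simp: borel_prob_def)
  note measurable_cong_sets[OF sets refl, simp]
  define \<sigma> where "\<sigma> j = distr (\<nu> j) borel code" for j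
  have rd: "real_distribution (\<sigma> j)" for j
    unfolding \<sigma>_def by (rule prob_space.real_distribution_distr[OF ps]) simp
  have m1: "measure (\<sigma> j) {-1<..1} = 1" for j
  proof -
    interpret P: prob_space "\<nu> j" by (rule ps)
    have "code -` {-1<..1} \<inter> space (\<nu> j) = space (\<nu> j)"
    proof -
      have "-1 < code z" for z using code_bounds(1)[of z] by linarith
      then show ?thesis using code_bounds(2) by auto
    qed
    then show ?thesis unfolding \<sigma>_def by (subst measure_distr) (simp_all add: P.prob_space)
  qed
  have "tight \<sigma>"
    unfolding tight_def
  proof (intro conjI allI impI)
    fix \<epsilon> :: real assume "\<epsilon> > 0"
    then show "\<exists>a b. a < b \<and> (\<forall>n. 1 - \<epsilon> < measure (\<sigma> n) {a<..b})"
      using m1 by (intro exI[of _ "-1"] exI[of _ 1]) simp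
  qed (rule rd)
  then obtain s M where s: "strict_mono s" "real_distribution M" "weak_conv_m (\<sigma> \<circ> s) M"
    using tight_imp_convergent_subsubsequence[of \<sigma> id] by (auto simp: strict_mono_def)
  interpret M: real_distribution M by (rule s(2))
  have wc: "(\<lambda>n. integral\<^sup>L (\<sigma> (s n)) f) \<longlonglongrightarrow> integral\<^sup>L M f"
    if "\<And>x. isCont f x" "\<And>x. norm (f x) \<le> B" for f :: "real \<Rightarrow> complex" and B
    using weak_conv_imp_integral_bdd_continuous_conv[of "\<sigma> \<circ> s" M f B] rd s that by (simp add: o_def)
  \<comment> \<open>The parameters that decode to a point of the plane, since \<open>squash\<close>
    maps into the open unit disc.\<close>
  define D where "D = {t. norm (\<Phi> t) < 1}"
  have D[measurable]: "D \<in> sets borel" unfolding D_def by measurable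
  define \<rho> where "\<rho> = distr (restrict_space M D) borel (unsquash \<circ> \<Phi>)"
  have um: "unsquash \<circ> \<Phi> \<in> measurable (restrict_space M D) borel"
    by (intro measurable_restrict_space1) measurable
  show ?thesis
  proof (intro exI[of _ s] exI[of _ \<rho>] conjI allI impI)
    show "sets \<rho> = sets borel" by (simp add: \<rho>_def)
    have "emeasure \<rho> UNIV = emeasure (restrict_space M D) (space (restrict_space M D))"
      unfolding \<rho>_def using um by (subst emeasure_distr) auto
    also have "\<dots> = emeasure M D" by (subst emeasure_restrict_space) (auto simp: space_restrict_space)
    also have "\<dots> \<le> 1" by (rule M.emeasure_le_1)
    finally show "emeasure \<rho> UNIV \<le> 1" .
    fix \<psi> :: "complex \<Rightarrow> complex" assume \<psi>: "test_function \<psi>"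
    obtain R where R: "R > 0" "\<And>z. norm z > R \<Longrightarrow> \<psi> z = 0" using test_function_support[OF \<psi>] by blast
    obtain B where B: "B > 0" "\<And>z. norm (\<psi> z) \<le> B" using test_function_bounded[OF \<psi>] by blast
    \<comment> \<open>\<open>\<psi>\<close> transported to the disc. Its support corresponds to
      \<open>norm w \<le> R / (1 + R)\<close>, which stays away from the unit circle, so extension
      by 0 is continuous.\<close>
    define \<psi>' where "\<psi>' = (\<lambda>w. if norm w < 1 then \<psi> (unsquash w) else 0)"
    have c: "continuous_on UNIV \<psi>'"
    proof -
      let ?A = "{w::complex. norm w < 1}" and ?B = "{w::complex. norm w > R / (1 + R)}"
      have "continuous_on ?A (\<lambda>w. \<psi> (unsquash w))"
        unfolding unsquash_def
        by (rule continuous_on_compose2[OF test_function_continuous[OF \<psi>, of UNIV]]) (auto intro!: continuous_intros)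
      then have A: "continuous_on ?A \<psi>'" by (rule continuous_on_eq) (simp add: \<psi>'_def)
      have "\<psi>' w = 0" if "w \<in> ?B" for w
      proof (cases "norm w < 1")
        case True
        have "norm w * (1 + R) > R" using that R(1) by (simp add: field_simps)
        then have "norm (unsquash w) > R" using True by (simp add: unsquash_def field_simps)
        then show ?thesis using R by (simp add: \<psi>'_def)
      qed (simp add: \<psi>'_def)
      then have B: "continuous_on ?B \<psi>'" by (intro continuous_on_eq[OF continuous_on_const[of _ 0]]) simp
      have "continuous_on (?A \<union> ?B) \<psi>'"
        by (rule continuous_on_open_Un[OF _ _ A B]) (intro open_Collect_less continuous_intros)+
      moreover have "R / (1 + R) < 1" using R(1) by simp
      then have "?A \<union> ?B = UNIV" by auto
      ultimately show ?thesis by simp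
    qed
    have [measurable]: "\<psi>' \<in> borel_measurable borel" by (rule borel_measurable_continuous_onI[OF c])
    have "(\<lambda>n. integral\<^sup>L (\<sigma> (s n)) (\<psi>' \<circ> \<Phi>)) \<longlonglongrightarrow> integral\<^sup>L M (\<psi>' \<circ> \<Phi>)"
    proof (rule wc)
      show "isCont (\<psi>' \<circ> \<Phi>) x" for x
      proof -
        have "continuous_on UNIV (\<psi>' \<circ> \<Phi>)"
          by (rule continuous_on_compose[OF \<Phi>(1)]) (rule continuous_on_subset[OF c], simp)
        then show ?thesis by (simp add: continuous_on_eq_continuous_at o_def)
      qed
      show "norm ((\<psi>' \<circ> \<Phi>) x) \<le> B" for x using B by (simp add: \<psi>'_def less_imp_le)
    qed
    moreover have "integral\<^sup>L (\<sigma> n) (\<psi>' \<circ> \<Phi>) = (LINT z|\<nu> n. \<psi> z)" for n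
    proof -
      have mm: "\<psi>' \<circ> \<Phi> \<in> borel_measurable borel" by measurable
      have "\<psi>' (squash z) = \<psi> z" for z by (simp add: \<psi>'_def norm_squash_less_1)
      then show ?thesis unfolding \<sigma>_def by (subst integral_distr[OF _ mm]) (simp_all add: \<Phi>(2))
    qed
    moreover have "integral\<^sup>L M (\<psi>' \<circ> \<Phi>) = (LINT z|\<rho>. \<psi> z)"
      unfolding \<rho>_def
      by (subst integral_distr[OF um])
         (auto simp: integral_restrict_space test_function_measurable[OF \<psi>] D_def \<psi>'_def indicator_def intro!: Bochner_Integration.integral_cong)
    ultimately show "(\<lambda>j. LINT z|\<nu> (s j). \<psi> z) \<longlonglongrightarrow> (LINT z|\<rho>. \<psi> z)" by simp
  qed (rule s(1))
qed

section \<open>The measure of a subharmonic function of logarithmic growth\<close>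

lemma frechet_derivative_scale:
  assumes "smooth f"
  shows "((\<lambda>z. f (complex_of_real c * z)) has_derivative (\<lambda>v. c *\<^sub>R frechet_derivative f (at (complex_of_real c * z)) v)) (at z)"
proof -
  have d: "f differentiable (at (complex_of_real c * z))" using assms by (rule smooth_differentiable)
  have "((\<lambda>z. complex_of_real c * z) has_derivative (\<lambda>v. complex_of_real c * v)) (at z)"
    by (auto intro!: derivative_eq_intros)
  from has_derivative_compose[OF this d[unfolded frechet_derivative_works]]
  have "((\<lambda>z. f (complex_of_real c * z)) has_derivative (\<lambda>v. frechet_derivative f (at (complex_of_real c * z)) (c *\<^sub>R v))) (at z)"
    by (simp add: scaleR_conv_of_real)
  then show ?thesis using linear_frechet_derivative[OF d] by (simp add: linear_scale)
qed

lemma laplacian_scale: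
  assumes f: "smooth f"
  shows "laplacian (\<lambda>z. f (complex_of_real c * z)) z = c\<^sup>2 *\<^sub>R laplacian f (complex_of_real c * z)"
proof -
  have 1: "frechet_derivative (\<lambda>z. f (complex_of_real c * z)) (at w) b = c *\<^sub>R frechet_derivative f (at (complex_of_real c * w)) b" for w b
    using frechet_derivative_at[OF frechet_derivative_scale[OF f, of c w]] by metis
  have 2: "frechet_derivative (\<lambda>w. c *\<^sub>R frechet_derivative f (at (complex_of_real c * w)) b) (at z) b
    = c *\<^sub>R c *\<^sub>R frechet_derivative (\<lambda>w. frechet_derivative f (at w) b) (at (complex_of_real c * z)) b" for b
    using frechet_derivative_at[OF has_derivative_scaleR_right[OF frechet_derivative_scale[OF smooth_frechet_derivative[OF f, of b], of c z], of c]] by metis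
  show ?thesis unfolding laplacian_def 1 2 by (simp add: power2_eq_square scaleR_add_right)
qed

text \<open>Steepness \<open>1/n\<close> on a square of half-side \<open>n\<close> makes the family
  a rescaling of \<open>cutoff 1\<close>: the Laplacian is of order \<open>1/n\<^sup>2\<close> on an
  area of order \<open>n\<^sup>2\<close>. The value at 0 is \<open>exp (-4)\<close>, one factor
  \<open>exp (-1)\<close> for each side of the square.\<close>

definition cutoff :: "real \<Rightarrow> complex \<Rightarrow> complex" where
  "cutoff n z = complex_of_real (box_bump (1/n) (Complex (- n) (- n)) (Complex n n) z)"

lemma test_function_cutoff: "n > 0 \<Longrightarrow> test_function (cutoff n)"
  unfolding cutoff_def by (intro test_function_box_bump) simp

lemma cutoff_scale: "n > 0 \<Longrightarrow> cutoff n z = cutoff 1 (complex_of_real (1/n) * z)"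
  by (simp add: cutoff_def box_bump_def field_simps)

lemma cutoff_nonneg: "cutoff n z = complex_of_real (Re (cutoff n z))" "0 \<le> Re (cutoff n z)" "Re (cutoff n z) \<le> 1"
  using box_bump_bounds by (simp_all add: cutoff_def)

lemma norm_cutoff_le: "norm (cutoff n z) \<le> 1"
  using box_bump_bounds by (simp add: cutoff_def)

lemma cutoff_0: "n > 0 \<Longrightarrow> cutoff n 0 = complex_of_real (exp (-4))"
  by (simp add: cutoff_def box_bump_def flat_def mult_exp_exp)

text \<open>On the disc of half size each of the four arguments of \<open>flat 0\<close> is at least
  1/2, and \<open>flat 0 (1/2) = exp (-2)\<close>.\<close>

lemma cutoff_lower:
  assumes n: "n > 0" and z: "norm z \<le> n / 2"
  shows "exp (-8) \<le> Re (cutoff n z)"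
proof -
  have f: "exp (-2) \<le> flat 0 t" if "t \<ge> 1/2" for t
    using that by (auto simp: flat_def field_simps)
  have b: "\<bar>Re z\<bar> \<le> n / 2" "\<bar>Im z\<bar> \<le> n / 2" using z abs_Re_le_cmod[of z] abs_Im_le_cmod[of z] by linarith+
  have "exp (-8) = exp (-2) * exp (-2) * (exp (-2) * exp (-2) :: real)" by (simp add: mult_exp_exp)
  also have "\<dots> \<le> Re (cutoff n z)"
    unfolding cutoff_def box_bump_def using b n
    by (simp, intro mult_mono f mult_nonneg_nonneg flat_nonneg) (auto simp: field_simps abs_le_iff)
  finally show ?thesis .
qed

lemma cutoff_eq_0:
  assumes "n > 0" "norm z > 2 * n" shows "cutoff n z = 0"
proof -
  have "z \<notin> box (Complex (- n) (- n)) (Complex n n)"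
    using assms cmod_le[of z] by (auto simp: in_box_complex_iff)
  then show ?thesis using assms box_bump_eq_0 by (simp add: cutoff_def)
qed

lemma laplacian_cutoff_bound:
  obtains L where "\<And>n z. n > 0 \<Longrightarrow> norm (laplacian (cutoff n) z) \<le> L / n\<^sup>2 * indicator (cball 0 (2 * n)) z"
proof -
  obtain L where L: "\<And>z. norm (laplacian (cutoff 1) z) \<le> L"
    using laplacian_test_function(2)[OF test_function_cutoff[of 1]] by auto
  have sm: "smooth (cutoff 1)" using test_function_cutoff[of 1] by (simp add: test_function_def)
  have "norm (laplacian (cutoff n) z) \<le> L / n\<^sup>2 * indicator (cball 0 (2 * n)) z" if n: "n > 0" for n z
  proof (cases "norm z \<le> 2 * n")
    case True
    have "cutoff n = (\<lambda>z. cutoff 1 (complex_of_real (1/n) * z))" using cutoff_scale[OF n] by auto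
    then have "laplacian (cutoff n) z = (1/n)\<^sup>2 *\<^sub>R laplacian (cutoff 1) (complex_of_real (1/n) * z)"
      using laplacian_scale[OF sm, of "1/n" z] by simp
    then have "norm (laplacian (cutoff n) z) = 1/n\<^sup>2 * norm (laplacian (cutoff 1) (complex_of_real (1/n) * z))"
      by (simp add: power_one_over)
    also have "\<dots> \<le> 1/n\<^sup>2 * L" using L by (intro mult_left_mono) auto
    finally show ?thesis using True by simp
  next
    case False
    have "supp_fun (cutoff n) \<subseteq> cball 0 (2 * n)"
      unfolding supp_fun_def using cutoff_eq_0[OF n] by (intro closure_minimal) (auto simp: not_less[symmetric])
    then have "z \<notin> supp_fun (cutoff n)" using False by auto
    then show ?thesis using laplacian_test_function(3)[OF test_function_cutoff[OF n]] False by simp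
  qed
  then show ?thesis using that by blast
qed

text \<open>The submean inequality is asked only for almost every centre, as circle averages of a
  locally integrable function allow. Growth like \<open>ln (norm z)\<close> with coefficient 1
  encodes total mass 1.\<close>

locale log_subharmonic =
  fixes U :: "complex \<Rightarrow> real"
  assumes loc_int: "loc_integrable U"
    and submean: "\<And>r. r > 0 \<Longrightarrow> AE z in lborel. U z \<le> (\<integral>\<zeta>. U (z + \<zeta>) \<partial>circle_measure r)"
    and asymptotic: "\<And>\<epsilon>. \<epsilon> > 0 \<Longrightarrow> \<exists>R>0. \<forall>z. norm z \<ge> R \<longrightarrow> \<bar>U z - ln (norm z)\<bar> \<le> \<epsilon>"
begin

lemma U_measurable [measurable]: "U \<in> borel_measurable borel"
  using loc_int by measurable

definition \<Lambda> :: "(complex \<Rightarrow> complex) \<Rightarrow> complex" where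
  "\<Lambda> \<psi> = complex_of_real (1 / (2 * pi)) * (\<integral>z. laplacian \<psi> z * complex_of_real (U z) \<partial>lborel)"

text \<open>The logarithm itself gives exactly \<open>exp (-4)\<close> by \<open>poisson\<close> at
  0. The difference between \<open>U\<close> and the logarithm contributes little: near 0 a fixed
  integral meets a Laplacian of size \<open>L / n\<^sup>2\<close>, and far out the difference is at
  most \<open>\<epsilon>\<close>.\<close>

lemma \<Lambda>_cutoff_tendsto: "(\<lambda>n. \<Lambda> (cutoff (real n))) \<longlonglongrightarrow> complex_of_real (exp (-4))"
proof (rule tendstoI)
  fix e :: real assume e: "e > 0"
  obtain L where L: "\<And>n z. n > 0 \<Longrightarrow> norm (laplacian (cutoff n) z) \<le> L / n\<^sup>2 * indicator (cball 0 (2 * n)) z"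
    using laplacian_cutoff_bound by blast
  have "norm (laplacian (cutoff 1) 0) \<le> L" using L[of 1 0] by simp
  then have L0: "L \<ge> 0" using norm_ge_zero order_trans by blast
  \<comment> \<open>The outer part contributes \<open>1 / (2 * pi) * (L / n\<^sup>2) * \<epsilon> *
    (pi * (2 * n)\<^sup>2) = 2 * L * \<epsilon>\<close>, at most \<open>e / 2\<close>.\<close>
  define \<epsilon> where "\<epsilon> = e / (4 * (L + 1))"
  have \<epsilon>: "\<epsilon> > 0" using e L0 by (simp add: \<epsilon>_def)
  obtain R where R: "R > 0" "\<And>z. norm z \<ge> R \<Longrightarrow> \<bar>U z - ln (norm z)\<bar> \<le> \<epsilon>" using asymptotic[OF \<epsilon>] by blast
  define D where "D = (\<lambda>z. U z - ln (norm (z - 0)))"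
  have Dm[measurable]: "D \<in> borel_measurable borel" unfolding D_def by measurable
  have ln_int: "loc_integrable (\<lambda>z. ln (norm (z - 0)))" by (rule loc_integrable_ln)
  have Di: "integrable lborel (\<lambda>z. indicator (cball 0 S) z *\<^sub>R D z)" for S
  proof -
    have "integrable lborel (\<lambda>z. indicator (cball 0 S) z *\<^sub>R U z - indicator (cball 0 S) z *\<^sub>R ln (norm (z - 0)))"
      by (rule Bochner_Integration.integrable_diff) (use loc_int ln_int in \<open>unfold loc_integrable_def, blast+\<close>)
    then show ?thesis by (simp add: D_def right_diff_distrib)
  qed
  define I where "I = (\<integral>z. indicator (cball 0 R) z * \<bar>D z\<bar> \<partial>lborel)"
  have Ii: "integrable lborel (\<lambda>z. indicator (cball 0 R) z * \<bar>D z\<bar>)"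
    using integrable_norm[OF Di[of R]] by (simp add: abs_mult)
  have fin: "emeasure lborel (cball (0::complex) S) < \<infinity>" for S by (rule emeasure_bounded_finite) simp
  have area: "measure lborel (cball (0::complex) (2 * n)) = pi * (2 * n)\<^sup>2" if "n > 0" for n
    using that by (simp add: content_cball unit_ball_vol_2)
  have bound: "norm (\<Lambda> (cutoff n) - complex_of_real (exp (-4))) \<le> L * I / n\<^sup>2 + e / 2" if n: "n > 0" for n :: real
  proof -
    have lm[measurable]: "laplacian (cutoff n) \<in> borel_measurable borel"
      by (rule laplacian_test_function(1)[OF test_function_cutoff[OF n]])
    have lb: "norm (laplacian (cutoff n) z) \<le> L / n\<^sup>2" for z
      using L[OF n, of z] L0 by (auto simp: indicator_def split: if_splits intro: order_trans)
    have l0: "laplacian (cutoff n) z = 0" if "norm z > 2 * n" for z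
      using L[OF n, of z] that by simp
    have iU: "integrable lborel (\<lambda>z. laplacian (cutoff n) z * complex_of_real (U z))"
      by (rule loc_integrable_mult[OF loc_int lm lb l0])
    have il: "integrable lborel (\<lambda>z. laplacian (cutoff n) z * complex_of_real (ln (norm (z - 0))))"
      by (rule loc_integrable_mult[OF ln_int lm lb l0])
    have "complex_of_real (exp (-4)) = complex_of_real (1 / (2 * pi)) * (\<integral>z. laplacian (cutoff n) z * complex_of_real (ln (norm (z - 0))) \<partial>lborel)"
      unfolding poisson[OF test_function_cutoff[OF n], of 0] by (simp add: cutoff_0[OF n])
    then have "\<Lambda> (cutoff n) - complex_of_real (exp (-4)) = complex_of_real (1 / (2 * pi)) * (\<integral>z. laplacian (cutoff n) z * complex_of_real (D z) \<partial>lborel)"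
      unfolding \<Lambda>_def D_def using iU il by (simp add: right_diff_distrib)
    also have "norm \<dots> = 1 / (2 * pi) * norm (\<integral>z. laplacian (cutoff n) z * complex_of_real (D z) \<partial>lborel)"
      by (simp only: norm_mult norm_of_real) simp
    also have "\<dots> \<le> 1 / (2 * pi) * (\<integral>z. L / n\<^sup>2 * (indicator (cball 0 R) z * \<bar>D z\<bar> + \<epsilon> * indicator (cball 0 (2 * n)) z) \<partial>lborel)"
    proof (intro mult_left_mono norm_integral_le)
      show "integrable lborel (\<lambda>z. laplacian (cutoff n) z * complex_of_real (D z))"
        unfolding D_def using iU il by (simp add: right_diff_distrib)
      show "integrable lborel (\<lambda>z. L / n\<^sup>2 * (indicator (cball 0 R) z * \<bar>D z\<bar> + \<epsilon> * indicator (cball 0 (2 * n)) z))"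
        using Ii fin by (intro integrable_mult_right Bochner_Integration.integrable_add) (auto simp: integrable_indicator_iff)
      fix z
      have "indicator (cball 0 (2 * n)) z * \<bar>D z\<bar> \<le> indicator (cball 0 R) z * \<bar>D z\<bar> + \<epsilon> * indicator (cball 0 (2 * n)) z"
        using R(2)[of z] \<epsilon> by (auto simp: indicator_def D_def)
      then have "L / n\<^sup>2 * (indicator (cball 0 (2 * n)) z * \<bar>D z\<bar>) \<le> L / n\<^sup>2 * (indicator (cball 0 R) z * \<bar>D z\<bar> + \<epsilon> * indicator (cball 0 (2 * n)) z)"
        using L0 by (intro mult_left_mono) auto
      moreover have "norm (laplacian (cutoff n) z * complex_of_real (D z)) \<le> L / n\<^sup>2 * indicator (cball 0 (2 * n)) z * \<bar>D z\<bar>"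
        unfolding norm_mult norm_of_real using L[OF n, of z] by (intro mult_right_mono) auto
      ultimately show "norm (laplacian (cutoff n) z * complex_of_real (D z)) \<le> L / n\<^sup>2 * (indicator (cball 0 R) z * \<bar>D z\<bar> + \<epsilon> * indicator (cball 0 (2 * n)) z)"
        by (simp add: mult.assoc)
    qed simp
    also have "(\<integral>z. L / n\<^sup>2 * (indicator (cball 0 R) z * \<bar>D z\<bar> + \<epsilon> * indicator (cball 0 (2 * n)) z) \<partial>lborel) = L / n\<^sup>2 * (I + \<epsilon> * (pi * (2 * n)\<^sup>2))"
      using Ii fin[of "2 * n"] area[OF n] by (simp add: I_def integrable_indicator_iff)
    also have "1 / (2 * pi) * (L / n\<^sup>2 * (I + \<epsilon> * (pi * (2 * n)\<^sup>2))) = 1 / (2 * pi) * (L * I / n\<^sup>2) + 2 * (L * \<epsilon>)"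
      using n by (simp add: field_simps power2_eq_square)
    also have "\<dots> \<le> L * I / n\<^sup>2 + e / 2"
    proof (rule add_mono)
      have "I \<ge> 0" unfolding I_def by (rule integral_nonneg_AE) simp
      then have "0 \<le> L * I / n\<^sup>2" using L0 by simp
      moreover have "1 / (2 * pi) \<le> 1" using pi_ge_two by simp
      ultimately show "1 / (2 * pi) * (L * I / n\<^sup>2) \<le> L * I / n\<^sup>2" by (metis mult_left_le_one_le mult_1 mult_right_mono)
      have "L * \<epsilon> = e / 4 * (L / (L + 1))" by (simp add: \<epsilon>_def)
      also have "\<dots> \<le> e / 4" using e L0 by (intro mult_left_le) (auto simp: field_simps)
      finally show "2 * (L * \<epsilon>) \<le> e / 2" by simp
    qed
    finally show ?thesis .
  qed
  have "(\<lambda>n. L * I / (real n)\<^sup>2 + e / 2) \<longlonglongrightarrow> 0 + e / 2"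
    by (intro tendsto_add tendsto_const) real_asymp
  then have "\<forall>\<^sub>F n in sequentially. L * I / (real n)\<^sup>2 + e / 2 < e"
    by (rule order_tendstoD(2)) (use e in simp)
  then show "\<forall>\<^sub>F n in sequentially. dist (\<Lambda> (cutoff (real n))) (complex_of_real (exp (-4))) < e"
    using eventually_gt_at_top[of 0]
  proof eventually_elim
    case (elim n)
    then show ?case using bound[of "real n"] by (simp add: dist_norm)
  qed
qed

text \<open>The constant is \<open>1 / (2 * pi)\<close> times the \<open>4 / r\<^sup>2\<close> of
  \<open>laplacian_limit\<close>. By \<open>submean\<close> the maximum with 0 changes values only
  on a null set and makes the function a density at every point.\<close>

definition smoothed_density :: "real \<Rightarrow> complex \<Rightarrow> real" where
  "smoothed_density r z = 2 / (pi * r\<^sup>2) * max 0 ((\<integral>\<zeta>. U (z + \<zeta>) \<partial>circle_measure r) - U z)"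

lemma smoothed_density_measurable [measurable]: "smoothed_density r \<in> borel_measurable borel"
proof -
  interpret C: prob_space "circle_measure r" by (rule prob_space_circle_measure)
  show ?thesis unfolding smoothed_density_def by measurable
qed

lemma smoothed_density_nonneg: "0 \<le> smoothed_density r z"
  by (simp add: smoothed_density_def)

lemma test_function_support_cball:
  assumes "test_function \<psi>"
  obtains R B where "R > 0" "\<And>z. norm z > R \<Longrightarrow> \<psi> z = 0" "\<And>z. norm (\<psi> z) \<le> B"
  using test_function_support[OF assms] test_function_bounded[OF assms] by metis

lemma smoothed_density_integral:
  assumes \<psi>: "test_function \<psi>" and r: "r > 0"
  shows "(\<integral>z. \<psi> z * complex_of_real (smoothed_density r z) \<partial>lborel) = complex_of_real (1 / (2 * pi)) *
    (complex_of_real (4/r\<^sup>2) * (\<integral>z. \<psi> z * complex_of_real ((\<integral>\<zeta>. U (z + \<zeta>) \<partial>circle_measure r) - U z) \<partial>lborel))"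
    and "integrable lborel (\<lambda>z. \<psi> z * complex_of_real (smoothed_density r z))"
proof -
  interpret C: prob_space "circle_measure r" by (rule prob_space_circle_measure)
  have [measurable]: "\<psi> \<in> borel_measurable borel" by (rule test_function_measurable[OF \<psi>])
  obtain R B where RB: "R > 0" "\<And>z. norm z > R \<Longrightarrow> \<psi> z = 0" "\<And>z. norm (\<psi> z) \<le> B"
    using test_function_support_cball[OF \<psi>] by metis
  define c where "c = complex_of_real (2 / (pi * r\<^sup>2))"
  define g where "g = (\<lambda>z. \<psi> z * complex_of_real ((\<integral>\<zeta>. U (z + \<zeta>) \<partial>circle_measure r) - U z))"
  have [measurable]: "g \<in> borel_measurable borel" unfolding g_def by measurable
  have ae: "AE z in lborel. \<psi> z * complex_of_real (smoothed_density r z) = c * g z"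
    using submean[OF r] by eventually_elim (simp add: smoothed_density_def c_def g_def)
  have gi: "integrable lborel g"
    using circle_average_Fubini(1)[OF loc_int test_function_measurable[OF \<psi>] r RB(3,2)]
      loc_integrable_mult[OF loc_int test_function_measurable[OF \<psi>] RB(3,2)]
    unfolding g_def by (simp add: right_diff_distrib)
  have "(\<integral>z. \<psi> z * complex_of_real (smoothed_density r z) \<partial>lborel) = (\<integral>z. c * g z \<partial>lborel)"
    by (rule integral_cong_AE[OF _ _ ae]) measurable
  also have "\<dots> = c * (\<integral>z. g z \<partial>lborel)" by simp
  also have "c = complex_of_real (1 / (2 * pi)) * complex_of_real (4/r\<^sup>2)" using r by (simp add: c_def field_simps)
  finally show "(\<integral>z. \<psi> z * complex_of_real (smoothed_density r z) \<partial>lborel) = complex_of_real (1 / (2 * pi)) *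
    (complex_of_real (4/r\<^sup>2) * (\<integral>z. \<psi> z * complex_of_real ((\<integral>\<zeta>. U (z + \<zeta>) \<partial>circle_measure r) - U z) \<partial>lborel))"
    by (simp add: g_def mult.assoc)
  show "integrable lborel (\<lambda>z. \<psi> z * complex_of_real (smoothed_density r z))"
    by (subst integrable_cong_AE[OF _ _ ae]) (use gi in auto)
qed

lemma smoothed_density_tendsto:
  assumes \<psi>: "test_function \<psi>"
  shows "((\<lambda>r. \<integral>z. \<psi> z * complex_of_real (smoothed_density r z) \<partial>lborel) \<longlongrightarrow> \<Lambda> \<psi>) (at_right 0)"
proof (rule Lim_transform_eventually)
  show "((\<lambda>r. complex_of_real (1 / (2 * pi)) * (complex_of_real (4/r\<^sup>2) * (\<integral>z. \<psi> z * complex_of_real ((\<integral>\<zeta>. U (z + \<zeta>) \<partial>circle_measure r) - U z) \<partial>lborel))) \<longlongrightarrow> \<Lambda> \<psi>) (at_right 0)"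
    unfolding \<Lambda>_def by (intro tendsto_mult_left laplacian_limit[OF loc_int \<psi>])
  show "\<forall>\<^sub>F r in at_right 0. complex_of_real (1 / (2 * pi)) * (complex_of_real (4/r\<^sup>2) * (\<integral>z. \<psi> z * complex_of_real ((\<integral>\<zeta>. U (z + \<zeta>) \<partial>circle_measure r) - U z) \<partial>lborel)) = (\<integral>z. \<psi> z * complex_of_real (smoothed_density r z) \<partial>lborel)"
  proof (rule eventually_at_rightI[of 0 1])
    fix r :: real assume "r \<in> {0<..<1}"
    then have "r > 0" by simp
    from smoothed_density_integral(1)[OF \<psi> this] show "complex_of_real (1 / (2 * pi)) * (complex_of_real (4/r\<^sup>2) * (\<integral>z. \<psi> z * complex_of_real ((\<integral>\<zeta>. U (z + \<zeta>) \<partial>circle_measure r) - U z) \<partial>lborel)) = (\<integral>z. \<psi> z * complex_of_real (smoothed_density r z) \<partial>lborel)"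
      by (rule sym)
  qed simp
qed

text \<open>\<open>exp 8 * cutoff n\<close> is at least 1 on the disc of radius \<open>n / 2\<close>
  and nonnegative elsewhere, so the pairing with the cutoff bounds the mass there.\<close>

lemma smoothed_density_mass:
  assumes n: "n > 0" and r: "r > 0"
    and b: "norm (\<integral>z. cutoff n z * complex_of_real (smoothed_density r z) \<partial>lborel) \<le> B"
  shows "(\<integral>\<^sup>+z. ennreal (smoothed_density r z * indicator (cball 0 (n / 2)) z) \<partial>lborel) \<le> ennreal (exp 8 * B)"
proof -
  have eq: "cutoff n z * complex_of_real (smoothed_density r z) = complex_of_real (Re (cutoff n z) * smoothed_density r z)" for z
    using cutoff_nonneg(1)[of n z] by simp
  have [measurable]: "cutoff n \<in> borel_measurable borel" by (rule test_function_measurable[OF test_function_cutoff[OF n]])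
  have i: "integrable lborel (\<lambda>z. Re (cutoff n z) * smoothed_density r z)"
    using smoothed_density_integral(2)[OF test_function_cutoff[OF n] r] unfolding eq by (simp only: complex_of_real_integrable_eq)
  have nn: "0 \<le> (\<integral>z. Re (cutoff n z) * smoothed_density r z \<partial>lborel)"
    by (intro integral_nonneg_AE AE_I2 mult_nonneg_nonneg cutoff_nonneg smoothed_density_nonneg)
  have "(\<integral>\<^sup>+z. ennreal (smoothed_density r z * indicator (cball 0 (n / 2)) z) \<partial>lborel)
    \<le> (\<integral>\<^sup>+z. ennreal (exp 8 * (Re (cutoff n z) * smoothed_density r z)) \<partial>lborel)"
  proof (intro nn_integral_mono ennreal_leI)
    fix z
    show "smoothed_density r z * indicator (cball 0 (n / 2)) z \<le> exp 8 * (Re (cutoff n z) * smoothed_density r z)"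
    proof (cases "norm z \<le> n / 2")
      case True
      have "1 = exp 8 * exp (-8 :: real)" by (simp add: mult_exp_exp)
      also have "\<dots> \<le> exp 8 * Re (cutoff n z)" using cutoff_lower[OF n True] by simp
      finally have "1 * smoothed_density r z \<le> exp 8 * Re (cutoff n z) * smoothed_density r z"
        by (intro mult_right_mono smoothed_density_nonneg)
      then show ?thesis using True by (simp add: mult.assoc)
    qed (use cutoff_nonneg[of n z] smoothed_density_nonneg[of r z] in simp)
  qed
  also have "\<dots> = ennreal (\<integral>z. exp 8 * (Re (cutoff n z) * smoothed_density r z) \<partial>lborel)"
    by (rule nn_integral_eq_integral) (use i cutoff_nonneg smoothed_density_nonneg in auto)
  also have "\<dots> \<le> ennreal (exp 8 * B)"
    using b nn unfolding eq integral_complex_of_real norm_of_real by (intro ennreal_leI) simp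
  finally show ?thesis .
qed

text \<open>A positive distribution is a measure. Since \<open>vague_compactness\<close> speaks of
  probability measures, the smoothed densities are truncated to growing discs, divided by a common
  bound \<open>C\<close> of their masses and completed to mass 1; the limit is multiplied by
  \<open>C\<close> again.\<close>

theorem laplacian_measure:
  obtains \<rho> where "borel_prob \<rho>" "\<And>\<psi>. test_function \<psi> \<Longrightarrow> (LINT z|\<rho>. \<psi> z) = \<Lambda> \<psi>"
proof -
  have "\<forall>\<^sub>F n in sequentially. dist (\<Lambda> (cutoff (real n))) (complex_of_real (exp (-4))) < 1"
    by (rule tendstoD[OF \<Lambda>_cutoff_tendsto]) simp
  then obtain N where N: "\<And>n. n \<ge> N \<Longrightarrow> dist (\<Lambda> (cutoff (real n))) (complex_of_real (exp (-4))) < 1"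
    unfolding eventually_sequentially by blast
  have \<Lambda>2: "norm (\<Lambda> (cutoff (real n))) \<le> 2" if "n \<ge> N" for n
  proof -
    have "norm (\<Lambda> (cutoff (real n))) \<le> dist (\<Lambda> (cutoff (real n))) (complex_of_real (exp (-4))) + norm (complex_of_real (exp (-4)))"
      by (metis dist_0_norm dist_triangle dist_commute)
    moreover have "exp (-4::real) \<le> 1" by simp
    ultimately show ?thesis using N[OF that] by (simp del: exp_le_one_iff)
  qed
  \<comment> \<open>The pairings with the cutoffs are at most 3 in modulus: 2 for their limits by
    \<open>\<Lambda>2\<close>, and 1 for the choice of the radii below. The factor
    \<open>exp 8\<close> is that of \<open>smoothed_density_mass\<close>.\<close>
  define C where "C = exp 8 * (3::real)"
  have C: "C > 0" by (simp add: C_def)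
  define n where "n = (\<lambda>j. real (j + N + 1))"
  have n: "n j > 0" for j by (simp add: n_def)
  \<comment> \<open>A diagonal choice: convergence as \<open>r\<close> tends to 0 is known for one
    cutoff at a time, so the radius is picked after the size of the disc; the bound by
    \<open>1 / real (Suc j)\<close> forces it to 0.\<close>
  have "\<exists>r. 0 < r \<and> r < 1 / real (Suc j) \<and> dist (\<integral>z. cutoff (n j) z * complex_of_real (smoothed_density r z) \<partial>lborel) (\<Lambda> (cutoff (n j))) < 1" for j
  proof -
    have "\<forall>\<^sub>F r in at_right 0. dist (\<integral>z. cutoff (n j) z * complex_of_real (smoothed_density r z) \<partial>lborel) (\<Lambda> (cutoff (n j))) < 1"
      by (rule tendstoD[OF smoothed_density_tendsto[OF test_function_cutoff[OF n]]]) simp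
    moreover have "\<forall>\<^sub>F r in at_right 0. r \<in> {0<..<1 / real (Suc j)}"
      by (rule eventually_at_right_real) simp
    ultimately have "\<forall>\<^sub>F r in at_right (0::real). 0 < r \<and> r < 1 / real (Suc j) \<and> dist (\<integral>z. cutoff (n j) z * complex_of_real (smoothed_density r z) \<partial>lborel) (\<Lambda> (cutoff (n j))) < 1"
      by eventually_elim auto
    then show ?thesis by (rule eventually_happens'[rotated]) simp
  qed
  then obtain r where r: "\<And>j. 0 < r j" "\<And>j. r j < 1 / real (Suc j)"
    "\<And>j. dist (\<integral>z. cutoff (n j) z * complex_of_real (smoothed_density (r j) z) \<partial>lborel) (\<Lambda> (cutoff (n j))) < 1"
    by metis
  have r0: "filterlim r (at_right 0) sequentially"
  proof (rule tendsto_imp_filterlim_at_right)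
    show "r \<longlonglongrightarrow> 0"
    proof (rule tendsto_sandwich[OF _ _ tendsto_const])
      show "(\<lambda>j. 1 / real (Suc j)) \<longlonglongrightarrow> 0" using LIMSEQ_inverse_real_of_nat by (simp add: inverse_eq_divide)
    qed (intro always_eventually allI less_imp_le r(1,2))+
  qed (use r(1) in auto)
  define f where "f = (\<lambda>j z. smoothed_density (r j) z * indicator (cball 0 (n j / 2)) z)"
  have fm[measurable]: "f j \<in> borel_measurable borel" for j unfolding f_def by measurable
  have f0: "0 \<le> f j z" for j z by (simp add: f_def smoothed_density_nonneg)
  have fC: "(\<integral>\<^sup>+z. ennreal (f j z) \<partial>lborel) \<le> ennreal C" for j
    unfolding f_def C_def
  proof (rule smoothed_density_mass[OF n r(1)])
    show "norm (\<integral>z. cutoff (n j) z * complex_of_real (smoothed_density (r j) z) \<partial>lborel) \<le> 3"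
    proof -
      have "norm x \<le> dist x y + norm y" for x y :: complex by (metis dist_0_norm dist_triangle dist_commute)
      from this[of _ "\<Lambda> (cutoff (n j))"]
      have "norm (\<integral>z. cutoff (n j) z * complex_of_real (smoothed_density (r j) z) \<partial>lborel) \<le>
        dist (\<integral>z. cutoff (n j) z * complex_of_real (smoothed_density (r j) z) \<partial>lborel) (\<Lambda> (cutoff (n j))) + norm (\<Lambda> (cutoff (n j)))" .
      moreover have "norm (\<Lambda> (cutoff (n j))) \<le> 2" unfolding n_def by (rule \<Lambda>2) simp
      ultimately show ?thesis using r(3)[of j] by linarith
    qed
  qed
  have fi: "integrable lborel (f j)" for j
    by (rule integrableI_nonneg) (use f0 fC[of j] in \<open>auto simp: le_less_trans\<close>)
  define mass where "mass j = (\<integral>z. f j z \<partial>lborel)" for j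
  have mass: "0 \<le> mass j" "mass j \<le> C" for j
  proof -
    show "0 \<le> mass j" unfolding mass_def by (rule integral_nonneg_AE) (simp add: f0)
    have "ennreal (mass j) \<le> ennreal C" unfolding mass_def using fC[of j] nn_integral_eq_integral[OF fi[of j]] f0 by simp
    then show "mass j \<le> C" using C by simp
  qed
  define B where "B j = ball (complex_of_real (3 * n j)) 1" for j
  have Bfin: "emeasure lborel (B j) < \<infinity>" for j unfolding B_def by (rule emeasure_bounded_finite) simp
  have Barea: "measure lborel (B j) = pi" for j unfolding B_def by (simp add: content_ball unit_ball_vol_2)
  have [measurable]: "B j \<in> sets borel" for j by (simp add: B_def)
  \<comment> \<open>The missing mass is put on balls escaping to infinity, where it does not affect vague limits.\<close>
  define g where "g = (\<lambda>j z. f j z / C + (1 - mass j / C) / pi * indicator (B j) z)"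
  have g0: "0 \<le> g j z" for j z
    unfolding g_def using f0[of j z] mass[of j] C by (intro add_nonneg_nonneg mult_nonneg_nonneg divide_nonneg_nonneg) auto
  have gm[measurable]: "g j \<in> borel_measurable borel" for j unfolding g_def by measurable
  have iB: "integrable lborel (\<lambda>z. (1 - mass j / C) / pi * indicator (B j) z)" for j
    using Bfin[of j] by (intro integrable_mult_right) (simp add: integrable_indicator_iff)
  have gi: "integrable lborel (g j)" for j
    unfolding g_def by (intro Bochner_Integration.integrable_add iB) (use fi[of j] in simp)
  have gint: "(\<integral>z. g j z \<partial>lborel) = 1" for j
  proof -
    have "(\<integral>z. g j z \<partial>lborel) = mass j / C + (1 - mass j / C) / pi * measure lborel (B j)"
      unfolding g_def using fi[of j] iB[of j] by (simp add: mass_def)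
    then show ?thesis using Barea[of j] by simp
  qed
  define \<nu> where "\<nu> j = density lborel (\<lambda>z. ennreal (g j z))" for j
  have \<nu>: "borel_prob (\<nu> j)" for j
    unfolding borel_prob_def
  proof
    show "sets (\<nu> j) = sets borel" by (simp add: \<nu>_def)
    show "prob_space (\<nu> j)"
    proof (rule prob_spaceI)
      show "emeasure (\<nu> j) (space (\<nu> j)) = 1"
        unfolding \<nu>_def using nn_integral_eq_integral[OF gi[of j]] g0 gint[of j] by (simp add: emeasure_density)
    qed
  qed
  obtain s \<rho>0 where s: "strict_mono s" and \<rho>0: "sets \<rho>0 = sets borel" "emeasure \<rho>0 UNIV \<le> 1"
    and lim': "\<forall>\<psi>. test_function \<psi> \<longrightarrow> (\<lambda>j. LINT z|\<nu> (s j). \<psi> z) \<longlonglongrightarrow> (LINT z|\<rho>0. \<psi> z)"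
    using vague_compactness[of \<nu>, OF \<nu>] by blast
  have lim: "(\<lambda>j. LINT z|\<nu> (s j). \<psi> z) \<longlonglongrightarrow> (LINT z|\<rho>0. \<psi> z)" if "test_function \<psi>" for \<psi>
    using lim' that by simp
  have nlim: "filterlim n at_top sequentially" unfolding n_def by real_asymp
  have \<nu>lim: "(\<lambda>j. LINT z|\<nu> j. \<psi> z) \<longlonglongrightarrow> \<Lambda> \<psi> / complex_of_real C" if \<psi>: "test_function \<psi>" for \<psi>
  proof (rule Lim_transform_eventually)
    have [measurable]: "\<psi> \<in> borel_measurable borel" by (rule test_function_measurable[OF \<psi>])
    show "(\<lambda>j. (\<integral>z. \<psi> z * complex_of_real (smoothed_density (r j) z) \<partial>lborel) / complex_of_real C) \<longlonglongrightarrow> \<Lambda> \<psi> / complex_of_real C"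
      using C by (intro tendsto_divide tendsto_const filterlim_compose[OF smoothed_density_tendsto[OF \<psi>] r0]) simp
    obtain R where R: "R > 0" "\<And>z. norm z > R \<Longrightarrow> \<psi> z = 0" using test_function_support[OF \<psi>] by blast
    \<comment> \<open>From here on the support of \<open>\<psi>\<close> lies in the disc of
      truncation and misses \<open>B j\<close>, so \<open>\<nu> j\<close> integrates
      \<open>\<psi>\<close> like the smoothed density divided by \<open>C\<close>.\<close>
    have "\<forall>\<^sub>F j in sequentially. n j \<ge> 2 * R + 1" using nlim by (simp add: filterlim_at_top)
    then show "\<forall>\<^sub>F j in sequentially. (\<integral>z. \<psi> z * complex_of_real (smoothed_density (r j) z) \<partial>lborel) / complex_of_real C = (LINT z|\<nu> j. \<psi> z)"
    proof eventually_elim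
      case (elim j)
      have "(LINT z|\<nu> j. \<psi> z) = (\<integral>z. g j z *\<^sub>R \<psi> z \<partial>lborel)"
        unfolding \<nu>_def by (rule integral_density) (use g0 in auto)
      also have "\<dots> = (\<integral>z. \<psi> z * complex_of_real (smoothed_density (r j) z) / complex_of_real C \<partial>lborel)"
      proof (rule Bochner_Integration.integral_cong[OF refl])
        fix z
        show "g j z *\<^sub>R \<psi> z = \<psi> z * complex_of_real (smoothed_density (r j) z) / complex_of_real C"
        proof (cases "norm z \<le> R")
          case True
          have "z \<notin> B j"
          proof
            assume "z \<in> B j"
            then have "norm (complex_of_real (3 * n j) - z) < 1" by (simp add: B_def dist_norm)
            moreover have "norm (complex_of_real (3 * n j)) - norm z \<le> norm (complex_of_real (3 * n j) - z)" by (rule norm_triangle_ineq2)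
            moreover have "norm (complex_of_real (3 * n j)) = 3 * n j" using n[of j] by (subst norm_of_real) simp
            ultimately show False using True elim R(1) by linarith
          qed
          moreover have "z \<in> cball 0 (n j / 2)" using True elim by simp
          ultimately show ?thesis by (simp add: g_def f_def scaleR_conv_of_real)
        qed (use R in simp)
      qed
      also have "\<dots> = (\<integral>z. \<psi> z * complex_of_real (smoothed_density (r j) z) \<partial>lborel) / complex_of_real C" by simp
      finally show ?case by simp
    qed
  qed
  have \<rho>0int: "(LINT z|\<rho>0. \<psi> z) = \<Lambda> \<psi> / complex_of_real C" if \<psi>: "test_function \<psi>" for \<psi>
    using LIMSEQ_unique[OF lim[OF \<psi>] LIMSEQ_subseq_LIMSEQ[OF \<nu>lim[OF \<psi>] s, unfolded o_def]] .
  define \<rho> where "\<rho> = density \<rho>0 (\<lambda>_. ennreal C)"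
  have \<rho>s: "sets \<rho> = sets borel" by (simp add: \<rho>_def \<rho>0)
  have sp0: "space \<rho>0 = UNIV" using sets_eq_imp_space_eq[OF \<rho>0(1)] by simp
  have \<rho>int: "(LINT z|\<rho>. \<psi> z) = \<Lambda> \<psi>" if \<psi>: "test_function \<psi>" for \<psi>
  proof -
    have "(LINT z|\<rho>. \<psi> z) = (LINT z|\<rho>0. C *\<^sub>R \<psi> z)"
      unfolding \<rho>_def using C test_function_measurable[OF \<psi>] measurable_cong_sets[OF \<rho>0(1) refl]
      by (intro integral_density) auto
    then show ?thesis using \<rho>0int[OF \<psi>] C by (simp add: scaleR_conv_of_real)
  qed
  interpret R: finite_measure \<rho>
  proof (rule finite_measureI)
    have "emeasure \<rho> (space \<rho>) = ennreal C * emeasure \<rho>0 UNIV"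
      unfolding \<rho>_def space_density sp0 by (rule emeasure_density_const) (simp add: \<rho>0(1))
    also have "\<dots> \<le> ennreal C * 1" by (intro mult_left_mono \<rho>0(2)) simp
    finally show "emeasure \<rho> (space \<rho>) \<noteq> \<infinity>" by (auto simp: top_unique)
  qed
  \<comment> \<open>Testing with ever wider cutoffs shows that no mass is lost at infinity.\<close>
  have spR: "space \<rho> = UNIV" using sets_eq_imp_space_eq[OF \<rho>s] by simp
  have "(\<lambda>j. LINT z|\<rho>. cutoff (real (Suc j)) z) \<longlonglongrightarrow> (LINT z|\<rho>. complex_of_real (exp (-4)))"
  proof (rule integral_dominated_convergence[where w="\<lambda>_. 1"])
    show "cutoff (real (Suc j)) \<in> borel_measurable \<rho>" for j
      using test_function_measurable[OF test_function_cutoff[of "real (Suc j)"]] measurable_cong_sets[OF \<rho>s refl] by auto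
    show "AE z in \<rho>. (\<lambda>j. cutoff (real (Suc j)) z) \<longlonglongrightarrow> complex_of_real (exp (-4))"
    proof (rule AE_I2)
      fix z
      have "isCont (cutoff 1) 0"
        using test_function_continuous[OF test_function_cutoff[of 1], of UNIV] by (simp add: continuous_on_eq_continuous_at)
      moreover have "(\<lambda>j. complex_of_real (1 / real (Suc j)) * z) \<longlonglongrightarrow> of_real 0 * z"
        by (intro tendsto_mult tendsto_of_real tendsto_const) (use LIMSEQ_inverse_real_of_nat in \<open>simp add: inverse_eq_divide\<close>)
      ultimately have "(\<lambda>j. cutoff 1 (complex_of_real (1 / real (Suc j)) * z)) \<longlonglongrightarrow> cutoff 1 0"
        by (intro isCont_tendsto_compose[of 0 "cutoff 1"]) simp_all
      moreover have "cutoff 1 (complex_of_real (1 / real (Suc j)) * z) = cutoff (real (Suc j)) z" for j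
        by (rule cutoff_scale[symmetric]) simp
      ultimately show "(\<lambda>j. cutoff (real (Suc j)) z) \<longlonglongrightarrow> complex_of_real (exp (-4))"
        using cutoff_0[of 1] by (simp del: of_nat_Suc)
    qed
    show "AE z in \<rho>. norm (cutoff (real (Suc j)) z) \<le> 1" for j
      by (intro AE_I2 norm_cutoff_le)
  qed auto
  moreover have "(LINT z|\<rho>. cutoff (real (Suc j)) z) = \<Lambda> (cutoff (real (Suc j)))" for j
    by (rule \<rho>int[OF test_function_cutoff]) simp
  ultimately have "(\<lambda>j. \<Lambda> (cutoff (real (Suc j)))) \<longlonglongrightarrow> (LINT z|\<rho>. complex_of_real (exp (-4)))" by simp
  from LIMSEQ_unique[OF this LIMSEQ_Suc[OF \<Lambda>_cutoff_tendsto]]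
  have "complex_of_real (measure \<rho> UNIV * exp (-4)) = complex_of_real (exp (-4))"
    by (simp add: spR scaleR_conv_of_real)
  then have "measure \<rho> UNIV = 1" by (simp only: of_real_eq_iff) simp
  then have "prob_space \<rho>"
    by (intro prob_spaceI) (simp add: spR R.emeasure_eq_measure)
  then show ?thesis using that \<rho>s \<rho>int by (simp add: borel_prob_def)
qed

end

section \<open>The maximum of several potentials\<close>

locale potentials =
  fixes m :: nat and \<mu> :: "nat \<Rightarrow> complex measure" and S :: real
  assumes m: "m \<ge> 1" and bp: "\<And>k. k \<in> {1..m} \<Longrightarrow> bounded_prob (\<mu> k) S"
begin

definition U :: "complex \<Rightarrow> real" where
  "U z = Max ((\<lambda>k. pot (\<mu> k) z) ` {1..m})"

lemma pot_measurable [measurable]: "k \<in> {1..m} \<Longrightarrow> pot (\<mu> k) \<in> borel_measurable borel"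
  by (rule bounded_prob.pot_measurable[OF bp])

lemma U_measurable [measurable]: "U \<in> borel_measurable borel"
proof -
  have "(\<lambda>z. Max ((\<lambda>k. pot (\<mu> k) z) ` {1..m})) \<in> borel_measurable borel"
    by (rule borel_measurable_Max) auto
  then show ?thesis by (simp add: U_def[abs_def])
qed

lemma pot_le_U: "k \<in> {1..m} \<Longrightarrow> pot (\<mu> k) z \<le> U z"
  unfolding U_def by (intro Max_ge) auto

lemma U_attained: obtains k where "k \<in> {1..m}" "U z = pot (\<mu> k) z"
proof -
  have "U z \<in> (\<lambda>k. pot (\<mu> k) z) ` {1..m}" unfolding U_def using m by (intro Max_in) auto
  then show ?thesis using that by blast
qed

lemma U_square_le: "(U z)\<^sup>2 \<le> (\<Sum>k\<in>{1..m}. (pot (\<mu> k) z)\<^sup>2)"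
proof -
  obtain k where "k \<in> {1..m}" "U z = pot (\<mu> k) z" by (rule U_attained)
  then show ?thesis using member_le_sum[of k "{1..m}" "\<lambda>k. (pot (\<mu> k) z)\<^sup>2"] by simp
qed

lemma loc_square_integrable_U: "loc_square_integrable U"
  unfolding loc_square_integrable_def
proof (intro conjI allI U_measurable)
  fix R :: real
  have "(\<integral>\<^sup>+z. indicator (cball 0 R) z * ennreal ((U z)\<^sup>2) \<partial>lborel)
    \<le> (\<integral>\<^sup>+z. (\<Sum>k\<in>{1..m}. indicator (cball 0 R) z * ennreal ((pot (\<mu> k) z)\<^sup>2)) \<partial>lborel)"
  proof (rule nn_integral_mono)
    fix z
    have "ennreal ((U z)\<^sup>2) \<le> (\<Sum>k\<in>{1..m}. ennreal ((pot (\<mu> k) z)\<^sup>2))"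
      using U_square_le[of z] by (subst sum_ennreal) (auto intro: ennreal_leI)
    then show "indicator (cball 0 R) z * ennreal ((U z)\<^sup>2) \<le> (\<Sum>k\<in>{1..m}. indicator (cball 0 R) z * ennreal ((pot (\<mu> k) z)\<^sup>2))"
      unfolding sum_distrib_left[symmetric] by (rule mult_left_mono) simp
  qed
  also have "\<dots> = (\<Sum>k\<in>{1..m}. \<integral>\<^sup>+z. indicator (cball 0 R) z * ennreal ((pot (\<mu> k) z)\<^sup>2) \<partial>lborel)"
    by (rule nn_integral_sum) measurable
  also have "\<dots> < \<infinity>"
    using bounded_prob.loc_square_integrable_pot[OF bp] by (simp add: loc_square_integrable_def)
  finally show "(\<integral>\<^sup>+z. indicator (cball 0 R) z * ennreal ((U z)\<^sup>2) \<partial>lborel) < \<infinity>" .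
qed

lemma abs_U_le: "\<bar>U z\<bar> \<le> (\<Sum>k\<in>{1..m}. \<bar>pot (\<mu> k) z\<bar>)"
proof -
  obtain k where "k \<in> {1..m}" "U z = pot (\<mu> k) z" by (rule U_attained)
  then show ?thesis using member_le_sum[of k "{1..m}" "\<lambda>k. \<bar>pot (\<mu> k) z\<bar>"] by simp
qed

text \<open>At the centre \<open>U\<close> equals the potential of an attaining index; that
  potential is submean, and on the circle it is at most \<open>U\<close>. The asymptotics pass to
  the maximum with the largest of finitely many radii.\<close>

sublocale log_subharmonic U
proof
  show "loc_integrable U" by (rule loc_square_integrable_imp_loc_integrable[OF loc_square_integrable_U])
next
  fix r :: real assume r: "r > 0"
  have "AE z in lborel. \<forall>k\<in>{1..m}. integrable (circle_measure r) (\<lambda>\<zeta>. pot (\<mu> k) (z + \<zeta>)) \<and>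
      pot (\<mu> k) z \<le> (\<integral>\<zeta>. pot (\<mu> k) (z + \<zeta>) \<partial>circle_measure r)"
    using bounded_prob.AE_pot_le_circle_average[OF bp r] by (intro AE_finite_allI) auto
  then show "AE z in lborel. U z \<le> (\<integral>\<zeta>. U (z + \<zeta>) \<partial>circle_measure r)"
  proof eventually_elim
    case (elim z)
    obtain k where k: "k \<in> {1..m}" "U z = pot (\<mu> k) z" by (rule U_attained)
    have "integrable (circle_measure r) (\<lambda>\<zeta>. U (z + \<zeta>))"
    proof (rule Bochner_Integration.integrable_bound)
      show "integrable (circle_measure r) (\<lambda>\<zeta>. \<Sum>k\<in>{1..m}. \<bar>pot (\<mu> k) (z + \<zeta>)\<bar>)"
        using elim by (intro Bochner_Integration.integrable_sum integrable_abs) auto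
      show "AE \<zeta> in circle_measure r. norm (U (z + \<zeta>)) \<le> norm (\<Sum>k\<in>{1..m}. \<bar>pot (\<mu> k) (z + \<zeta>)\<bar>)"
        using abs_U_le by (intro AE_I2) (simp add: order_trans[OF abs_U_le abs_ge_self])
    qed measurable
    then have "(\<integral>\<zeta>. pot (\<mu> k) (z + \<zeta>) \<partial>circle_measure r) \<le> (\<integral>\<zeta>. U (z + \<zeta>) \<partial>circle_measure r)"
      using elim k pot_le_U by (intro integral_mono) auto
    then show ?case using elim k by force
  qed
next
  fix \<epsilon> :: real assume e: "\<epsilon> > 0"
  have "\<exists>R>0. \<forall>z. norm z \<ge> R \<longrightarrow> \<bar>pot (\<mu> k) z - ln (norm z)\<bar> \<le> \<epsilon>" if "k \<in> {1..m}" for k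
    using bounded_prob.pot_asymptotic[OF bp[OF that] e] by metis
  then obtain R where R: "\<And>k. k \<in> {1..m} \<Longrightarrow> R k > 0"
    "\<And>k z. k \<in> {1..m} \<Longrightarrow> norm z \<ge> R k \<Longrightarrow> \<bar>pot (\<mu> k) z - ln (norm z)\<bar> \<le> \<epsilon>" by metis
  define R' where "R' = Max (R ` {1..m})"
  have R': "R k \<le> R'" if "k \<in> {1..m}" for k unfolding R'_def using that by (intro Max_ge) auto
  show "\<exists>R>0. \<forall>z. norm z \<ge> R \<longrightarrow> \<bar>U z - ln (norm z)\<bar> \<le> \<epsilon>"
  proof (intro exI[of _ R'] conjI allI impI)
    show "R' > 0" using R(1)[of 1] R'[of 1] m by auto
    fix z :: complex assume z: "norm z \<ge> R'"
    obtain k where "k \<in> {1..m}" "U z = pot (\<mu> k) z" by (rule U_attained)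
    then show "\<bar>U z - ln (norm z)\<bar> \<le> \<epsilon>" using R(2)[of k z] R'[of k] z by simp
  qed
qed

lemma AE_log_potential_eq: "AE z in lborel. \<forall>k\<in>{1..m}. log_potential (\<mu> k) z = ereal (pot (\<mu> k) z)"
  using bounded_prob.AE_log_potential[OF bp] by (intro AE_finite_allI) auto

lemma AE_max_potential: "AE z in lborel. max_potential m \<mu> z = ereal (U z)"
  using AE_log_potential_eq
proof eventually_elim
  case (elim z)
  have "max_potential m \<mu> z = Max ((\<lambda>k. ereal (pot (\<mu> k) z)) ` {1..m})"
    unfolding max_potential_def using elim by (intro arg_cong[where f=Max] image_cong) auto
  also have "\<dots> = Max (ereal ` (\<lambda>k. pot (\<mu> k) z) ` {1..m})" by (simp add: image_image)
  also have "\<dots> = ereal (U z)"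
    unfolding U_def using m by (intro mono_Max_commute[symmetric]) (auto simp: mono_def)
  finally show ?case .
qed

lemma log_potential_measurable:
  assumes k: "k \<in> {1..m}"
  shows "log_potential (\<mu> k) \<in> borel_measurable borel"
proof -
  interpret bounded_prob "\<mu> k" S by (rule bp[OF k])
  have [measurable]: "eln \<in> borel_measurable borel" unfolding eln_def[abs_def] by measurable
  show ?thesis unfolding log_potential_def[abs_def] by measurable
qed

lemma max_potential_measurable: "(\<lambda>z. real_of_ereal (max_potential m \<mu> z)) \<in> borel_measurable borel"
proof -
  have "(\<lambda>z. Max ((\<lambda>k. log_potential (\<mu> k) z) ` {1..m})) \<in> borel_measurable borel"
    by (rule borel_measurable_Max) (use log_potential_measurable in auto)
  then show ?thesis unfolding max_potential_def[abs_def] by measurable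
qed

text \<open>\<open>max_potential\<close> and the real-valued \<open>U\<close> differ only on a
  Lebesgue null set, which contains the points of value minus infinity.\<close>

lemma is_normalized_laplacian_iff:
  "is_normalized_laplacian \<rho> (max_potential m \<mu>) \<longleftrightarrow> (\<forall>\<psi>. test_function \<psi> \<longrightarrow> (LINT z|\<rho>. \<psi> z) = \<Lambda> \<psi>)"
proof -
  have "(LINT z|lborel. laplacian \<psi> z * complex_of_real (real_of_ereal (max_potential m \<mu> z))) = (\<integral>z. laplacian \<psi> z * complex_of_real (U z) \<partial>lborel)"
    if "test_function \<psi>" for \<psi>
  proof (rule integral_cong_AE)
    have [measurable]: "laplacian \<psi> \<in> borel_measurable borel" by (rule laplacian_test_function(1)[OF that])
    note max_potential_measurable[measurable]
    show "(\<lambda>z. laplacian \<psi> z * complex_of_real (real_of_ereal (max_potential m \<mu> z))) \<in> borel_measurable lborel" by measurable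
    show "(\<lambda>z. laplacian \<psi> z * complex_of_real (U z)) \<in> borel_measurable lborel" by measurable
    show "AE z in lborel. laplacian \<psi> z * complex_of_real (real_of_ereal (max_potential m \<mu> z)) = laplacian \<psi> z * complex_of_real (U z)"
      using AE_max_potential by eventually_elim simp
  qed
  then show ?thesis unfolding is_normalized_laplacian_def \<Lambda>_def by simp
qed

end

section \<open>Weak law and concentration of sums\<close>

context prob_space
begin

lemma sum_indep_square:
  fixes Z :: "nat \<Rightarrow> 'a \<Rightarrow> real"
  assumes ind: "indep_vars (\<lambda>_. borel) Z UNIV"
    and sq: "\<And>i. integrable M (\<lambda>\<omega>. (Z i \<omega>)\<^sup>2)" and mean: "\<And>i. expectation (Z i) = 0" and var: "\<And>i. expectation (\<lambda>\<omega>. (Z i \<omega>)\<^sup>2) = v"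
  shows "integrable M (\<lambda>\<omega>. (\<Sum>i<n. Z i \<omega>)\<^sup>2) \<and> expectation (\<lambda>\<omega>. (\<Sum>i<n. Z i \<omega>)\<^sup>2) = real n * v \<and> expectation (\<lambda>\<omega>. \<Sum>i<n. Z i \<omega>) = 0"
proof (induction n)
  case (Suc n)
  have rv[measurable]: "random_variable borel (Z i)" for i using ind by (auto simp: indep_vars_def)
  have int: "integrable M (Z i)" for i by (rule square_integrable_imp_integrable[OF rv sq])
  let ?S = "\<lambda>\<omega>. \<Sum>i<n. Z i \<omega>"
  have Sint: "integrable M ?S" using int by auto
  have "indep_var borel (Z n) borel ?S"
    by (rule indep_vars_sum) (auto intro: indep_vars_subset[OF ind])
  from indep_var_lebesgue_integral[OF this int Sint] indep_var_integrable[OF this int Sint]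
  have c: "expectation (\<lambda>\<omega>. Z n \<omega> * ?S \<omega>) = 0" "integrable M (\<lambda>\<omega>. Z n \<omega> * ?S \<omega>)" using mean by simp_all
  have eq: "(\<Sum>i<Suc n. Z i \<omega>)\<^sup>2 = (?S \<omega>)\<^sup>2 + 2 * (Z n \<omega> * ?S \<omega>) + (Z n \<omega>)\<^sup>2" for \<omega>
    by (simp add: power2_sum algebra_simps)
  show ?case
    unfolding eq using Suc.IH c sq[of n] var[of n] int[of n] Sint mean[of n]
    by (simp add: algebra_simps)
qed simp

lemma weak_law:
  fixes Y :: "nat \<Rightarrow> 'a \<Rightarrow> real"
  assumes ind: "indep_vars (\<lambda>_. borel) Y UNIV"
    and sq: "\<And>i. integrable M (\<lambda>\<omega>. (Y i \<omega>)\<^sup>2)" and mean: "\<And>i. expectation (Y i) = u" and var: "\<And>i. variance (Y i) = v"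
    and e: "e > 0"
  shows "(\<lambda>n. prob {\<omega> \<in> space M. \<bar>(\<Sum>i<n. Y i \<omega>) - real n * u\<bar> \<ge> e * real n}) \<longlonglongrightarrow> 0"
proof -
  define Z where "Z = (\<lambda>i \<omega>. Y i \<omega> - u)"
  have rv[measurable]: "random_variable borel (Y i)" for i using ind by (auto simp: indep_vars_def)
  have int: "integrable M (Y i)" for i by (rule square_integrable_imp_integrable[OF rv sq])
  have ZI: "indep_vars (\<lambda>_. borel) Z UNIV" unfolding Z_def by (rule indep_vars_compose2[OF ind]) auto
  have Zsq: "integrable M (\<lambda>\<omega>. (Z i \<omega>)\<^sup>2)" for i
    unfolding Z_def power2_diff using sq int by auto
  have Zm: "expectation (Z i) = 0" for i unfolding Z_def using int mean by (simp add: prob_space)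
  have Zv: "expectation (\<lambda>\<omega>. (Z i \<omega>)\<^sup>2) = v" for i using var[of i] mean[of i] by (simp add: Z_def)
  note S = sum_indep_square[OF ZI Zsq Zm Zv]
  have bound: "prob {\<omega> \<in> space M. \<bar>(\<Sum>i<n. Y i \<omega>) - real n * u\<bar> \<ge> e * real n} \<le> v / e\<^sup>2 / real n" if n: "n > 0" for n
  proof -
    have "prob {\<omega> \<in> space M. \<bar>(\<Sum>i<n. Z i \<omega>) - expectation (\<lambda>\<omega>. \<Sum>i<n. Z i \<omega>)\<bar> \<ge> e * real n} \<le> variance (\<lambda>\<omega>. \<Sum>i<n. Z i \<omega>) / (e * real n)\<^sup>2"
    proof (rule Chebyshev_inequality)
      show "random_variable borel (\<lambda>\<omega>. \<Sum>i<n. Z i \<omega>)" unfolding Z_def by measurable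
    qed (use S[of n] e n in auto)
    also have "variance (\<lambda>\<omega>. \<Sum>i<n. Z i \<omega>) = real n * v" using S[of n] by simp
    also have "real n * v / (e * real n)\<^sup>2 = v / e\<^sup>2 / real n" using n e by (simp add: power2_eq_square)
    finally show ?thesis using S[of n] by (simp add: Z_def sum_subtractf)
  qed
  show ?thesis
  proof (rule tendsto_sandwich[OF _ _ tendsto_const])
    show "(\<lambda>n. v / e\<^sup>2 / real n) \<longlonglongrightarrow> 0" by (rule lim_const_over_n)
    show "\<forall>\<^sub>F n in sequentially. prob {\<omega> \<in> space M. \<bar>(\<Sum>i<n. Y i \<omega>) - real n * u\<bar> \<ge> e * real n} \<le> v / e\<^sup>2 / real n"
      using eventually_gt_at_top[of 0] by eventually_elim (rule bound)
  qed simp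
qed

end

section \<open>Anti-concentration of sums from the central limit theorem\<close>

lemma cdf_std_normal_diff:
  assumes "a \<le> b"
  shows "cdf std_normal_distribution b - cdf std_normal_distribution a \<le> b - a"
proof (cases "a = b")
  case False
  interpret N: real_distribution std_normal_distribution by (rule real_dist_normal_dist)
  have "emeasure std_normal_distribution {a<..b} = (\<integral>\<^sup>+x. ennreal (std_normal_density x) * indicator {a<..b} x \<partial>lborel)"
    by (rule emeasure_density) auto
  also have "\<dots> \<le> (\<integral>\<^sup>+x. indicator {a<..b} x \<partial>lborel)"
  proof (rule nn_integral_mono)
    fix x :: real
    have "1 \<le> 2 * pi" using pi_ge_two by simp
    then have "1 / sqrt (2 * pi) \<le> 1" by simp
    then have "std_normal_density x \<le> 1"
      unfolding std_normal_density_def by (intro mult_le_one) auto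
    then show "ennreal (std_normal_density x) * indicator {a<..b} x \<le> indicator {a<..b} x"
      by (auto simp: indicator_def)
  qed
  also have "\<dots> = ennreal (b - a)" using assms by simp
  finally have "ennreal (measure std_normal_distribution {a<..b}) \<le> ennreal (b - a)"
    by (simp add: N.emeasure_eq_measure)
  then have "measure std_normal_distribution {a<..b} \<le> b - a" using assms by simp
  then show ?thesis using N.cdf_diff_eq[of a b] assms False by simp
qed simp

lemma isCont_cdf_std_normal: "isCont (cdf std_normal_distribution) x"
proof -
  interpret N: real_distribution std_normal_distribution by (rule real_dist_normal_dist)
  have "emeasure std_normal_distribution {x} = 0"
    by (subst emeasure_density) (auto simp: nn_integral_indicator_singleton)
  then show ?thesis by (subst N.isCont_cdf) (simp add: measure_def)
qed

text \<open>
  Here \<open>G\<close> is the distribution function of a normalized sum and \<open>F\<close> that of its limit. Closeness at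
  finitely many grid points controls \<open>G\<close> on every interval of length \<open>3h\<close>.
\<close>

lemma concentration_cdf:
  fixes F G :: "real \<Rightarrow> real" and h e :: real and K :: int
  assumes G: "\<And>x y. x \<le> y \<Longrightarrow> G x \<le> G y" "\<And>x. 0 \<le> G x" "\<And>x. G x \<le> 1"
    and F: "\<And>x y. x \<le> y \<Longrightarrow> F y - F x \<le> y - x" "F (- (real_of_int K * h)) < e/4" "1 - e/4 < F (real_of_int K * h)"
    and FG: "\<And>k. \<bar>k\<bar> \<le> K \<Longrightarrow> \<bar>G (real_of_int k * h) - F (real_of_int k * h)\<bar> < e/8"
    and h: "h = e/8" "e > 0" and K: "K \<ge> 2"
  shows "G (real_of_int (k+2) * h) - G (real_of_int (k-1) * h) \<le> e"
proof -
  have h0: "h > 0" using h by simp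
  \<comment> \<open>Left tail, right tail and bulk. In a tail, \<open>F\<close> two grid points
    inside the range is within \<open>e/4 + 2 * h\<close> of 0 or 1, and \<open>G\<close> is within
    \<open>e/8\<close> of it; in the bulk \<open>F\<close> grows by at most \<open>3 * h\<close> and
    two errors \<open>e/8\<close> occur. With \<open>h = e/8\<close> each case stays below
    \<open>e\<close>.\<close>
  consider "k - 1 < -K" | "k + 2 > K" | "-K \<le> k - 1" "k + 2 \<le> K" by linarith
  then show ?thesis
  proof cases
    case 1
    have "G (real_of_int (k+2) * h) \<le> G (real_of_int (2-K) * h)" using 1 h0 by (intro G(1) mult_right_mono) auto
    moreover have "\<bar>G (real_of_int (2-K) * h) - F (real_of_int (2-K) * h)\<bar> < e/8" using K by (intro FG) auto
    moreover have "F (real_of_int (2-K) * h) - F (- (real_of_int K * h)) \<le> real_of_int (2-K) * h - (- (real_of_int K * h))"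
      using h0 by (intro F(1)) (simp add: algebra_simps)
    moreover have "real_of_int (2-K) * h - (- (real_of_int K * h)) = 2 * h" by (simp add: algebra_simps)
    moreover have "0 \<le> G (real_of_int (k-1) * h)" by (rule G)
    ultimately show ?thesis using F(2) h by linarith
  next
    case 2
    have "G (real_of_int (K-2) * h) \<le> G (real_of_int (k-1) * h)" using 2 h0 by (intro G(1) mult_right_mono) auto
    moreover have "\<bar>G (real_of_int (K-2) * h) - F (real_of_int (K-2) * h)\<bar> < e/8" using K by (intro FG) auto
    moreover have "F (real_of_int K * h) - F (real_of_int (K-2) * h) \<le> real_of_int K * h - real_of_int (K-2) * h"
      using h0 by (intro F(1)) (simp add: algebra_simps)
    moreover have "real_of_int K * h - real_of_int (K-2) * h = 2 * h" by (simp add: algebra_simps)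
    moreover have "G (real_of_int (k+2) * h) \<le> 1" by (rule G)
    ultimately show ?thesis using F(3) h by linarith
  next
    case 3
    have "\<bar>G (real_of_int (k+2) * h) - F (real_of_int (k+2) * h)\<bar> < e/8" "\<bar>G (real_of_int (k-1) * h) - F (real_of_int (k-1) * h)\<bar> < e/8"
      using 3 K by (intro FG; linarith)+
    moreover have "F (real_of_int (k+2) * h) - F (real_of_int (k-1) * h) \<le> real_of_int (k+2) * h - real_of_int (k-1) * h"
      using h0 by (intro F(1)) (simp add: algebra_simps)
    moreover have "real_of_int (k+2) * h - real_of_int (k-1) * h = 3 * h" by (simp add: algebra_simps)
    ultimately show ?thesis using h by linarith
  qed
qed

context prob_space
begin

text \<open>Normalisation shrinks a window of length 2 to length
  \<open>2 / sqrt (real n * \<sigma>\<^sup>2)\<close>, and the limit law has no atoms. Uniformity in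
  \<open>a\<close> is the point: it comes from finitely many values of the distribution function and
  allows \<open>a\<close> to be replaced by an independent random variable.\<close>

lemma sum_concentration:
  fixes X :: "nat \<Rightarrow> 'a \<Rightarrow> real"
  assumes X_indep: "indep_vars (\<lambda>i. borel) X UNIV"
    and X_mean: "\<And>n. expectation (X n) = m"
    and \<sigma>_pos: "\<sigma> > 0"
    and X_square_integrable: "\<And>n. integrable M (\<lambda>x. (X n x)\<^sup>2)"
    and X_variance: "\<And>n. variance (X n) = \<sigma>\<^sup>2"
    and X_distrib: "\<And>n. distr M borel (X n) = \<mu>"
    and e: "e > 0"
  shows "\<forall>\<^sub>F n in sequentially. \<forall>a. prob {\<omega> \<in> space M. \<bar>(\<Sum>i<n. X i \<omega>) - a\<bar> \<le> 1} \<le> e"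
proof -
  have rv[measurable]: "random_variable borel (X i)" for i using X_indep by (auto simp: indep_vars_def)
  define Z where "Z = (\<lambda>n x. (\<Sum>i<n. X i x - m) / sqrt (real n * \<sigma>\<^sup>2))"
  have [measurable]: "random_variable borel (Z n)" for n unfolding Z_def by measurable
  let ?N = std_normal_distribution
  interpret N: real_distribution ?N by (rule real_dist_normal_dist)
  have rd: "real_distribution (distr M borel (Z n))" for n by (rule real_distribution_distr) measurable
  have "weak_conv_m (\<lambda>n. distr M borel (Z n)) ?N"
    unfolding Z_def by (rule central_limit_theorem[OF X_indep X_mean \<sigma>_pos X_square_integrable X_variance X_distrib])
  then have lim: "(\<lambda>n. cdf (distr M borel (Z n)) x) \<longlonglongrightarrow> cdf ?N x" for x
    using isCont_cdf_std_normal unfolding weak_conv_m_def weak_conv_def by blast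
  define h where "h = e / 8"
  have h: "h > 0" using e by (simp add: h_def)
  have "\<forall>\<^sub>F x in at_bot. cdf ?N x < e/4"
    using N.cdf_lim_at_bot by (rule order_tendstoD(2)) (use e in simp)
  then obtain A where A: "\<And>x. x \<le> A \<Longrightarrow> cdf ?N x < e/4" unfolding eventually_at_bot_linorder by blast
  have "\<forall>\<^sub>F x in at_top. 1 - e/4 < cdf ?N x"
    using N.cdf_lim_at_top_prob by (rule order_tendstoD(1)) (use e in simp)
  then obtain B where B: "\<And>x. x \<ge> B \<Longrightarrow> 1 - e/4 < cdf ?N x" unfolding eventually_at_top_linorder by blast
  \<comment> \<open>Grid range: beyond \<open>K * h\<close> on either side the normal law has less
    than \<open>e/4\<close> of its mass.\<close>
  define K where "K = max 2 (max \<lceil>- A / h\<rceil> \<lceil>B / h\<rceil>)"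
  have KA: "- (real_of_int K * h) \<le> A"
  proof -
    have "- A / h \<le> real_of_int K" unfolding K_def by linarith
    then show ?thesis using h by (simp add: field_simps)
  qed
  have KB: "real_of_int K * h \<ge> B"
  proof -
    have "B / h \<le> real_of_int K" unfolding K_def by linarith
    then show ?thesis using h by (simp add: field_simps)
  qed
  have ev1: "\<forall>\<^sub>F n in sequentially. \<forall>k\<in>{-K..K}. \<bar>cdf (distr M borel (Z n)) (real_of_int k * h) - cdf ?N (real_of_int k * h)\<bar> < e/8"
  proof (rule eventually_ball_finite)
    show "\<forall>k\<in>{-K..K}. \<forall>\<^sub>F n in sequentially. \<bar>cdf (distr M borel (Z n)) (real_of_int k * h) - cdf ?N (real_of_int k * h)\<bar> < e/8"
    proof
      fix k
      have "\<forall>\<^sub>F n in sequentially. dist (cdf (distr M borel (Z n)) (real_of_int k * h)) (cdf ?N (real_of_int k * h)) < e/8"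
        by (rule tendstoD[OF lim]) (use e in simp)
      then show "\<forall>\<^sub>F n in sequentially. \<bar>cdf (distr M borel (Z n)) (real_of_int k * h) - cdf ?N (real_of_int k * h)\<bar> < e/8"
        by (simp add: dist_real_def)
    qed
  qed simp
  have "(\<lambda>n. 2 / sqrt (real n * \<sigma>\<^sup>2)) \<longlonglongrightarrow> 0" using \<sigma>_pos by real_asymp
  then have ev2: "\<forall>\<^sub>F n in sequentially. 2 / sqrt (real n * \<sigma>\<^sup>2) < h" by (rule order_tendstoD(2)) (rule h)
  show ?thesis
    using ev1 ev2 eventually_gt_at_top[of 0]
  proof eventually_elim
    case (elim n)
    define s where "s = sqrt (real n * \<sigma>\<^sup>2)"
    have s: "s > 0" using elim(3) \<sigma>_pos by (simp add: s_def)
    interpret D: real_distribution "distr M borel (Z n)" by (rule rd)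
    show ?case
    proof
      fix a
      define b where "b = (a - 1 - real n * m) / s"
      \<comment> \<open>The window from \<open>b\<close> to \<open>b + 2 / s\<close> starts in cell
        \<open>k\<close> and is shorter than \<open>h\<close>. One more cell on the left
        accommodates the half-open interval of \<open>cdf_diff_eq\<close> when \<open>b\<close> is a
        grid point.\<close>
      define k where "k = \<lfloor>b / h\<rfloor>"
      have k1: "real_of_int k * h \<le> b" "b < real_of_int (k+1) * h"
      proof -
        have "real_of_int k \<le> b / h" "b / h < real_of_int (k+1)" unfolding k_def by linarith+
        then show "real_of_int k * h \<le> b" "b < real_of_int (k+1) * h" using h by (simp_all add: field_simps)
      qed
      have sub: "{\<omega> \<in> space M. \<bar>(\<Sum>i<n. X i \<omega>) - a\<bar> \<le> 1} \<subseteq> {\<omega> \<in> space M. Z n \<omega> \<in> {real_of_int (k-1) * h<..real_of_int (k+2) * h}}"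
      proof safe
        fix \<omega> assume w: "\<bar>(\<Sum>i<n. X i \<omega>) - a\<bar> \<le> 1"
        have Zeq: "Z n \<omega> = ((\<Sum>i<n. X i \<omega>) - real n * m) / s" by (simp add: Z_def s_def sum_subtractf)
        have "b \<le> Z n \<omega>" unfolding Zeq b_def using w s by (intro divide_right_mono) auto
        moreover have "Z n \<omega> \<le> b + 2 / s" unfolding Zeq b_def add_divide_distrib[symmetric] using w s by (intro divide_right_mono) auto
        moreover have "real_of_int (k-1) * h = real_of_int k * h - h" by (simp add: algebra_simps)
        moreover have "real_of_int (k+2) * h = real_of_int (k+1) * h + h" by (simp add: algebra_simps)
        ultimately show "Z n \<omega> \<in> {real_of_int (k-1) * h<..real_of_int (k+2) * h}"
          using k1 elim(2) h unfolding s_def greaterThanAtMost_iff by linarith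
      qed
      have "prob {\<omega> \<in> space M. \<bar>(\<Sum>i<n. X i \<omega>) - a\<bar> \<le> 1} \<le> prob {\<omega> \<in> space M. Z n \<omega> \<in> {real_of_int (k-1) * h<..real_of_int (k+2) * h}}"
        by (rule finite_measure_mono[OF sub]) measurable
      also have "\<dots> = measure (distr M borel (Z n)) {real_of_int (k-1) * h<..real_of_int (k+2) * h}"
        by (subst measure_distr) (auto simp: vimage_def Int_def conj_commute)
      also have "\<dots> = cdf (distr M borel (Z n)) (real_of_int (k+2) * h) - cdf (distr M borel (Z n)) (real_of_int (k-1) * h)"
        by (rule D.cdf_diff_eq[symmetric]) (use h in simp)
      also have "\<dots> \<le> e"
      proof (rule concentration_cdf[where F="cdf ?N" and K=K])
        show "0 \<le> cdf (distr M borel (Z n)) x" for x by (simp add: cdf_def)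
        show "cdf ?N y - cdf ?N x \<le> y - x" if "x \<le> y" for x y by (rule cdf_std_normal_diff[OF that])
        show "\<bar>cdf (distr M borel (Z n)) (real_of_int k * h) - cdf ?N (real_of_int k * h)\<bar> < e / 8" if "\<bar>k\<bar> \<le> K" for k
          by (rule elim(1)[rule_format]) (use that in auto)
      qed (use e A[OF KA] B[OF KB] D.cdf_nondecreasing D.cdf_bounded_prob in \<open>auto simp: h_def K_def\<close>)
      finally show "prob {\<omega> \<in> space M. \<bar>(\<Sum>i<n. X i \<omega>) - a\<bar> \<le> 1} \<le> e" .
    qed
  qed
qed

text \<open>Conditioning on \<open>Y\<close>: the joint law is a product, and every section of the
  strip at fixed \<open>y\<close> is a window about \<open>y\<close>.\<close>

lemma indep_var_concentration:
  fixes X Y :: "'a \<Rightarrow> real"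
  assumes ind: "indep_var borel X borel Y" and e: "e \<ge> 0" and c: "\<And>a. prob {\<omega> \<in> space M. \<bar>X \<omega> - a\<bar> \<le> 1} \<le> e"
  shows "prob {\<omega> \<in> space M. \<bar>X \<omega> - Y \<omega>\<bar> \<le> 1} \<le> e"
proof -
  have rv[measurable]: "random_variable borel X" "random_variable borel Y"
    and eq: "distr M borel X \<Otimes>\<^sub>M distr M borel Y = distr M (borel \<Otimes>\<^sub>M borel) (\<lambda>x. (X x, Y x))"
    using ind by (auto simp: indep_var_distribution_eq)
  interpret X: prob_space "distr M borel X" by (rule prob_space_distr) measurable
  interpret Y: prob_space "distr M borel Y" by (rule prob_space_distr) measurable
  interpret P: pair_sigma_finite "distr M borel X" "distr M borel Y" by standard
  define A where "A = {p :: real \<times> real. \<bar>fst p - snd p\<bar> \<le> 1}"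
  have A[measurable]: "A \<in> sets (borel \<Otimes>\<^sub>M borel)"
  proof -
    have "closed A" unfolding A_def by (intro closed_Collect_le continuous_intros)
    then have "A \<in> sets borel" by simp
    then show ?thesis unfolding borel_prod .
  qed
  have "emeasure M {\<omega> \<in> space M. \<bar>X \<omega> - Y \<omega>\<bar> \<le> 1} = emeasure (distr M (borel \<Otimes>\<^sub>M borel) (\<lambda>x. (X x, Y x))) A"
    by (subst emeasure_distr[OF _ A]) (auto simp: A_def vimage_def Int_def conj_commute)
  also have "\<dots> = (\<integral>\<^sup>+y. emeasure (distr M borel X) ((\<lambda>x. (x, y)) -` A) \<partial>distr M borel Y)"
    unfolding eq[symmetric] by (rule P.emeasure_pair_measure_alt2) (simp cong: sets_pair_measure_cong)
  also have "\<dots> \<le> (\<integral>\<^sup>+y. ennreal e \<partial>distr M borel Y)"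
  proof (rule nn_integral_mono)
    fix y
    have "(\<lambda>x. (x, y)) -` A = {x. \<bar>x - y\<bar> \<le> 1}" by (auto simp: A_def)
    moreover have "emeasure (distr M borel X) {x. \<bar>x - y\<bar> \<le> 1} = emeasure M {\<omega> \<in> space M. \<bar>X \<omega> - y\<bar> \<le> 1}"
      by (subst emeasure_distr) (auto simp: vimage_def Int_def conj_commute)
    ultimately show "emeasure (distr M borel X) ((\<lambda>x. (x, y)) -` A) \<le> ennreal e"
      using c[of y] by (simp add: emeasure_eq_measure ennreal_leI)
  qed
  also have "\<dots> = ennreal e" using Y.emeasure_space_1 by simp
  finally show ?thesis using e by (simp add: emeasure_eq_measure)
qed

end

section \<open>Pointwise convergence for random roots\<close>

text \<open>The upper bound is the triangle inequality; cancellation affects only the lower bound,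
  which enters as \<open>low\<close> and is supplied by the next two lemmas. The factors
  \<open>m\<close> and 1/2 cost only terms of order \<open>1 / n\<close>.\<close>

lemma log_sum_bound:
  fixes p :: "nat \<Rightarrow> complex"
  assumes n: "n > 0" and j: "j \<in> {1..m}"
    and p: "\<And>k. k \<in> {1..m} \<Longrightarrow> norm (p k) = exp (s k)"
    and s: "\<And>k. k \<in> {1..m} \<Longrightarrow> \<bar>s k - n * u k\<bar> \<le> \<eta> * n"
    and u: "\<And>k. k \<in> {1..m} \<Longrightarrow> u k \<le> U" and eta: "\<eta> > 0"
    and low: "exp (n * (U - 2 * \<eta>)) / 2 \<le> norm (\<Sum>k\<in>{1..m}. p k)"
  shows "\<bar>ln (norm (\<Sum>k\<in>{1..m}. p k)) / n - U\<bar> \<le> 2 * \<eta> + (ln (real m) + ln 2) / n"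
proof -
  let ?P = "norm (\<Sum>k\<in>{1..m}. p k)"
  have m: "real m \<ge> 1" using j by auto
  have pos: "?P > 0" using low exp_gt_zero[of "n * (U - 2 * \<eta>)"] by linarith
  have "?P \<le> (\<Sum>k\<in>{1..m}. norm (p k))" by (rule norm_sum)
  also have "\<dots> \<le> (\<Sum>k\<in>{1..m}. exp (n * (U + \<eta>)))"
  proof (rule sum_mono)
    fix k assume k: "k \<in> {1..m}"
    have "s k \<le> n * u k + \<eta> * n" using s[OF k] by linarith
    also have "\<dots> \<le> n * U + \<eta> * n" using u[OF k] n by simp
    finally show "norm (p k) \<le> exp (n * (U + \<eta>))" using p[OF k] by (simp add: algebra_simps)
  qed
  also have "\<dots> = real m * exp (n * (U + \<eta>))" by simp
  finally have "ln ?P \<le> ln (real m * exp (n * (U + \<eta>)))" using pos by (intro ln_mono)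
  also have "\<dots> = ln (real m) + n * (U + \<eta>)" using m by (subst ln_mult) auto
  finally have up: "ln ?P / n \<le> ln (real m) / n + (U + \<eta>)" using n by (simp add: field_simps)
  have "n * (U - 2 * \<eta>) - ln 2 = ln (exp (n * (U - 2 * \<eta>)) / 2)" by (subst ln_div) auto
  also have "\<dots> \<le> ln ?P" using low by (intro ln_mono) auto
  finally have "(n * (U - 2 * \<eta>) - ln 2) / n \<le> ln ?P / n" using n by (intro divide_right_mono) auto
  moreover have "(n * (U - 2 * \<eta>) - ln 2) / n = U - 2 * \<eta> - ln 2 / n" using n by (simp add: diff_divide_distrib)
  ultimately have dn: "U - 2 * \<eta> - ln 2 / n \<le> ln ?P / n" by simp
  have "0 \<le> ln (real m) / n" "0 \<le> ln 2 / n" using m n by simp_all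
  then show ?thesis using up dn eta unfolding add_divide_distrib by (simp add: abs_le_iff)
qed

text \<open>Half of the gap \<open>g\<close> absorbs the fluctuations \<open>\<eta> * n\<close> of
  both terms compared, so each other term is below the leading one by the factor
  \<open>exp (- (n * g / 2))\<close>; by \<open>big\<close> all of them together weigh at most half
  of it.\<close>

lemma log_sum_lower_dominant:
  fixes p :: "nat \<Rightarrow> complex"
  assumes n: "n > 0" and j: "j \<in> {1..m}" "u j = U"
    and p: "\<And>k. k \<in> {1..m} \<Longrightarrow> norm (p k) = exp (s k)"
    and s: "\<And>k. k \<in> {1..m} \<Longrightarrow> \<bar>s k - n * u k\<bar> \<le> \<eta> * n"
    and gap: "\<And>k. k \<in> {1..m} - {j} \<Longrightarrow> u k \<le> U - g" and eta: "\<eta> > 0" "4 * \<eta> \<le> g"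
    and big: "real m * exp (- (n * g / 2)) \<le> 1/2"
  shows "exp (n * (U - 2 * \<eta>)) / 2 \<le> norm (\<Sum>k\<in>{1..m}. p k)"
proof -
  let ?V = "\<Sum>k\<in>{1..m} - {j}. p k"
  have split: "(\<Sum>k\<in>{1..m}. p k) = p j + ?V" using j by (subst sum.remove[of _ j]) auto
  have "norm ?V \<le> (\<Sum>k\<in>{1..m} - {j}. norm (p k))" by (rule norm_sum)
  also have "\<dots> \<le> (\<Sum>k\<in>{1..m} - {j}. exp (n * (U - \<eta>)) * exp (- (n * g / 2)))"
  proof (rule sum_mono)
    fix k assume k: "k \<in> {1..m} - {j}"
    then have k': "k \<in> {1..m}" by simp
    have "s k \<le> n * u k + \<eta> * n" using s[OF k'] by linarith
    also have "\<dots> \<le> n * (U - g) + \<eta> * n" using gap[OF k] n by simp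
    also have "\<dots> = n * (U - \<eta>) + n * (2 * \<eta> - g)" by (simp add: algebra_simps)
    also have "\<dots> \<le> n * (U - \<eta>) + n * (- (g / 2))" using eta n by (intro add_left_mono mult_left_mono) auto
    finally show "norm (p k) \<le> exp (n * (U - \<eta>)) * exp (- (n * g / 2))"
      using p[OF k'] by (simp add: mult_exp_exp)
  qed
  also have "\<dots> \<le> real m * (exp (n * (U - \<eta>)) * exp (- (n * g / 2)))"
    using j by (simp add: card_Diff_singleton)
  also have "\<dots> = exp (n * (U - \<eta>)) * (real m * exp (- (n * g / 2)))" by simp
  also have "\<dots> \<le> exp (n * (U - \<eta>)) * (1/2)" using big by (intro mult_left_mono) auto
  finally have V: "norm ?V \<le> exp (n * (U - \<eta>)) / 2" by simp
  have "n * (U - \<eta>) \<le> s j" using s[OF j(1)] j(2) by (simp add: algebra_simps abs_le_iff)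
  then have "exp (n * (U - \<eta>)) \<le> norm (p j)" using p[OF j(1)] by simp
  moreover have "norm (p j) \<le> norm (p j + ?V) + norm ?V" using norm_triangle_ineq4[of "p j + ?V" ?V] by simp
  moreover have "exp (n * (U - 2 * \<eta>)) \<le> exp (n * (U - \<eta>))" using n eta by simp
  ultimately show ?thesis unfolding split using V by linarith
qed

text \<open>If the sum were smaller than half of |p j|, the other terms would nearly cancel
  \<open>p j\<close>; their total would have modulus between half and twice that of
  \<open>p j\<close>, so the logarithms would differ by at most \<open>ln 2\<close>. As
  \<open>ln 2 \<le> 1\<close>, this falls in the window of \<open>sum_concentration\<close>.\<close>

lemma log_sum_lower_spread:
  fixes p :: "nat \<Rightarrow> complex"
  assumes n: "n > 0" and j: "j \<in> {1..m}" "u j = U"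
    and p: "norm (p j) = exp (s j)" and s: "\<bar>s j - n * u j\<bar> \<le> \<eta> * n" and eta: "\<eta> > 0"
    and V: "\<not> \<bar>s j - ln (norm (\<Sum>k\<in>{1..m} - {j}. p k))\<bar> \<le> 1"
  shows "exp (n * (U - 2 * \<eta>)) / 2 \<le> norm (\<Sum>k\<in>{1..m}. p k)"
proof (rule ccontr)
  assume neg: "\<not> ?thesis"
  let ?V = "\<Sum>k\<in>{1..m} - {j}. p k"
  have split: "(\<Sum>k\<in>{1..m}. p k) = p j + ?V" using j by (subst sum.remove[of _ j]) auto
  have "n * (U - 2 * \<eta>) \<le> n * (U - \<eta>)" using n eta by simp
  also have "\<dots> \<le> s j" using s j(2) by (simp add: algebra_simps abs_le_iff)
  finally have "exp (n * (U - 2 * \<eta>)) \<le> norm (p j)" using p by simp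
  then have small: "norm (p j + ?V) < norm (p j) / 2" using neg unfolding split by linarith
  have "norm (p j) \<le> norm (p j + ?V) + norm ?V" using norm_triangle_ineq4[of "p j + ?V" ?V] by simp
  then have lo: "norm (p j) / 2 \<le> norm ?V" using small by linarith
  have "norm ?V \<le> norm (p j + ?V) + norm (p j)" using norm_triangle_ineq4[of "p j + ?V" "p j"] by simp
  then have hi: "norm ?V \<le> 2 * norm (p j)" using small norm_ge_zero[of "p j"] by linarith
  have pj: "norm (p j) > 0" using p by simp
  have "s j - ln 2 = ln (norm (p j) / 2)" using p pj by (simp add: ln_div)
  also have "\<dots> \<le> ln (norm ?V)" using lo pj by (intro ln_mono) auto
  finally have 1: "s j - ln 2 \<le> ln (norm ?V)" .
  have "norm ?V > 0" using lo pj by linarith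
  then have "ln (norm ?V) \<le> ln (2 * norm (p j))" using hi by (intro ln_mono)
  also have "\<dots> = ln 2 + s j" using p pj by (simp add: ln_mult)
  finally have 2: "ln (norm ?V) \<le> ln 2 + s j" .
  have "ln 2 \<le> (1::real)" using ln_le_minus_one[of "2::real"] by simp
  then show False using 1 2 V by linarith
qed

locale random_roots = prob_space M + potentials m \<mu> S
  for M :: "'a measure" and m :: nat and \<mu> :: "nat \<Rightarrow> complex measure" and S :: real +
  fixes X :: "nat \<Rightarrow> nat \<Rightarrow> 'a \<Rightarrow> complex"
  assumes indep: "indep_vars (\<lambda>_. borel) (\<lambda>(i, k). X i k) ({1..} \<times> {1..m})"
    and distr_X: "\<And>i k. i \<ge> 1 \<Longrightarrow> k \<in> {1..m} \<Longrightarrow> distr M borel (X i k) = \<mu> k"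
begin

lemma X_measurable [measurable]: "i \<ge> 1 \<Longrightarrow> k \<in> {1..m} \<Longrightarrow> X i k \<in> borel_measurable M"
  using indep unfolding indep_vars_def by force

lemma integral_X:
  fixes f :: "complex \<Rightarrow> real"
  assumes "i \<ge> 1" "k \<in> {1..m}" and [measurable]: "f \<in> borel_measurable borel"
  shows "expectation (\<lambda>\<omega>. f (X i k \<omega>)) = (\<integral>w. f w \<partial>\<mu> k)" "integrable M (\<lambda>\<omega>. f (X i k \<omega>)) \<longleftrightarrow> integrable (\<mu> k) f"
  using assms(1,2) by (simp_all add: distr_X[OF assms(1,2), symmetric] integral_distr integrable_distr_eq)

lemma AE_X:
  assumes "i \<ge> 1" "k \<in> {1..m}" "AE w in \<mu> k. P w" and [measurable]: "Measurable.pred borel P"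
  shows "AE \<omega> in M. P (X i k \<omega>)"
proof -
  have "AE w in distr M borel (X i k). P w" unfolding distr_X[OF assms(1,2)] by (rule assms(3))
  then show ?thesis using assms(1,2) by (subst (asm) AE_distr_iff) auto
qed

text \<open>
  Where \<open>P n z\<close> vanishes, \<open>ln 0 = 0\<close> stands in for \<open>-\<infinity>\<close>. This does no harm: such points form a null set
  for fixed outcome, and for fixed \<open>z\<close> the event is covered by the lower bounds above.
\<close>

definition P :: "nat \<Rightarrow> complex \<Rightarrow> 'a \<Rightarrow> complex" where
  "P n z \<omega> = (\<Sum>k\<in>{1..m}. \<Prod>i\<in>{1..n}. (z - X i k \<omega>))"

text \<open>The variables are numbered from 1 and the limit theorems from 0, hence
  \<open>Suc i\<close>.\<close>

lemma indep_column:
  assumes k: "k \<in> {1..m}" and [measurable]: "f \<in> borel_measurable borel"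
  shows "indep_vars (\<lambda>_. borel) (\<lambda>i \<omega>. f (X (Suc i) k \<omega>) :: real) UNIV"
proof -
  let ?K = "\<lambda>i::nat. {(Suc i, k)}"
  have "indep_vars (\<lambda>i. PiM (?K i) (\<lambda>_. borel)) (\<lambda>i \<omega>. restrict (\<lambda>x. (case x of (i, k) \<Rightarrow> X i k) \<omega>) (?K i)) UNIV"
    by (rule indep_vars_restrict[OF indep]) (use k in \<open>auto simp: disjoint_family_on_def\<close>)
  then have "indep_vars (\<lambda>_. borel) (\<lambda>i \<omega>. (\<lambda>x. f (x (Suc i, k))) (restrict (\<lambda>x. (case x of (i, k) \<Rightarrow> X i k) \<omega>) (?K i))) UNIV"
    by (rule indep_vars_compose2) measurable
  then show ?thesis by simp
qed

lemma prob_log_sum_tendsto_0: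
  assumes sq: "\<And>k. k \<in> {1..m} \<Longrightarrow> integrable (\<mu> k) (\<lambda>w. (ln (norm (z - w)))\<^sup>2)"
    and ne: "\<And>k. k \<in> {1..m} \<Longrightarrow> AE w in \<mu> k. norm (z - w) \<noteq> 0"
    and j: "j \<in> {1..m}" "pot (\<mu> j) z = U z"
    and alt: "(\<forall>k\<in>{1..m} - {j}. pot (\<mu> k) z < U z) \<or> \<not> (\<exists>r. AE w in \<mu> j. norm (w - z) = r)"
    and \<delta>: "\<delta> > 0"
  shows "(\<lambda>n. prob {\<omega> \<in> space M. \<bar>ln (norm (P n z \<omega>)) / real n - U z\<bar> > \<delta>}) \<longlonglongrightarrow> 0"
proof -
  define L where "L = (\<lambda>k i \<omega>. ln (norm (z - X (Suc i) k \<omega>)))"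
  define T where "T = (\<lambda>n k \<omega>. \<Sum>i<n. L k i \<omega>)"
  define u where "u = (\<lambda>k. pot (\<mu> k) z)"
  define v where "v = (\<lambda>k. \<integral>w. (ln (norm (z - w)) - u k)\<^sup>2 \<partial>\<mu> k)"
  define p where "p = (\<lambda>n k \<omega>. \<Prod>i\<in>{1..n}. (z - X i k \<omega>))"
  have Tm[measurable]: "k \<in> {1..m} \<Longrightarrow> T n k \<in> borel_measurable M" for n k unfolding T_def L_def by measurable
  have pm[measurable]: "k \<in> {1..m} \<Longrightarrow> p n k \<in> borel_measurable M" for n k unfolding p_def by measurable
  have Peq: "P n z \<omega> = (\<Sum>k\<in>{1..m}. p n k \<omega>)" for n \<omega> by (simp add: P_def p_def)
  have Lind: "indep_vars (\<lambda>_. borel) (L k) UNIV" if "k \<in> {1..m}" for k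
    unfolding L_def by (rule indep_column[OF that, of "\<lambda>w. ln (norm (z - w))"]) measurable
  have Lsq: "integrable M (\<lambda>\<omega>. (L k i \<omega>)\<^sup>2)" if "k \<in> {1..m}" for k i
    unfolding L_def using sq[OF that] by (subst integral_X(2)[OF _ that, of _ "\<lambda>w. (ln (norm (z - w)))\<^sup>2"]) auto
  have Lmean: "expectation (L k i) = u k" if "k \<in> {1..m}" for k i
    unfolding L_def u_def pot_def by (rule integral_X(1)[OF _ that, of _ "\<lambda>w. ln (norm (z - w))"]) auto
  have Lvar: "variance (L k i) = v k" if "k \<in> {1..m}" for k i
    unfolding Lmean[OF that] unfolding L_def v_def by (rule integral_X(1)[OF _ that, of _ "\<lambda>w. (ln (norm (z - w)) - u k)\<^sup>2"]) auto
  \<comment> \<open>Off this null event no factor vanishes, so the moduli are true exponentials of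
    sums of logarithms.\<close>
  have nz: "AE \<omega> in M. \<forall>i\<in>{1..}. \<forall>k\<in>{1..m}. z - X i k \<omega> \<noteq> 0"
  proof -
    have "AE \<omega> in M. z - X i k \<omega> \<noteq> 0" if "i \<in> {1..}" "k \<in> {1..m}" for i k
      by (rule AE_X[where P="\<lambda>w. z - w \<noteq> 0"]) (use that ne[of k] in auto)
    then show ?thesis by (simp add: AE_ball_countable)
  qed
  have norm_p: "norm (p n k \<omega>) = exp (T n k \<omega>)" if "\<forall>i\<in>{1..}. \<forall>k\<in>{1..m}. z - X i k \<omega> \<noteq> 0" "k \<in> {1..m}" for n k \<omega>
  proof -
    have "p n k \<omega> = (\<Prod>i<n. (z - X (Suc i) k \<omega>))" unfolding p_def by (simp add: prod.atLeast1_atMost_eq)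
    then have "norm (p n k \<omega>) = (\<Prod>i<n. norm (z - X (Suc i) k \<omega>))" by (simp add: prod_norm)
    also have "\<dots> = (\<Prod>i<n. exp (L k i \<omega>))" unfolding L_def using that by (intro prod.cong) auto
    also have "\<dots> = exp (T n k \<omega>)" unfolding T_def by (simp add: exp_sum)
    finally show ?thesis .
  qed
  have uU: "u k \<le> U z" if "k \<in> {1..m}" for k unfolding u_def by (rule pot_le_U[OF that])
  have uj: "u j = U z" using j by (simp add: u_def)
  define \<eta>0 where "\<eta>0 = \<delta> / 4"
  have wl: "(\<lambda>n. \<Sum>k\<in>{1..m}. prob {\<omega> \<in> space M. \<bar>T n k \<omega> - real n * u k\<bar> \<ge> \<eta> * real n}) \<longlonglongrightarrow> 0" if "\<eta> > 0" for \<eta>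
  proof -
    have "(\<lambda>n. \<Sum>k\<in>{1..m}. prob {\<omega> \<in> space M. \<bar>T n k \<omega> - real n * u k\<bar> \<ge> \<eta> * real n}) \<longlonglongrightarrow> (\<Sum>k\<in>{1..m}. 0)"
      unfolding T_def by (intro tendsto_sum weak_law[OF Lind Lsq Lmean Lvar that])
    then show ?thesis by simp
  qed
  \<comment> \<open>Common end of both cases: outside the deviation events of the weak law and an
    exceptional event \<open>E n\<close>, a lower bound for the sum is enough. Strict domination
    takes \<open>E n\<close> empty; in the other case it is the event that the two logarithms come
    within distance 1.\<close>
  have key: "(\<lambda>n. prob {\<omega> \<in> space M. \<bar>ln (norm (P n z \<omega>)) / real n - U z\<bar> > \<delta>}) \<longlonglongrightarrow> 0"
    if \<eta>: "0 < \<eta>" "4 * \<eta> \<le> \<delta>" and E[measurable]: "\<And>n. E n \<in> sets M" and Elim: "(\<lambda>n. prob (E n)) \<longlonglongrightarrow> 0"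
      and low: "\<forall>\<^sub>F n in sequentially. \<forall>\<omega>\<in>space M. (\<forall>i\<in>{1..}. \<forall>k\<in>{1..m}. z - X i k \<omega> \<noteq> 0) \<longrightarrow>
         (\<forall>k\<in>{1..m}. \<bar>T n k \<omega> - real n * u k\<bar> \<le> \<eta> * real n) \<longrightarrow> \<omega> \<notin> E n \<longrightarrow>
         exp (real n * (U z - 2 * \<eta>)) / 2 \<le> norm (\<Sum>k\<in>{1..m}. p n k \<omega>)" for \<eta> E
  proof (rule tendsto_sandwich[OF _ _ tendsto_const])
    show "(\<lambda>n. (\<Sum>k\<in>{1..m}. prob {\<omega> \<in> space M. \<bar>T n k \<omega> - real n * u k\<bar> \<ge> \<eta> * real n}) + prob (E n)) \<longlonglongrightarrow> 0"
      using tendsto_add[OF wl[OF \<eta>(1)] Elim] by simp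
    have "(\<lambda>n. (ln (real m) + ln 2) / real n) \<longlonglongrightarrow> 0" by (rule lim_const_over_n)
    then have "\<forall>\<^sub>F n in sequentially. (ln (real m) + ln 2) / real n < 2 * \<eta>"
      by (rule order_tendstoD(2)) (use \<eta> in simp)
    then show "\<forall>\<^sub>F n in sequentially. prob {\<omega> \<in> space M. \<bar>ln (norm (P n z \<omega>)) / real n - U z\<bar> > \<delta>}
      \<le> (\<Sum>k\<in>{1..m}. prob {\<omega> \<in> space M. \<bar>T n k \<omega> - real n * u k\<bar> \<ge> \<eta> * real n}) + prob (E n)"
      using low eventually_gt_at_top[of 0]
    proof eventually_elim
      case (elim n)
      let ?A = "\<lambda>k. {\<omega> \<in> space M. \<bar>T n k \<omega> - real n * u k\<bar> \<ge> \<eta> * real n}"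
      have A[measurable]: "?A k \<in> sets M" if "k \<in> {1..m}" for k using that by measurable
      have UA: "(\<Union>k\<in>{1..m}. ?A k) \<in> sets M" using A by auto
      have "prob {\<omega> \<in> space M. \<bar>ln (norm (P n z \<omega>)) / real n - U z\<bar> > \<delta>} \<le> prob ((\<Union>k\<in>{1..m}. ?A k) \<union> E n)"
      proof (rule finite_measure_mono_AE)
        show "AE \<omega> in M. \<omega> \<in> {\<omega> \<in> space M. \<bar>ln (norm (P n z \<omega>)) / real n - U z\<bar> > \<delta>} \<longrightarrow> \<omega> \<in> (\<Union>k\<in>{1..m}. ?A k) \<union> E n"
          using nz
        proof eventually_elim
          case (elim \<omega>)
          show ?case
          proof (rule impI, rule ccontr)
            assume bad: "\<omega> \<in> {\<omega> \<in> space M. \<bar>ln (norm (P n z \<omega>)) / real n - U z\<bar> > \<delta>}" and "\<omega> \<notin> (\<Union>k\<in>{1..m}. ?A k) \<union> E n"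
            then have w: "\<omega> \<in> space M" "\<omega> \<notin> E n" "\<And>k. k \<in> {1..m} \<Longrightarrow> \<bar>T n k \<omega> - real n * u k\<bar> \<le> \<eta> * real n" by force+
            have "exp (real n * (U z - 2 * \<eta>)) / 2 \<le> norm (\<Sum>k\<in>{1..m}. p n k \<omega>)"
              using \<open>\<forall>\<omega>\<in>space M. _\<close> w elim by blast
            from log_sum_bound[of "real n" j m "\<lambda>k. p n k \<omega>" "\<lambda>k. T n k \<omega>" u \<eta> "U z", OF _ j(1) norm_p[OF elim] w(3) uU \<eta>(1) this]
            have "\<bar>ln (norm (P n z \<omega>)) / real n - U z\<bar> \<le> 2 * \<eta> + (ln (real m) + ln 2) / real n"
              unfolding Peq using \<open>0 < n\<close> by simp
            also have "\<dots> \<le> \<delta>" using \<open>(ln (real m) + ln 2) / real n < 2 * \<eta>\<close> \<eta> by simp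
            finally show False using bad by simp
          qed
        qed
        show "(\<Union>k\<in>{1..m}. ?A k) \<union> E n \<in> sets M" using UA E by blast
      qed
      also have "\<dots> \<le> prob (\<Union>k\<in>{1..m}. ?A k) + prob (E n)" by (rule measure_Un_le[OF UA E])
      also have "prob (\<Union>k\<in>{1..m}. ?A k) \<le> (\<Sum>k\<in>{1..m}. prob (?A k))"
        by (rule measure_UNION_le) (use A in auto)
      finally show ?case by simp
    qed
  qed (simp add: measure_nonneg)
  from alt show ?thesis
  proof
    assume gap: "\<forall>k\<in>{1..m} - {j}. pot (\<mu> k) z < U z"
    have "\<exists>g>0. \<forall>k\<in>{1..m} - {j}. u k \<le> U z - g"
    proof (cases "{1..m} - {j} = {}")
      case True then show ?thesis by (intro exI[of _ 1]) (unfold True, simp)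
    next
      case False
      define g where "g = Min ((\<lambda>k. U z - u k) ` ({1..m} - {j}))"
      have "g > 0" unfolding g_def using False gap by (subst Min_gr_iff) (auto simp: u_def)
      moreover have "g \<le> U z - u k" if "k \<in> {1..m} - {j}" for k unfolding g_def using that by (intro Min_le) auto
      ultimately show ?thesis by (intro exI[of _ g]) force
    qed
    then obtain g where g: "g > 0" "\<And>k. k \<in> {1..m} - {j} \<Longrightarrow> u k \<le> U z - g" by blast
    define \<eta> where "\<eta> = min \<delta> g / 4"
    have \<eta>: "\<eta> > 0" "4 * \<eta> \<le> \<delta>" "4 * \<eta> \<le> g" using \<delta> g by (simp_all add: \<eta>_def)
    have "(\<lambda>n. real m * exp (- (real n * g / 2))) \<longlonglongrightarrow> 0" using g(1) by real_asymp
    then have "\<forall>\<^sub>F n in sequentially. real m * exp (- (real n * g / 2)) < 1/2" by (rule order_tendstoD(2)) simp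
    then have low: "\<forall>\<^sub>F n in sequentially. \<forall>\<omega>\<in>space M. (\<forall>i\<in>{1..}. \<forall>k\<in>{1..m}. z - X i k \<omega> \<noteq> 0) \<longrightarrow>
         (\<forall>k\<in>{1..m}. \<bar>T n k \<omega> - real n * u k\<bar> \<le> \<eta> * real n) \<longrightarrow> \<omega> \<notin> {} \<longrightarrow>
         exp (real n * (U z - 2 * \<eta>)) / 2 \<le> norm (\<Sum>k\<in>{1..m}. p n k \<omega>)"
      using eventually_gt_at_top[of 0]
    proof eventually_elim
      case (elim n)
      show ?case
      proof (intro ballI impI)
        fix \<omega> assume 1: "\<forall>i\<in>{1..}. \<forall>k\<in>{1..m}. z - X i k \<omega> \<noteq> 0" and 2: "\<forall>k\<in>{1..m}. \<bar>T n k \<omega> - real n * u k\<bar> \<le> \<eta> * real n"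
        show "exp (real n * (U z - 2 * \<eta>)) / 2 \<le> norm (\<Sum>k\<in>{1..m}. p n k \<omega>)"
          by (rule log_sum_lower_dominant[where p="\<lambda>k. p n k \<omega>" and s="\<lambda>k. T n k \<omega>" and u=u and g=g and j=j, OF _ j(1) uj norm_p[OF 1] _ g(2) \<eta>(1) \<eta>(3)])
             (use elim 2 in auto)
      qed
    qed
    show ?thesis by (rule key[OF \<eta>(1,2) _ _ low]) simp_all
  next
    assume nd: "\<not> (\<exists>r. AE w in \<mu> j. norm (w - z) = r)"
    interpret B: bounded_prob "\<mu> j" S by (rule bp[OF j(1)])
    have vi: "integrable (\<mu> j) (\<lambda>w. (ln (norm (z - w)) - u j)\<^sup>2)"
      unfolding power2_diff using sq[OF j(1)] B.integrable_ln[OF sq[OF j(1)]] by auto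
    \<comment> \<open>Zero variance would make \<open>norm (w - z)\<close> almost surely equal to
      \<open>exp (u j)\<close>, that is, put \<open>\<mu> j\<close> on a circle about
      \<open>z\<close>.\<close>
    have vpos: "v j > 0"
    proof (rule ccontr)
      assume "\<not> v j > 0"
      moreover have "v j \<ge> 0" unfolding v_def by (rule integral_nonneg_AE) simp
      ultimately have "v j = 0" by simp
      then have "AE w in \<mu> j. (ln (norm (z - w)) - u j)\<^sup>2 = 0"
        unfolding v_def by (subst (asm) integral_nonneg_eq_0_iff_AE[OF vi]) auto
      then have "AE w in \<mu> j. norm (w - z) = exp (u j)"
        using ne[OF j(1)]
      proof eventually_elim
        case (elim w)
        then have "ln (norm (z - w)) = u j" by simp
        then have "exp (u j) = norm (z - w)" using elim(2) by (metis exp_ln norm_ge_zero less_eq_real_def)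
        then show ?case by (simp add: norm_minus_commute)
      qed
      then show False using nd by blast
    qed
    define V where "V = (\<lambda>n \<omega>. ln (norm (\<Sum>k\<in>{1..m} - {j}. p n k \<omega>)))"
    define E where "E = (\<lambda>n. {\<omega> \<in> space M. \<bar>T n j \<omega> - V n \<omega>\<bar> \<le> 1})"
    have [measurable]: "V n \<in> borel_measurable M" for n
    proof -
      have "(\<lambda>\<omega>. \<Sum>k\<in>{1..m} - {j}. p n k \<omega>) \<in> borel_measurable M"
        by (intro borel_measurable_sum) auto
      then show ?thesis unfolding V_def by measurable
    qed
    have E[measurable]: "E n \<in> sets M" for n unfolding E_def using j(1) by measurable
    \<comment> \<open>\<open>T n j\<close> reads only column \<open>j\<close> of the array,
      \<open>V n\<close> only the other columns.\<close>
    have indTV: "indep_var borel (T n j) borel (V n)" for n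
    proof -
      let ?A = "{1..n} \<times> {j}" and ?B = "{1..n} \<times> ({1..m} - {j})"
      let ?X = "\<lambda>(i, k). X i k"
      let ?f = "\<lambda>x :: nat \<times> nat \<Rightarrow> complex. \<Sum>i\<in>{1..n}. ln (norm (z - x (i, j)))"
      let ?g = "\<lambda>x :: nat \<times> nat \<Rightarrow> complex. ln (norm (\<Sum>k\<in>{1..m} - {j}. \<Prod>i\<in>{1..n}. (z - x (i, k))))"
      have "indep_var (PiM ?A (\<lambda>_. borel)) (\<lambda>\<omega>. restrict (\<lambda>x. ?X x \<omega>) ?A) (PiM ?B (\<lambda>_. borel)) (\<lambda>\<omega>. restrict (\<lambda>x. ?X x \<omega>) ?B)"
        by (rule indep_var_restrict[OF indep]) (use j(1) in auto)
      moreover have "?f \<in> borel_measurable (PiM ?A (\<lambda>_. borel))"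
        by (intro borel_measurable_sum borel_measurable_ln borel_measurable_norm borel_measurable_diff borel_measurable_const measurable_component_singleton) auto
      moreover have "?g \<in> borel_measurable (PiM ?B (\<lambda>_. borel))"
        by (intro borel_measurable_sum borel_measurable_prod borel_measurable_ln borel_measurable_norm borel_measurable_diff borel_measurable_const measurable_component_singleton) auto
      ultimately have "indep_var borel (?f \<circ> (\<lambda>\<omega>. restrict (\<lambda>x. ?X x \<omega>) ?A)) borel (?g \<circ> (\<lambda>\<omega>. restrict (\<lambda>x. ?X x \<omega>) ?B))"
        by (rule indep_var_compose)
      moreover have "?f \<circ> (\<lambda>\<omega>. restrict (\<lambda>x. ?X x \<omega>) ?A) = T n j"
        unfolding T_def L_def by (auto simp: fun_eq_iff sum.atLeast1_atMost_eq)
      moreover have "?g \<circ> (\<lambda>\<omega>. restrict (\<lambda>x. ?X x \<omega>) ?B) = V n"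
        by (auto simp: fun_eq_iff V_def p_def intro!: arg_cong[where f="\<lambda>x. ln (norm x)"] sum.cong prod.cong)
      ultimately show ?thesis by simp
    qed
    have Elim: "(\<lambda>n. prob (E n)) \<longlonglongrightarrow> 0"
    proof (rule tendstoI)
      fix e :: real assume e: "e > 0"
      have "distr M borel (L j i) = distr (\<mu> j) borel (\<lambda>w. ln (norm (z - w)))" for i
        using j(1) by (subst distr_X[of "Suc i" j, symmetric]) (auto simp: distr_distr o_def L_def)
      moreover have "variance (L j i) = (sqrt (v j))\<^sup>2" for i using Lvar[OF j(1)] vpos by simp
      ultimately have "\<forall>\<^sub>F n in sequentially. \<forall>a. prob {\<omega> \<in> space M. \<bar>(\<Sum>i<n. L j i \<omega>) - a\<bar> \<le> 1} \<le> e / 2"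
        by (intro sum_concentration[OF Lind[OF j(1)] Lmean[OF j(1)] _ Lsq[OF j(1)], where \<sigma>="sqrt (v j)"]) (use vpos e in auto)
      then show "\<forall>\<^sub>F n in sequentially. dist (prob (E n)) 0 < e"
      proof eventually_elim
        case (elim n)
        have "prob (E n) \<le> e / 2"
          unfolding E_def by (rule indep_var_concentration[OF indTV]) (use elim e in \<open>auto simp: T_def\<close>)
        then show ?case using e by (simp add: dist_real_def)
      qed
    qed
    have \<eta>: "0 < \<delta> / 4" "4 * (\<delta> / 4) \<le> \<delta>" using \<delta> by simp_all
    have low: "\<forall>\<^sub>F n in sequentially. \<forall>\<omega>\<in>space M. (\<forall>i\<in>{1..}. \<forall>k\<in>{1..m}. z - X i k \<omega> \<noteq> 0) \<longrightarrow>
         (\<forall>k\<in>{1..m}. \<bar>T n k \<omega> - real n * u k\<bar> \<le> \<delta> / 4 * real n) \<longrightarrow> \<omega> \<notin> E n \<longrightarrow>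
         exp (real n * (U z - 2 * (\<delta> / 4))) / 2 \<le> norm (\<Sum>k\<in>{1..m}. p n k \<omega>)"
      using eventually_gt_at_top[of 0]
    proof eventually_elim
      case (elim n)
      show ?case
      proof (intro ballI impI)
        fix \<omega> assume w: "\<omega> \<in> space M" and 1: "\<forall>i\<in>{1..}. \<forall>k\<in>{1..m}. z - X i k \<omega> \<noteq> 0"
          and 2: "\<forall>k\<in>{1..m}. \<bar>T n k \<omega> - real n * u k\<bar> \<le> \<delta> / 4 * real n" and 3: "\<omega> \<notin> E n"
        show "exp (real n * (U z - 2 * (\<delta> / 4))) / 2 \<le> norm (\<Sum>k\<in>{1..m}. p n k \<omega>)"
        proof (rule log_sum_lower_spread[where p="\<lambda>k. p n k \<omega>" and s="\<lambda>k. T n k \<omega>" and u=u and j=j, OF _ j(1) uj norm_p[OF 1 j(1)] _ \<eta>(1)])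
          show "\<not> \<bar>T n j \<omega> - ln (norm (\<Sum>k\<in>{1..m} - {j}. p n k \<omega>))\<bar> \<le> 1"
            using 3 w by (simp add: E_def V_def)
        qed (use elim 2 j(1) in auto)
      qed
    qed
    show ?thesis by (rule key[OF \<eta> E Elim low])
  qed
qed

end

section \<open>Deterministic estimates for sums of polynomials\<close>

definition poly_sum :: "nat \<Rightarrow> nat \<Rightarrow> (nat \<Rightarrow> nat \<Rightarrow> complex) \<Rightarrow> complex \<Rightarrow> complex" where
  "poly_sum m n x z = (\<Sum>k\<in>{1..m}. \<Prod>i\<in>{1..n}. (z - x i k))"

lemma poly_sum_poly: "poly (sum_poly m n x) z = poly_sum m n x z"
  by (simp add: sum_poly_def root_poly_def poly_sum_def poly_sum poly_prod)

lemma root_poly_degree: "degree (root_poly n x) = n" "lead_coeff (root_poly n x) = 1"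
proof -
  show "degree (root_poly n x) = n"
    unfolding root_poly_def by (subst degree_prod_eq_sum_degree) auto
  show "lead_coeff (root_poly n x) = 1"
    unfolding root_poly_def by (subst lead_coeff_prod) simp
qed

text \<open>The summands are monic of the same degree, so their leading coefficients add up to
  \<open>m\<close> without cancellation; the sum therefore has exactly \<open>n\<close> zeros with
  multiplicity.\<close>

lemma sum_poly_degree:
  assumes "m \<ge> 1"
  shows "degree (sum_poly m n x) = n" "lead_coeff (sum_poly m n x) = of_nat m"
proof -
  have c: "coeff (sum_poly m n x) n = of_nat m"
    using root_poly_degree[of n] by (simp add: sum_poly_def coeff_sum)
  have "degree (sum_poly m n x) \<le> n"
    unfolding sum_poly_def by (intro degree_sum_le) (auto simp: root_poly_degree)
  moreover have "n \<le> degree (sum_poly m n x)" using assms c by (intro le_degree) simp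
  ultimately show d: "degree (sum_poly m n x) = n" by simp
  show "lead_coeff (sum_poly m n x) = of_nat m" using c d by simp
qed

lemma sum_poly_roots:
  assumes m: "m \<ge> 1"
  obtains \<zeta> where "\<And>z. poly_sum m n x z = of_nat m * (\<Prod>i<n. (z - \<zeta> i))"
    "\<And>\<phi>. zero_average \<phi> m n x = (1 / of_nat n) * (\<Sum>i<n. \<phi> (\<zeta> i))"
proof -
  let ?p = "sum_poly m n x"
  obtain xs where xs: "mset xs = proots ?p" using ex_mset by blast
  have len: "length xs = n"
    using size_proots_complex[of ?p] sum_poly_degree(1)[OF m, of n x] xs by (metis size_mset)
  have eq: "proots ?p = image_mset (\<lambda>i. xs ! i) (mset_set {..<n})"
  proof -
    have "map (\<lambda>i. xs ! i) [0..<n] = xs" using map_nth[of xs] len by simp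
    then have "mset xs = image_mset (\<lambda>i. xs ! i) (mset [0..<n])" by (metis mset_map)
    then show ?thesis using xs by (simp add: lessThan_atLeast0)
  qed
  show ?thesis
  proof (rule that[of "\<lambda>i. xs ! i"])
    fix z
    have "poly_sum m n x z = poly (smult (lead_coeff ?p) (\<Prod>x\<in>#proots ?p. [:-x, 1:])) z"
      by (simp only: complex_poly_decompose_multiset poly_sum_poly)
    also have "\<dots> = of_nat m * (\<Prod>i<n. (z - xs ! i))"
      unfolding eq sum_poly_degree(2)[OF m]
      by (simp add: image_mset.compositionality o_def prod_unfold_prod_mset[symmetric] poly_prod)
    finally show "poly_sum m n x z = of_nat m * (\<Prod>i<n. (z - xs ! i))" .
  next
    fix \<phi> :: "complex \<Rightarrow> complex"
    show "zero_average \<phi> m n x = (1 / of_nat n) * (\<Sum>i<n. \<phi> (xs ! i))"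
      unfolding zero_average_def eq
      by (simp add: image_mset.compositionality o_def sum_unfold_sum_mset[symmetric])
  qed
qed

lemma ln_norm_prod_roots:
  fixes z :: complex and n :: nat
  assumes "m \<ge> 1" "\<And>i. i < n \<Longrightarrow> z \<noteq> \<zeta> i"
  shows "ln (norm (of_nat m * (\<Prod>i<n. (z - \<zeta> i)))) = ln (real m) + (\<Sum>i<n. ln (norm (z - \<zeta> i)))"
proof -
  have a: "norm (of_nat m * (\<Prod>i<n. (z - \<zeta> i))) = real m * (\<Prod>i<n. norm (z - \<zeta> i))"
    by (simp add: norm_mult prod_norm)
  have b: "ln (\<Prod>i<n. norm (z - \<zeta> i)) = (\<Sum>i<n. ln (norm (z - \<zeta> i)))"
    using assms(2) by (intro ln_prod) auto
  have "(\<Prod>i<n. norm (z - \<zeta> i)) > 0" using assms(2) by (intro prod_pos) auto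
  then have "ln (real m * (\<Prod>i<n. norm (z - \<zeta> i))) = ln (real m) + ln (\<Prod>i<n. norm (z - \<zeta> i))"
    using assms(1) by (intro ln_mult_pos) simp_all
  then show ?thesis unfolding a b .
qed

lemma AE_not_roots: "AE z in lborel. \<forall>i<(n::nat). z \<noteq> (\<zeta> i :: complex)"
proof -
  have "AE z in lborel. \<forall>i\<in>{..<n}. z \<noteq> \<zeta> i"
    by (rule AE_finite_allI) (auto simp: AE_lborel_singleton)
  then show ?thesis by (rule eventually_mono) auto
qed

lemma poly_sum_measurable [measurable]: "poly_sum m n x \<in> borel_measurable borel"
  unfolding poly_sum_def[abs_def] by measurable

text \<open>Off the roots, a null set, the logarithm is \<open>ln (real m)\<close> plus a sum of
  translated logarithms; \<open>poisson\<close> evaluates each of these and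
  \<open>integral_laplacian\<close> removes the constant.\<close>

lemma zero_average_eq_integral:
  assumes \<phi>: "test_function \<phi>" and m: "m \<ge> 1" and n: "n \<ge> 1"
  shows "zero_average \<phi> m n x = complex_of_real (1 / (2 * pi)) *
      (\<integral>z. laplacian \<phi> z * complex_of_real (ln (norm (poly_sum m n x z)) / real n) \<partial>lborel)"
    and "integrable lborel (\<lambda>z. laplacian \<phi> z * complex_of_real (ln (norm (poly_sum m n x z)) / real n))"
proof -
  obtain \<zeta> where \<zeta>: "\<And>z. poly_sum m n x z = of_nat m * (\<Prod>i<n. (z - \<zeta> i))"
    "\<And>\<phi>. zero_average \<phi> m n x = (1 / of_nat n) * (\<Sum>i<n. \<phi> (\<zeta> i))"
    using sum_poly_roots[OF m, of n x] by blast
  have lm[measurable]: "laplacian \<phi> \<in> borel_measurable borel" by (rule laplacian_test_function(1)[OF \<phi>])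
  obtain B where B: "\<And>z. norm (laplacian \<phi> z) \<le> B" using laplacian_test_function(2)[OF \<phi>] by blast
  have "bounded (supp_fun \<phi>)" using \<phi> by (simp add: test_function_def compact_imp_bounded)
  then obtain R where R: "R > 0" "\<forall>z\<in>supp_fun \<phi>. norm z \<le> R" unfolding bounded_pos by blast
  have l0: "laplacian \<phi> z = 0" if "norm z > R" for z
    using laplacian_test_function(3)[OF \<phi>, of z] R(2) that by force
  have li: "integrable lborel (\<lambda>z. laplacian \<phi> z * complex_of_real (ln (norm (z - w))))" for w
    by (rule loc_integrable_mult[OF loc_integrable_ln lm B l0])
  have c: "loc_integrable (\<lambda>_. 1)"
    unfolding loc_integrable_def using emeasure_bounded_finite[of "cball (0::complex) _"]
    by (auto simp: integrable_indicator_iff)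
  have l1: "integrable lborel (laplacian \<phi>)" using loc_integrable_mult[OF c lm B l0] by simp
  let ?f = "\<lambda>z. (laplacian \<phi> z * complex_of_real (ln (real m)) + (\<Sum>i<n. laplacian \<phi> z * complex_of_real (ln (norm (z - \<zeta> i))))) / of_nat n"
  have ae: "AE z in lborel. laplacian \<phi> z * complex_of_real (ln (norm (poly_sum m n x z)) / real n) = ?f z"
    using AE_not_roots[of n \<zeta>]
  proof eventually_elim
    case (elim z)
    then have "ln (norm (poly_sum m n x z)) = ln (real m) + (\<Sum>i<n. ln (norm (z - \<zeta> i)))"
      unfolding \<zeta>(1) by (intro ln_norm_prod_roots[OF m]) auto
    then show ?case by (simp add: sum_distrib_left[symmetric] distrib_left)
  qed
  have fi: "integrable lborel ?f"
    using li l1 by (intro integrable_divide_zero Bochner_Integration.integrable_add Bochner_Integration.integrable_sum) auto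
  show "integrable lborel (\<lambda>z. laplacian \<phi> z * complex_of_real (ln (norm (poly_sum m n x z)) / real n))"
    by (subst integrable_cong_AE[OF _ _ ae]) (use fi in auto)
  have "(\<integral>z. laplacian \<phi> z * complex_of_real (ln (norm (poly_sum m n x z)) / real n) \<partial>lborel) = (\<integral>z. ?f z \<partial>lborel)"
    by (rule integral_cong_AE[OF _ _ ae]) measurable
  also have "\<dots> = (\<Sum>i<n. complex_of_real (2 * pi) * \<phi> (\<zeta> i)) / of_nat n"
    using li l1 by (simp add: poisson[OF \<phi>] integral_laplacian[OF \<phi>])
  finally have eq: "(\<integral>z. laplacian \<phi> z * complex_of_real (ln (norm (poly_sum m n x z)) / real n) \<partial>lborel)
      = (\<Sum>i<n. complex_of_real (2 * pi) * \<phi> (\<zeta> i)) / of_nat n" .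
  show "zero_average \<phi> m n x = complex_of_real (1 / (2 * pi)) *
      (\<integral>z. laplacian \<phi> z * complex_of_real (ln (norm (poly_sum m n x z)) / real n) \<partial>lborel)"
    unfolding \<zeta>(2) eq by (simp add: sum_distrib_left[symmetric])
qed

text \<open>By the circle mean of the logarithm, the left-hand side is at most the average of \<open>ln |P / m|\<close> over a circle avoiding the roots.\<close>

lemma sum_ln_max_roots:
  assumes m: "m \<ge> 1" and R: "R > 0" and x: "\<And>i k. i \<in> {1..n} \<Longrightarrow> k \<in> {1..m} \<Longrightarrow> norm (x i k) \<le> R"
    and \<zeta>: "\<And>z. poly_sum m n x z = of_nat m * (\<Prod>i<n. (z - \<zeta> i))"
  shows "(\<Sum>i<n. ln (max (norm (\<zeta> i)) R)) \<le> real n * ln (2 * R + 1)"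
proof -
  \<comment> \<open>\<open>circle_mean_ln\<close> excludes circles through a root, and finitely many
    moduli cannot fill the interval. The choice \<open>s < R + 1\<close> leads to the bound
    \<open>2 * R + 1\<close>.\<close>
  have "\<exists>s\<in>{R<..<R+1}. s \<notin> (\<lambda>i. norm (\<zeta> i)) ` {..<n}"
  proof (rule ccontr)
    assume "\<not> ?thesis"
    then have "{R<..<R+1} \<subseteq> (\<lambda>i. norm (\<zeta> i)) ` {..<n}" by blast
    then have "finite {R<..<R+1}" by (rule finite_subset) simp
    then show False using infinite_Ioo[of R "R+1"] by simp
  qed
  then obtain s where s': "s \<in> {R<..<R+1}" "s \<notin> (\<lambda>i. norm (\<zeta> i)) ` {..<n}" by blast
  then have s: "R < s" "s < R + 1" "\<And>i. i < n \<Longrightarrow> norm (\<zeta> i) \<noteq> s" by auto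
  have s0: "s > 0" using s R by simp
  interpret C: prob_space "circle_measure s" by (rule prob_space_circle_measure)
  have mean: "integrable (circle_measure s) (\<lambda>\<omega>. ln (norm (\<omega> - \<zeta> i)))"
    "(\<integral>\<omega>. ln (norm (\<omega> - \<zeta> i)) \<partial>circle_measure s) = ln (max (norm (\<zeta> i)) s)" if "i < n" for i
    using circle_mean_ln[OF s0, of "- \<zeta> i"] s(3)[OF that] by (simp_all add: algebra_simps)
  have "(\<Sum>i<n. ln (max (norm (\<zeta> i)) R)) \<le> (\<Sum>i<n. ln (max (norm (\<zeta> i)) s))"
    using R s by (intro sum_mono ln_mono) auto
  also have "\<dots> = (\<integral>\<omega>. (\<Sum>i<n. ln (norm (\<omega> - \<zeta> i))) \<partial>circle_measure s)"
    using mean by (subst Bochner_Integration.integral_sum) auto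
  also have "\<dots> \<le> (\<integral>\<omega>. real n * ln (s + R) \<partial>circle_measure s)"
  proof (rule integral_mono_AE)
    show "AE \<omega> in circle_measure s. (\<Sum>i<n. ln (norm (\<omega> - \<zeta> i))) \<le> real n * ln (s + R)"
    proof (rule AE_mp[OF circle_measure_norm_AE], use s0 in simp, intro AE_I2 impI)
      fix \<omega> :: complex assume \<omega>: "norm \<omega> = s"
      have ne: "\<omega> \<noteq> \<zeta> i" if "i < n" for i using \<omega> s(3)[OF that] by auto
      have "norm (poly_sum m n x \<omega>) \<le> (\<Sum>k\<in>{1..m}. norm (\<Prod>i\<in>{1..n}. (\<omega> - x i k)))"
        unfolding poly_sum_def by (rule norm_sum)
      also have "\<dots> \<le> (\<Sum>k\<in>{1..m}. (s + R) ^ n)"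
      proof (rule sum_mono)
        fix k assume k: "k \<in> {1..m}"
        have "norm (\<Prod>i\<in>{1..n}. (\<omega> - x i k)) = (\<Prod>i\<in>{1..n}. norm (\<omega> - x i k))" by (simp add: prod_norm)
        also have "\<dots> \<le> (\<Prod>i\<in>{1..n}. s + R)"
        proof (intro prod_mono conjI)
          fix i assume "i \<in> {1..n}"
          then show "norm (\<omega> - x i k) \<le> s + R" using norm_triangle_ineq4[of \<omega> "x i k"] x[OF _ k, of i] \<omega> by simp
        qed simp
        finally show "norm (\<Prod>i\<in>{1..n}. (\<omega> - x i k)) \<le> (s + R) ^ n" by simp
      qed
      also have "\<dots> = real m * (s + R) ^ n" by simp
      finally have le: "norm (poly_sum m n x \<omega>) \<le> real m * (s + R) ^ n" .
      have eq: "ln (norm (poly_sum m n x \<omega>)) = ln (real m) + (\<Sum>i<n. ln (norm (\<omega> - \<zeta> i)))"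
        unfolding \<zeta> using ne by (intro ln_norm_prod_roots[OF m]) auto
      have "poly_sum m n x \<omega> \<noteq> 0" unfolding \<zeta> using ne m by auto
      then have "ln (norm (poly_sum m n x \<omega>)) \<le> ln (real m * (s + R) ^ n)" using le by (intro ln_mono) auto
      also have "\<dots> = ln (real m) + real n * ln (s + R)"
        using m s0 R by (simp add: ln_mult ln_realpow)
      finally show "(\<Sum>i<n. ln (norm (\<omega> - \<zeta> i))) \<le> real n * ln (s + R)" unfolding eq by simp
    qed
  qed (use mean in auto)
  also have "\<dots> = real n * ln (s + R)" using C.prob_space by simp
  also have "\<dots> \<le> real n * ln (2 * R + 1)" using s s0 R by (intro mult_left_mono ln_mono) auto
  finally show ?thesis .
qed

text \<open>Roots may lie far away, but \<open>sum_ln_max_roots\<close> bounds the average of their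
  logarithms, and near each root \<open>lneg 1\<close> has a square integral independent of its
  position. The division by \<open>n\<close> compensates the number of roots, so \<open>C\<close>
  depends only on \<open>m\<close> and \<open>R\<close>.\<close>

lemma log_poly_sum_square_bound:
  assumes m: "m \<ge> 1" and R: "R \<ge> 1"
  obtains C where "C < \<infinity>" "\<And>n x. n \<ge> 1 \<Longrightarrow> (\<And>i k. i \<in> {1..n} \<Longrightarrow> k \<in> {1..m} \<Longrightarrow> norm (x i k) \<le> R) \<Longrightarrow>
    (\<integral>\<^sup>+z. indicator (cball 0 R) z * ennreal ((ln (norm (poly_sum m n x z)) / real n)\<^sup>2) \<partial>lborel) \<le> C"
proof -
  define c0 where "c0 = ln (real m) + ln 2 + ln (2 * R + 1)"
  define c2 where "c2 = (\<integral>\<^sup>+a. ennreal ((lneg 1 a)\<^sup>2) \<partial>lborel)"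
  define C where "C = ennreal (2 * c0\<^sup>2) * emeasure lborel (cball (0::complex) R) + 2 * c2"
  have cb[measurable]: "cball (0::complex) R \<in> sets borel" by (simp add: borel_closed)
  have "C < \<infinity>" unfolding C_def c2_def using nn_integral_lneg_square emeasure_bounded_finite[of "cball (0::complex) R"]
    by (auto simp: ennreal_mult_less_top)
  moreover have "(\<integral>\<^sup>+z. indicator (cball 0 R) z * ennreal ((ln (norm (poly_sum m n x z)) / real n)\<^sup>2) \<partial>lborel) \<le> C"
    if n: "n \<ge> 1" and x: "\<And>i k. i \<in> {1..n} \<Longrightarrow> k \<in> {1..m} \<Longrightarrow> norm (x i k) \<le> R" for n x
  proof -
    obtain \<zeta> where \<zeta>: "\<And>z. poly_sum m n x z = of_nat m * (\<Prod>i<n. (z - \<zeta> i))"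
      using sum_poly_roots[OF m, of n x] by metis
    have sm: "(\<Sum>i<n. ln (max (norm (\<zeta> i)) R)) \<le> real n * ln (2 * R + 1)"
      by (rule sum_ln_max_roots[OF m _ x \<zeta>]) (use R in auto)
    have "(\<integral>\<^sup>+z. indicator (cball 0 R) z * ennreal ((ln (norm (poly_sum m n x z)) / real n)\<^sup>2) \<partial>lborel)
      \<le> (\<integral>\<^sup>+z. ennreal (2 * c0\<^sup>2) * indicator (cball 0 R) z + ennreal (2 / real n) * (\<Sum>i<n. ennreal ((lneg 1 (z - \<zeta> i))\<^sup>2)) \<partial>lborel)"
    proof (rule nn_integral_mono_AE)
      show "AE z in lborel. indicator (cball 0 R) z * ennreal ((ln (norm (poly_sum m n x z)) / real n)\<^sup>2)
        \<le> ennreal (2 * c0\<^sup>2) * indicator (cball 0 R) z + ennreal (2 / real n) * (\<Sum>i<n. ennreal ((lneg 1 (z - \<zeta> i))\<^sup>2))"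
        using AE_not_roots[of n \<zeta>]
      proof eventually_elim
        case (elim z)
        show ?case
        proof (cases "norm z \<le> R")
          case True
          have one: "\<bar>ln (norm (z - \<zeta> i))\<bar> \<le> lneg 1 (z - \<zeta> i) + (ln 2 + ln (max (norm (\<zeta> i)) R))" if "i < n" for i
          proof -
            have "norm (z - \<zeta> i) \<le> 2 * max (norm (\<zeta> i)) R" using norm_triangle_ineq4[of z "\<zeta> i"] True by linarith
            moreover have p: "norm (z - \<zeta> i) > 0" using elim that by simp
            ultimately have "ln (norm (z - \<zeta> i)) \<le> ln (2 * max (norm (\<zeta> i)) R)" by (intro ln_mono) auto
            also have "\<dots> = ln 2 + ln (max (norm (\<zeta> i)) R)" using R by (subst ln_mult) auto
            finally have 1: "ln (norm (z - \<zeta> i)) \<le> ln 2 + ln (max (norm (\<zeta> i)) R)" .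
            have 2: "0 \<le> ln 2 + ln (max (norm (\<zeta> i)) R)" using R by (intro add_nonneg_nonneg) auto
            have 3: "lneg 1 (z - \<zeta> i) = max 0 (- ln (norm (z - \<zeta> i)))" using p by (simp add: lneg_def ln_div)
            show ?thesis using 1 2 unfolding 3 by linarith
          qed
          define a where "a = (\<Sum>i<n. lneg 1 (z - \<zeta> i))"
          have a0: "a \<ge> 0" unfolding a_def by (intro sum_nonneg) simp
          have lm: "0 \<le> ln (real m)" using m by simp
          have "\<bar>ln (norm (poly_sum m n x z))\<bar> = \<bar>ln (real m) + (\<Sum>i<n. ln (norm (z - \<zeta> i)))\<bar>"
            unfolding \<zeta> using elim by (subst ln_norm_prod_roots[OF m]) auto
          also have "\<dots> \<le> ln (real m) + (\<Sum>i<n. \<bar>ln (norm (z - \<zeta> i))\<bar>)"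
            using sum_abs[of "\<lambda>i. ln (norm (z - \<zeta> i))" "{..<n}"] lm by linarith
          also have "(\<Sum>i<n. \<bar>ln (norm (z - \<zeta> i))\<bar>) \<le> (\<Sum>i<n. lneg 1 (z - \<zeta> i) + (ln 2 + ln (max (norm (\<zeta> i)) R)))"
            by (rule sum_mono) (use one in auto)
          also have "\<dots> = a + real n * ln 2 + (\<Sum>i<n. ln (max (norm (\<zeta> i)) R))"
            by (simp add: sum.distrib a_def)
          also have "ln (real m) + \<dots> \<le> real n * ln (real m) + (a + real n * ln 2 + real n * ln (2 * R + 1))"
            using sm n lm mult_right_mono[of 1 "real n" "ln (real m)"] by simp
          finally have "\<bar>ln (norm (poly_sum m n x z))\<bar> \<le> real n * c0 + a" by (simp add: c0_def algebra_simps)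
          then have "\<bar>ln (norm (poly_sum m n x z)) / real n\<bar> \<le> c0 + a / real n"
            using n by (simp add: field_simps)
          moreover have "0 \<le> c0" unfolding c0_def using lm R by (intro add_nonneg_nonneg) auto
          ultimately have "(ln (norm (poly_sum m n x z)) / real n)\<^sup>2 \<le> (c0 + a / real n)\<^sup>2"
            using a0 by (intro abs_le_square_iff[THEN iffD1]) simp
          also have "\<dots> \<le> 2 * c0\<^sup>2 + 2 * (a / real n)\<^sup>2"
            using sum_squares_bound[of c0 "a / real n"] by (simp add: power2_sum)
          \<comment> \<open>Cauchy-Schwarz: the square of a sum of \<open>n\<close> terms is at most
            \<open>n\<close> times the sum of their squares.\<close>
          also have "(a / real n)\<^sup>2 \<le> (\<Sum>i<n. (lneg 1 (z - \<zeta> i))\<^sup>2) / real n"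
          proof -
            have "a\<^sup>2 \<le> (\<Sum>i<n. (lneg 1 (z - \<zeta> i))\<^sup>2) * real n"
              unfolding a_def using sum_squared_le_sum_of_squares[of "\<lambda>i. lneg 1 (z - \<zeta> i)" "{..<n}"] by simp
            then show ?thesis using n by (simp add: power_divide power2_eq_square field_simps)
          qed
          finally have "(ln (norm (poly_sum m n x z)) / real n)\<^sup>2 \<le> 2 * c0\<^sup>2 + 2 / real n * (\<Sum>i<n. (lneg 1 (z - \<zeta> i))\<^sup>2)" by simp
          then have "ennreal ((ln (norm (poly_sum m n x z)) / real n)\<^sup>2) \<le> ennreal (2 * c0\<^sup>2 + 2 / real n * (\<Sum>i<n. (lneg 1 (z - \<zeta> i))\<^sup>2))"
            by (rule ennreal_leI)
          also have "\<dots> = ennreal (2 * c0\<^sup>2) + ennreal (2 / real n) * (\<Sum>i<n. ennreal ((lneg 1 (z - \<zeta> i))\<^sup>2))"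
          proof -
            have E: "ennreal (a + b * c) = ennreal a + ennreal b * ennreal c" if "0 \<le> a" "0 \<le> b" "0 \<le> c" for a b c :: real
              using that by (simp add: ennreal_plus ennreal_mult)
            have "(\<Sum>i<n. ennreal ((lneg 1 (z - \<zeta> i))\<^sup>2)) = ennreal (\<Sum>i<n. (lneg 1 (z - \<zeta> i))\<^sup>2)"
              by (rule sum_ennreal) simp
            moreover have "0 \<le> (\<Sum>i<n. (lneg 1 (z - \<zeta> i))\<^sup>2)" by (rule sum_nonneg) simp
            ultimately show ?thesis using E[of "2 * c0\<^sup>2" "2 / real n"] by simp
          qed
          finally show ?thesis using True by simp
        qed simp
      qed
    qed
    also have "\<dots> = (\<integral>\<^sup>+z. ennreal (2 * c0\<^sup>2) * indicator (cball (0::complex) R) z \<partial>lborel) + (\<integral>\<^sup>+z. ennreal (2 / real n) * (\<Sum>i<n. ennreal ((lneg 1 (z - \<zeta> i))\<^sup>2)) \<partial>lborel)"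
      by (rule nn_integral_add) measurable
    also have "(\<integral>\<^sup>+z. ennreal (2 * c0\<^sup>2) * indicator (cball (0::complex) R) z \<partial>lborel) = ennreal (2 * c0\<^sup>2) * emeasure lborel (cball (0::complex) R)"
      by (rule nn_integral_cmult_indicator) simp
    also have "(\<integral>\<^sup>+z. ennreal (2 / real n) * (\<Sum>i<n. ennreal ((lneg 1 (z - \<zeta> i))\<^sup>2)) \<partial>lborel) = ennreal (2 / real n) * (\<Sum>i<n. \<integral>\<^sup>+z. ennreal ((lneg 1 (z - \<zeta> i))\<^sup>2) \<partial>lborel)"
      by (subst nn_integral_cmult, measurable) (subst nn_integral_sum, auto)
    also have "\<dots> = ennreal (2 / real n) * (\<Sum>i<n. c2)"
      unfolding c2_def by (simp add: nn_integral_lborel_translation[of "\<lambda>z. ennreal ((lneg 1 z)\<^sup>2)"])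
    also have "\<dots> = ennreal (2 / real n) * ennreal (real n) * c2" by (simp add: ennreal_of_nat_eq_real_of_nat mult.assoc)
    also have "ennreal (2 / real n) * ennreal (real n) = ennreal 2" using n by (simp add: ennreal_mult[symmetric])
    also have "ennreal 2 = 2" by (metis ennreal_numeral)
    finally show ?thesis unfolding C_def .
  qed
  ultimately show ?thesis using that by blast
qed

section \<open>Convergence of zero averages\<close>

context random_roots
begin

lemma P_eq_poly_sum: "P n z \<omega> = poly_sum m n (\<lambda>i k. X i k \<omega>) z"
  by (simp add: P_def poly_sum_def)

lemma P_measurable_pair [measurable]: "(\<lambda>(z, \<omega>). P n z \<omega>) \<in> borel_measurable (borel \<Otimes>\<^sub>M M)"
proof -
  have "(\<lambda>p. \<Sum>k\<in>{1..m}. \<Prod>i\<in>{1..n}. (fst p - X i k (snd p))) \<in> borel_measurable (borel \<Otimes>\<^sub>M M)"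
    by (intro borel_measurable_sum borel_measurable_prod borel_measurable_diff measurable_fst
        measurable_compose[OF measurable_snd X_measurable]) auto
  then show ?thesis by (simp add: P_def split_beta)
qed

lemma AE_X_bounded: "AE \<omega> in M. \<forall>i\<in>{1..}. \<forall>k\<in>{1..m}. norm (X i k \<omega>) \<le> S"
proof -
  have "AE \<omega> in M. norm (X i k \<omega>) \<le> S" if "i \<in> {1..}" "k \<in> {1..m}" for i k
    by (rule AE_X[where P="\<lambda>w. norm w \<le> S"]) (use that bounded_prob.AE_norm_le[OF bp[of k]] in auto)
  then show ?thesis by (simp add: AE_ball_countable)
qed

definition D :: "nat \<Rightarrow> complex \<Rightarrow> 'a \<Rightarrow> real" where
  "D n z \<omega> = ln (norm (P n z \<omega>)) / real n - U z"

lemma D_measurable_pair [measurable]: "(\<lambda>(z, \<omega>). D n z \<omega>) \<in> borel_measurable (borel \<Otimes>\<^sub>M M)"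
  unfolding D_def split_beta by measurable

text \<open>One radius \<open>R'\<close> covers the disc of integration and the almost sure bound
  \<open>S\<close> on the \<open>X i k\<close>, and is at least 1 as the deterministic estimate
  asks.\<close>

lemma D_square_bound:
  obtains Q where "Q < \<infinity>" "\<And>n. n \<ge> 1 \<Longrightarrow>
    (\<integral>\<^sup>+\<omega>. (\<integral>\<^sup>+z. indicator (cball 0 R) z * ennreal ((D n z \<omega>)\<^sup>2) \<partial>lborel) \<partial>M) \<le> Q"
proof -
  define R' where "R' = max (max R S) 1"
  have R': "R' \<ge> 1" "S \<le> R'" "R \<le> R'" by (auto simp: R'_def)
  obtain C where C: "C < \<infinity>" "\<And>n x. n \<ge> 1 \<Longrightarrow> (\<And>i k. i \<in> {1..n} \<Longrightarrow> k \<in> {1..m} \<Longrightarrow> norm (x i k) \<le> R') \<Longrightarrow>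
    (\<integral>\<^sup>+z. indicator (cball 0 R') z * ennreal ((ln (norm (poly_sum m n x z)) / real n)\<^sup>2) \<partial>lborel) \<le> C"
    using log_poly_sum_square_bound[OF m R'(1)] by blast
  define CU where "CU = (\<integral>\<^sup>+z. indicator (cball 0 R') z * ennreal ((U z)\<^sup>2) \<partial>lborel)"
  have CU: "CU < \<infinity>" unfolding CU_def using loc_square_integrable_U by (simp add: loc_square_integrable_def)
  have "(\<integral>\<^sup>+\<omega>. (\<integral>\<^sup>+z. indicator (cball 0 R) z * ennreal ((D n z \<omega>)\<^sup>2) \<partial>lborel) \<partial>M) \<le> 2 * C + 2 * CU" if n: "n \<ge> 1" for n
  proof -
    have "(\<integral>\<^sup>+\<omega>. (\<integral>\<^sup>+z. indicator (cball 0 R) z * ennreal ((D n z \<omega>)\<^sup>2) \<partial>lborel) \<partial>M) \<le> (\<integral>\<^sup>+\<omega>. 2 * C + 2 * CU \<partial>M)"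
    proof (rule nn_integral_mono_AE)
      show "AE \<omega> in M. (\<integral>\<^sup>+z. indicator (cball 0 R) z * ennreal ((D n z \<omega>)\<^sup>2) \<partial>lborel) \<le> 2 * C + 2 * CU"
        using AE_X_bounded
      proof eventually_elim
        case (elim \<omega>)
        let ?W = "\<lambda>z. ln (norm (poly_sum m n (\<lambda>i k. X i k \<omega>) z)) / real n"
        have "(\<integral>\<^sup>+z. indicator (cball 0 R) z * ennreal ((D n z \<omega>)\<^sup>2) \<partial>lborel)
          \<le> (\<integral>\<^sup>+z. 2 * (indicator (cball 0 R') z * ennreal ((?W z)\<^sup>2)) + 2 * (indicator (cball 0 R') z * ennreal ((U z)\<^sup>2)) \<partial>lborel)"
        proof (rule nn_integral_mono)
          fix z
          have "(D n z \<omega>)\<^sup>2 \<le> 2 * (?W z)\<^sup>2 + 2 * (U z)\<^sup>2"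
            using sum_squares_bound[of "?W z" "- U z"] by (simp add: D_def P_eq_poly_sum power2_diff)
          then have "ennreal ((D n z \<omega>)\<^sup>2) \<le> ennreal (2 * (?W z)\<^sup>2 + 2 * (U z)\<^sup>2)" by (rule ennreal_leI)
          also have "\<dots> = 2 * ennreal ((?W z)\<^sup>2) + 2 * ennreal ((U z)\<^sup>2)" by (simp add: ennreal_plus ennreal_mult)
          finally show "indicator (cball 0 R) z * ennreal ((D n z \<omega>)\<^sup>2) \<le> 2 * (indicator (cball 0 R') z * ennreal ((?W z)\<^sup>2)) + 2 * (indicator (cball 0 R') z * ennreal ((U z)\<^sup>2))"
            using R'(3) by (auto simp: indicator_def)
        qed
        also have "\<dots> = 2 * (\<integral>\<^sup>+z. indicator (cball 0 R') z * ennreal ((?W z)\<^sup>2) \<partial>lborel) + 2 * CU"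
          unfolding CU_def by (subst nn_integral_add, measurable) (simp add: nn_integral_cmult)
        also have "\<dots> \<le> 2 * C + 2 * CU"
          by (intro add_right_mono mult_left_mono C(2)[OF n]) (use elim R'(2) in \<open>force+\<close>)
        finally show ?case .
      qed
    qed
    also have "\<dots> = 2 * C + 2 * CU" using emeasure_space_1 by simp
    finally show ?thesis .
  qed
  moreover have "2 * C + 2 * CU < \<infinity>" using C(1) CU by (auto simp: ennreal_mult_less_top)
  ultimately show ?thesis using that by blast
qed

sublocale LM: pair_sigma_finite lborel M by standard

text \<open>Vitali's argument with explicit thresholds: convergence in probability at almost every
  \<open>z\<close>, together with the L^2 bound, gives convergence in L^1 over \<open>K\<close> and
  the probability space jointly.\<close>

lemma expected_L1_tendsto_0:
  assumes K[measurable]: "K \<in> sets borel" and KR: "K \<subseteq> cball 0 R"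
    and pw: "AE z in lborel. z \<in> K \<longrightarrow> (\<forall>\<delta>>0. (\<lambda>n. prob {\<omega> \<in> space M. \<bar>D n z \<omega>\<bar> > \<delta>}) \<longlonglongrightarrow> 0)"
    and e: "e > 0"
  shows "\<forall>\<^sub>F n in sequentially. (\<integral>\<^sup>+\<omega>. (\<integral>\<^sup>+z. indicator K z * ennreal \<bar>D n z \<omega>\<bar> \<partial>lborel) \<partial>M) \<le> ennreal e"
proof -
  obtain Q' where Q': "Q' < \<infinity>" "\<And>n. n \<ge> 1 \<Longrightarrow>
    (\<integral>\<^sup>+\<omega>. (\<integral>\<^sup>+z. indicator (cball 0 R) z * ennreal ((D n z \<omega>)\<^sup>2) \<partial>lborel) \<partial>M) \<le> Q'"
    using D_square_bound[of R] by blast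
  define Q where "Q = enn2real Q'"
  have Q: "Q' = ennreal Q" "Q \<ge> 0" using Q'(1) by (simp_all add: Q_def)
  have Kfin: "emeasure lborel K < \<infinity>"
    using emeasure_mono[OF KR, of lborel] emeasure_bounded_finite[of "cball (0::complex) R"] by (simp add: le_less_trans borel_closed)
  define l where "l = measure lborel K"
  have l: "emeasure lborel K = ennreal l" "l \<ge> 0" using Kfin by (simp_all add: l_def emeasure_eq_ennreal_measure)
  \<comment> \<open>Three shares of \<open>e / 3\<close>: \<open>a\<close> times the area of
    \<open>K\<close> for small values, the second moment divided by \<open>A\<close>, and
    \<open>A\<close> times the integrated probability of exceeding \<open>a\<close>.\<close>
  define a where "a = e / (3 * (l + 1))"
  define A where "A = 3 * (Q + 1) / e"
  have a: "a > 0" "a * l \<le> e / 3" using e l by (simp_all add: a_def field_simps)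
  have A: "A > 0" "Q / A \<le> e / 3" using e Q by (simp_all add: A_def field_simps)
  define pr where "pr n z = prob {\<omega> \<in> space M. \<bar>D n z \<omega>\<bar> > a}" for n z
  have ev_set: "{\<omega> \<in> space M. \<bar>D n z \<omega>\<bar> > a} \<in> sets M" for n z by measurable
  have prm[measurable]: "pr n \<in> borel_measurable borel" for n
  proof -
    have "pr n = (\<lambda>z. \<integral>\<omega>. indicator {\<omega> \<in> space M. \<bar>D n z \<omega>\<bar> > a} \<omega> \<partial>M)"
      using ev_set by (auto simp: pr_def fun_eq_iff)
    also have "\<dots> = (\<lambda>z. \<integral>\<omega>. of_bool (\<bar>D n z \<omega>\<bar> > a) \<partial>M)"
      by (intro ext Bochner_Integration.integral_cong) (auto simp: indicator_def)
    also have "\<dots> \<in> borel_measurable borel" unfolding of_bool_def by measurable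
    finally show ?thesis .
  qed
  have "(\<lambda>n. \<integral>z. indicator K z * pr n z \<partial>lborel) \<longlonglongrightarrow> (\<integral>z. 0 \<partial>(lborel :: complex measure))"
  proof (rule integral_dominated_convergence[where w="indicator K"])
    show "integrable lborel (indicator K :: complex \<Rightarrow> real)" using Kfin by (simp add: integrable_indicator_iff)
    show "AE z in lborel. (\<lambda>n. indicator K z * pr n z) \<longlonglongrightarrow> 0"
      using pw
    proof eventually_elim
      case (elim z)
      show ?case using elim a(1) by (cases "z \<in> K") (auto simp: pr_def)
    qed
    show "AE z in lborel. norm (indicator K z * pr n z) \<le> indicator K z" for n
      by (intro AE_I2) (auto simp: pr_def indicator_def)
  qed measurable
  then have "\<forall>\<^sub>F n in sequentially. (\<integral>z. indicator K z * pr n z \<partial>lborel) < e / (3 * A)"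
    by (intro order_tendstoD(2)) (use e A in auto)
  then show ?thesis using eventually_ge_at_top[of 1]
  proof eventually_elim
    case (elim n)
    have pint: "(\<integral>\<^sup>+z. indicator K z * ennreal (pr n z) \<partial>lborel) = ennreal (\<integral>z. indicator K z * pr n z \<partial>lborel)"
    proof (subst nn_integral_eq_integral[symmetric])
      show "integrable lborel (\<lambda>z. indicator K z * pr n z)"
      proof (rule Bochner_Integration.integrable_bound)
        show "integrable lborel (indicator K :: complex \<Rightarrow> real)" using Kfin by (simp add: integrable_indicator_iff)
        show "AE z in lborel. norm (indicator K z * pr n z) \<le> norm (indicator K z :: real)"
          by (intro AE_I2) (auto simp: pr_def indicator_def)
      qed measurable
    qed (auto simp: pr_def indicator_def intro!: nn_integral_cong)
    have swap: "(\<integral>\<^sup>+\<omega>. (\<integral>\<^sup>+z. indicator K z * f (D n z \<omega>) \<partial>lborel) \<partial>M) = (\<integral>\<^sup>+z. (\<integral>\<^sup>+\<omega>. indicator K z * f (D n z \<omega>) \<partial>M) \<partial>lborel)"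
      if [measurable]: "f \<in> borel_measurable borel" for f :: "real \<Rightarrow> ennreal"
      by (rule LM.Fubini') measurable
    \<comment> \<open>Where |x| exceeds \<open>a\<close>, completing the square gives
      \<open>A * \<bar>x\<bar> \<le> x\<^sup>2 + A\<^sup>2\<close>; elsewhere \<open>a\<close> alone
      suffices.\<close>
    have split: "ennreal \<bar>x\<bar> \<le> ennreal a + ennreal (1/A) * ennreal (x\<^sup>2) + ennreal A * indicator {x. \<bar>x\<bar> > a} x" for x
    proof -
      have "\<bar>x\<bar> \<le> a + (1/A) * x\<^sup>2 + A * indicator {x. \<bar>x\<bar> > a} x"
      proof (cases "\<bar>x\<bar> > a")
        case True
        have "0 \<le> (\<bar>x\<bar> - A / 2)\<^sup>2" by simp
        also have "(\<bar>x\<bar> - A / 2)\<^sup>2 = x\<^sup>2 - A * \<bar>x\<bar> + A\<^sup>2 / 4" by (simp add: power2_diff power_divide)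
        finally have "A * \<bar>x\<bar> \<le> x\<^sup>2 + A\<^sup>2" using zero_le_power2[of A] by linarith
        then have "\<bar>x\<bar> \<le> (x\<^sup>2 + A\<^sup>2) / A" using A(1) by (simp add: field_simps)
        also have "\<dots> = (1/A) * x\<^sup>2 + A" using A(1) by (simp add: field_simps power2_eq_square)
        finally show ?thesis using True a(1) by simp
      next
        case False
        have "0 \<le> (1/A) * x\<^sup>2" using A(1) by simp
        then show ?thesis using False by simp
      qed
      then have "ennreal \<bar>x\<bar> \<le> ennreal (a + (1/A) * x\<^sup>2 + A * indicator {x. \<bar>x\<bar> > a} x)" by (rule ennreal_leI)
      also have "\<dots> = ennreal a + ennreal (1/A) * ennreal (x\<^sup>2) + ennreal A * indicator {x. \<bar>x\<bar> > a} x"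
      proof -
        have "ennreal (1/A * x\<^sup>2) = ennreal (1/A) * ennreal (x\<^sup>2)" using A(1) by (intro ennreal_mult) auto
        then show ?thesis using a(1) A(1) by (simp add: ennreal_plus indicator_def)
      qed
      finally show ?thesis .
    qed
    have [measurable]: "{x :: real. \<bar>x\<bar> > a} \<in> sets borel" by measurable
    have "(\<integral>\<^sup>+\<omega>. (\<integral>\<^sup>+z. indicator K z * ennreal \<bar>D n z \<omega>\<bar> \<partial>lborel) \<partial>M)
      \<le> (\<integral>\<^sup>+\<omega>. (\<integral>\<^sup>+z. indicator K z * ennreal a + ennreal (1/A) * (indicator (cball 0 R) z * ennreal ((D n z \<omega>)\<^sup>2))
           + ennreal A * (indicator K z * indicator {x. \<bar>x\<bar> > a} (D n z \<omega>)) \<partial>lborel) \<partial>M)"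
    proof (intro nn_integral_mono)
      fix \<omega> z
      show "indicator K z * ennreal \<bar>D n z \<omega>\<bar> \<le> indicator K z * ennreal a + ennreal (1/A) * (indicator (cball 0 R) z * ennreal ((D n z \<omega>)\<^sup>2))
           + ennreal A * (indicator K z * indicator {x. \<bar>x\<bar> > a} (D n z \<omega>))"
      proof (cases "z \<in> K")
        case True
        then have "z \<in> cball 0 R" using KR by blast
        then show ?thesis using split[of "D n z \<omega>"] True by simp
      qed simp
    qed
    also have "\<dots> = (\<integral>\<^sup>+\<omega>. (\<integral>\<^sup>+z. indicator K z * ennreal a \<partial>lborel) + ennreal (1/A) * (\<integral>\<^sup>+z. indicator (cball 0 R) z * ennreal ((D n z \<omega>)\<^sup>2) \<partial>lborel)
           + ennreal A * (\<integral>\<^sup>+z. indicator K z * indicator {x. \<bar>x\<bar> > a} (D n z \<omega>) \<partial>lborel) \<partial>M)"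
    proof (rule nn_integral_cong)
      fix \<omega> assume [measurable]: "\<omega> \<in> space M"
      have [measurable]: "(\<lambda>z. D n z \<omega>) \<in> borel_measurable borel"
        using measurable_compose[OF measurable_Pair2'[OF \<open>\<omega> \<in> space M\<close>] D_measurable_pair[of n]] by simp
      show "(\<integral>\<^sup>+z. indicator K z * ennreal a + ennreal (1/A) * (indicator (cball 0 R) z * ennreal ((D n z \<omega>)\<^sup>2))
           + ennreal A * (indicator K z * indicator {x. \<bar>x\<bar> > a} (D n z \<omega>)) \<partial>lborel)
         = (\<integral>\<^sup>+z. indicator K z * ennreal a \<partial>lborel) + ennreal (1/A) * (\<integral>\<^sup>+z. indicator (cball 0 R) z * ennreal ((D n z \<omega>)\<^sup>2) \<partial>lborel)
           + ennreal A * (\<integral>\<^sup>+z. indicator K z * indicator {x. \<bar>x\<bar> > a} (D n z \<omega>) \<partial>lborel)"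
        by (subst nn_integral_add, measurable, subst nn_integral_add, measurable) (simp add: nn_integral_cmult)
    qed
    also have "\<dots> = (\<integral>\<^sup>+\<omega>. (\<integral>\<^sup>+z. indicator K z * ennreal a \<partial>lborel) \<partial>M) + ennreal (1/A) * (\<integral>\<^sup>+\<omega>. (\<integral>\<^sup>+z. indicator (cball 0 R) z * ennreal ((D n z \<omega>)\<^sup>2) \<partial>lborel) \<partial>M)
           + ennreal A * (\<integral>\<^sup>+\<omega>. (\<integral>\<^sup>+z. indicator K z * indicator {x. \<bar>x\<bar> > a} (D n z \<omega>) \<partial>lborel) \<partial>M)"
      by (subst nn_integral_add, measurable, subst nn_integral_add, measurable) (simp add: nn_integral_cmult)
    also have "(\<integral>\<^sup>+\<omega>. (\<integral>\<^sup>+z. indicator K z * ennreal a \<partial>lborel) \<partial>M) = ennreal (a * l)"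
    proof -
      have "(\<integral>\<^sup>+z. indicator K z * ennreal a \<partial>lborel) = ennreal l * ennreal a"
        unfolding l(1)[symmetric] by (subst nn_integral_multc) auto
      also have "\<dots> = ennreal (a * l)" using l(2) a(1) by (simp add: ennreal_mult mult.commute)
      finally show ?thesis using emeasure_space_1 by simp
    qed
    also have "(\<integral>\<^sup>+\<omega>. (\<integral>\<^sup>+z. indicator K z * indicator {x. \<bar>x\<bar> > a} (D n z \<omega>) \<partial>lborel) \<partial>M) = (\<integral>\<^sup>+z. indicator K z * ennreal (pr n z) \<partial>lborel)"
    proof (subst swap)
      show "(\<integral>\<^sup>+z. (\<integral>\<^sup>+\<omega>. indicator K z * indicator {x. \<bar>x\<bar> > a} (D n z \<omega>) \<partial>M) \<partial>lborel) = (\<integral>\<^sup>+z. indicator K z * ennreal (pr n z) \<partial>lborel)"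
      proof (rule nn_integral_cong)
        fix z
        have "(\<integral>\<^sup>+\<omega>. indicator {x. \<bar>x\<bar> > a} (D n z \<omega>) \<partial>M) = (\<integral>\<^sup>+\<omega>. indicator {\<omega> \<in> space M. \<bar>D n z \<omega>\<bar> > a} \<omega> \<partial>M)"
          by (rule nn_integral_cong) (auto simp: indicator_def)
        also have "\<dots> = ennreal (pr n z)" using ev_set by (simp add: pr_def emeasure_eq_measure)
        finally show "(\<integral>\<^sup>+\<omega>. indicator K z * indicator {x. \<bar>x\<bar> > a} (D n z \<omega>) \<partial>M) = indicator K z * ennreal (pr n z)"
          by (subst nn_integral_cmult) auto
      qed
    qed measurable
    also have "ennreal (a * l) + ennreal (1/A) * (\<integral>\<^sup>+\<omega>. (\<integral>\<^sup>+z. indicator (cball 0 R) z * ennreal ((D n z \<omega>)\<^sup>2) \<partial>lborel) \<partial>M)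
           + ennreal A * (\<integral>\<^sup>+z. indicator K z * ennreal (pr n z) \<partial>lborel)
       \<le> ennreal (e/3) + ennreal (1/A) * ennreal Q + ennreal A * ennreal (e / (3 * A))"
      using Q'(2)[OF elim(2)] elim(1) a(2) unfolding pint Q(1) by (intro add_mono mult_left_mono ennreal_leI) auto
    also have "\<dots> = ennreal (e/3 + Q / A + e/3)"
    proof -
      have "ennreal (1/A) * ennreal Q = ennreal (Q / A)" "ennreal A * ennreal (e / (3 * A)) = ennreal (e/3)"
        using A(1) Q(2) e by (simp_all add: ennreal_mult[symmetric])
      moreover have "ennreal (x + y + z) = ennreal x + ennreal y + ennreal z" if "0 \<le> x" "0 \<le> y" "0 \<le> z" for x y z
        using that by (simp add: ennreal_plus)
      from this[of "e/3" "Q / A" "e/3"] have "ennreal (e/3 + Q / A + e/3) = ennreal (e/3) + ennreal (Q / A) + ennreal (e/3)"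
        using e A(1) Q(2) by simp
      ultimately show ?thesis by simp
    qed
    also have "\<dots> \<le> ennreal e" using A(2) by (intro ennreal_leI) linarith
    finally show ?case .
  qed
qed

text \<open>The integral formula expresses the average through the values of \<open>P\<close>, which
  avoids a measurable selection of the roots. For \<open>n = 0\<close> the average is 0 by the
  convention on division.\<close>

lemma zero_average_measurable:
  assumes \<phi>: "test_function \<phi>"
  shows "(\<lambda>\<omega>. zero_average \<phi> m n (\<lambda>i k. X i k \<omega>)) \<in> borel_measurable M"
proof (cases "n = 0")
  case True then show ?thesis by (simp add: zero_average_def)
next
  case False
  then have n: "n \<ge> 1" by simp
  have [measurable]: "laplacian \<phi> \<in> borel_measurable borel" by (rule laplacian_test_function(1)[OF \<phi>])
  have [measurable]: "(\<lambda>p. P n (snd p) (fst p)) \<in> borel_measurable (M \<Otimes>\<^sub>M borel)"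
    using measurable_compose[OF measurable_pair_swap' P_measurable_pair[of n]] by (simp add: split_beta)
  have "(\<lambda>\<omega>. complex_of_real (1 / (2 * pi)) * (\<integral>z. laplacian \<phi> z * complex_of_real (ln (norm (P n z \<omega>)) / real n) \<partial>lborel)) \<in> borel_measurable M"
    by measurable
  then show ?thesis by (simp add: zero_average_eq_integral(1)[OF \<phi> m n] P_eq_poly_sum)
qed

text \<open>The Laplacian of \<open>\<phi>\<close> is bounded and vanishes off
  \<open>supp_fun \<phi>\<close>, so the error is at most a constant times the L^1 norm of
  \<open>D n\<close> there, and Markov's inequality applies.\<close>

theorem zero_average_converges:
  assumes \<phi>: "test_function \<phi>"
    and pw: "AE z in lborel. z \<in> supp_fun \<phi> \<longrightarrow> (\<forall>\<delta>>0. (\<lambda>n. prob {\<omega> \<in> space M. \<bar>D n z \<omega>\<bar> > \<delta>}) \<longlonglongrightarrow> 0)"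
  shows "converges_in_prob M (\<lambda>n \<omega>. zero_average \<phi> m n (\<lambda>i k. X i k \<omega>)) (\<Lambda> \<phi>)"
  unfolding converges_in_prob_def
proof (intro conjI allI impI zero_average_measurable[OF \<phi>])
  fix \<epsilon> :: real assume \<epsilon>: "\<epsilon> > 0"
  let ?Z = "\<lambda>n \<omega>. zero_average \<phi> m n (\<lambda>i k. X i k \<omega>)"
  have [measurable]: "?Z n \<in> borel_measurable M" for n by (rule zero_average_measurable[OF \<phi>])
  have lm[measurable]: "laplacian \<phi> \<in> borel_measurable borel" by (rule laplacian_test_function(1)[OF \<phi>])
  obtain B0 where B0: "\<And>z. norm (laplacian \<phi> z) \<le> B0" using laplacian_test_function(2)[OF \<phi>] by blast
  define B where "B = max B0 1"
  have B: "\<And>z. norm (laplacian \<phi> z) \<le> B" "B > 0" using B0 by (auto simp: B_def le_max_iff_disj)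
  have "bounded (supp_fun \<phi>)" using \<phi> by (simp add: test_function_def compact_imp_bounded)
  then obtain R where R: "R > 0" "\<forall>z\<in>supp_fun \<phi>. norm z \<le> R" unfolding bounded_pos by blast
  have KR: "supp_fun \<phi> \<subseteq> cball 0 R" using R by auto
  have l0: "laplacian \<phi> z = 0" if "norm z > R" for z
    using laplacian_test_function(3)[OF \<phi>, of z] R(2) that by force
  have K[measurable]: "supp_fun \<phi> \<in> sets borel" by (simp add: supp_fun_def)
  have iU: "integrable lborel (\<lambda>z. laplacian \<phi> z * complex_of_real (U z))"
    by (rule loc_integrable_mult[OF loc_int lm B(1) l0])
  have diff: "ennreal (norm (?Z n \<omega> - \<Lambda> \<phi>)) \<le> ennreal B * (\<integral>\<^sup>+z. indicator (supp_fun \<phi>) z * ennreal \<bar>D n z \<omega>\<bar> \<partial>lborel)"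
    if n: "n \<ge> 1" for n \<omega>
  proof -
    have "?Z n \<omega> - \<Lambda> \<phi> = complex_of_real (1 / (2 * pi)) * (\<integral>z. laplacian \<phi> z * complex_of_real (D n z \<omega>) \<partial>lborel)"
      unfolding zero_average_eq_integral(1)[OF \<phi> m n] \<Lambda>_def D_def P_eq_poly_sum
      using zero_average_eq_integral(2)[OF \<phi> m n] iU by (simp add: right_diff_distrib)
    then have "norm (?Z n \<omega> - \<Lambda> \<phi>) = 1 / (2 * pi) * norm (\<integral>z. laplacian \<phi> z * complex_of_real (D n z \<omega>) \<partial>lborel)"
      by (simp only: norm_mult norm_of_real) simp
    also have "\<dots> \<le> 1 * norm (\<integral>z. laplacian \<phi> z * complex_of_real (D n z \<omega>) \<partial>lborel)"
      using pi_ge_two by (intro mult_right_mono) auto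
    finally have "ennreal (norm (?Z n \<omega> - \<Lambda> \<phi>)) \<le> ennreal (norm (\<integral>z. laplacian \<phi> z * complex_of_real (D n z \<omega>) \<partial>lborel))"
      by (intro ennreal_leI) simp
    also have "\<dots> \<le> (\<integral>\<^sup>+z. ennreal (norm (laplacian \<phi> z * complex_of_real (D n z \<omega>))) \<partial>lborel)"
    proof (rule integral_norm_bound_ennreal)
      show "integrable lborel (\<lambda>z. laplacian \<phi> z * complex_of_real (D n z \<omega>))"
        unfolding D_def P_eq_poly_sum using zero_average_eq_integral(2)[OF \<phi> m n] iU by (simp add: right_diff_distrib)
    qed
    also have "\<dots> \<le> (\<integral>\<^sup>+z. ennreal B * (indicator (supp_fun \<phi>) z * ennreal \<bar>D n z \<omega>\<bar>) \<partial>lborel)"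
    proof (rule nn_integral_mono)
      fix z
      show "ennreal (norm (laplacian \<phi> z * complex_of_real (D n z \<omega>))) \<le> ennreal B * (indicator (supp_fun \<phi>) z * ennreal \<bar>D n z \<omega>\<bar>)"
      proof (cases "z \<in> supp_fun \<phi>")
        case True
        have "norm (laplacian \<phi> z * complex_of_real (D n z \<omega>)) \<le> B * \<bar>D n z \<omega>\<bar>"
          unfolding norm_mult norm_of_real using B(1)[of z] by (intro mult_right_mono) auto
        then have "ennreal (norm (laplacian \<phi> z * complex_of_real (D n z \<omega>))) \<le> ennreal (B * \<bar>D n z \<omega>\<bar>)" by (rule ennreal_leI)
        then show ?thesis using True B(2) by (simp add: ennreal_mult)
      qed (simp add: laplacian_test_function(3)[OF \<phi>])
    qed
    also have "\<dots> = ennreal B * (\<integral>\<^sup>+z. indicator (supp_fun \<phi>) z * ennreal \<bar>D n z \<omega>\<bar> \<partial>lborel)"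
      by (rule nn_integral_cmult) (simp add: D_def P_eq_poly_sum)
    finally show ?thesis .
  qed
  show "(\<lambda>n. measure M {\<omega> \<in> space M. norm (?Z n \<omega> - \<Lambda> \<phi>) > \<epsilon>}) \<longlonglongrightarrow> 0"
  proof (rule tendstoI)
    fix e :: real assume e: "e > 0"
    \<comment> \<open>Markov then yields \<open>(1/\<epsilon>) * B * e' = e / 2\<close>.\<close>
    define e' where "e' = e * \<epsilon> / (2 * B)"
    have e': "e' > 0" using e \<epsilon> B by (simp add: e'_def)
    show "\<forall>\<^sub>F n in sequentially. dist (measure M {\<omega> \<in> space M. norm (?Z n \<omega> - \<Lambda> \<phi>) > \<epsilon>}) 0 < e"
      using expected_L1_tendsto_0[OF K KR pw e'] eventually_ge_at_top[of 1]
    proof eventually_elim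
      case (elim n)
      have "emeasure M {\<omega> \<in> space M. norm (?Z n \<omega> - \<Lambda> \<phi>) > \<epsilon>} \<le> emeasure M {\<omega> \<in> space M. 1 \<le> ennreal (1/\<epsilon>) * ennreal (norm (?Z n \<omega> - \<Lambda> \<phi>))}"
      proof (rule emeasure_mono)
        show "{\<omega> \<in> space M. norm (?Z n \<omega> - \<Lambda> \<phi>) > \<epsilon>} \<subseteq> {\<omega> \<in> space M. 1 \<le> ennreal (1/\<epsilon>) * ennreal (norm (?Z n \<omega> - \<Lambda> \<phi>))}"
          using \<epsilon> by (auto simp: ennreal_mult[symmetric] ennreal_1[symmetric] field_simps simp del: ennreal_1 intro!: ennreal_leI)
      qed measurable
      also have "\<dots> \<le> ennreal (1/\<epsilon>) * (\<integral>\<^sup>+\<omega>. ennreal (norm (?Z n \<omega> - \<Lambda> \<phi>)) * indicator (space M) \<omega> \<partial>M)"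
        by (rule nn_integral_Markov_inequality) auto
      also have "\<dots> \<le> ennreal (1/\<epsilon>) * (\<integral>\<^sup>+\<omega>. ennreal B * (\<integral>\<^sup>+z. indicator (supp_fun \<phi>) z * ennreal \<bar>D n z \<omega>\<bar> \<partial>lborel) \<partial>M)"
        using diff[OF elim(2)] by (intro mult_left_mono nn_integral_mono) auto
      also have "(\<integral>\<^sup>+\<omega>. ennreal B * (\<integral>\<^sup>+z. indicator (supp_fun \<phi>) z * ennreal \<bar>D n z \<omega>\<bar> \<partial>lborel) \<partial>M) = ennreal B * (\<integral>\<^sup>+\<omega>. (\<integral>\<^sup>+z. indicator (supp_fun \<phi>) z * ennreal \<bar>D n z \<omega>\<bar> \<partial>lborel) \<partial>M)"
        by (rule nn_integral_cmult) measurable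
      also have "ennreal (1/\<epsilon>) * \<dots> \<le> ennreal (1/\<epsilon>) * (ennreal B * ennreal e')"
        by (rule mult_left_mono[OF mult_left_mono[OF elim(1)]]) simp_all
      also have "\<dots> = ennreal (e / 2)"
        using \<epsilon> B(2) e by (simp add: ennreal_mult[symmetric] e'_def)
      finally have "measure M {\<omega> \<in> space M. norm (?Z n \<omega> - \<Lambda> \<phi>) > \<epsilon>} \<le> e / 2"
        using e by (simp add: emeasure_eq_measure)
      then show ?case using e by (simp add: dist_real_def)
    qed
  qed
qed

end

section \<open>Absence of ties under the potential gap condition\<close>

context potentials
begin

text \<open>Points where the potentials coincide lie in each of the sets of the gap condition, and
  the bounds on the measures of these sets tend to 0.\<close>

lemma potential_gap_AE_neq:
  assumes K: "K \<in> sets borel" and kl: "k \<in> {1..m}" "l \<in> {1..m}" and gap: "potential_gap K (\<mu> k) (\<mu> l)"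
  shows "AE z in lborel. z \<in> K \<longrightarrow> pot (\<mu> k) z \<noteq> pot (\<mu> l) z"
proof -
  note [measurable] = K log_potential_measurable[OF kl(1)] log_potential_measurable[OF kl(2)]
  define h where "h = (\<lambda>z. \<bar>log_potential (\<mu> k) z - log_potential (\<mu> l) z\<bar>)"
  have hm[measurable]: "h \<in> borel_measurable borel" unfolding h_def by measurable
  obtain C :: real where C: "C > 0" "\<And>n::nat. real n > C \<Longrightarrow>
        emeasure lborel {z \<in> K. h z \<le> ereal ((ln (real n))\<^sup>2 / sqrt (real n))} \<le> ennreal (C / (ln (real n)) ^ 3)"
    using gap unfolding potential_gap_def h_def by blast
  define N where "N = {z \<in> K. h z \<le> 0}"
  have N[measurable]: "N \<in> sets borel" unfolding N_def by measurable
  have le: "emeasure lborel N \<le> ennreal (C / (ln (real n)) ^ 3)" if "real n > C" for n :: nat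
  proof -
    have "emeasure lborel N \<le> emeasure lborel {z \<in> K. h z \<le> ereal ((ln (real n))\<^sup>2 / sqrt (real n))}"
    proof (rule emeasure_mono)
      show "N \<subseteq> {z \<in> K. h z \<le> ereal ((ln (real n))\<^sup>2 / sqrt (real n))}"
      proof
        fix z assume z: "z \<in> N"
        have "(0::ereal) \<le> ereal ((ln (real n))\<^sup>2 / sqrt (real n))" by simp
        with z show "z \<in> {z \<in> K. h z \<le> ereal ((ln (real n))\<^sup>2 / sqrt (real n))}" unfolding N_def by (auto intro: order_trans)
      qed
    qed measurable
    then show ?thesis using C(2)[OF that] by (rule order_trans)
  qed
  have "(\<lambda>n. ennreal (C / (ln (real n)) ^ 3)) \<longlonglongrightarrow> ennreal 0"
    by (intro tendsto_ennrealI) real_asymp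
  moreover have "\<forall>\<^sub>F n in sequentially. emeasure lborel N \<le> ennreal (C / (ln (real n)) ^ 3)"
  proof -
    have "\<forall>\<^sub>F n in sequentially. real n > C" using filterlim_real_sequentially by (simp add: filterlim_at_top_dense)
    then show ?thesis by eventually_elim (rule le)
  qed
  ultimately have "emeasure lborel N \<le> ennreal 0" by (intro tendsto_lowerbound[of _ _ sequentially]) auto
  then have "N \<in> null_sets lborel" using N by (intro null_setsI) auto
  then have "AE z in lborel. z \<notin> N" by (rule AE_not_in)
  then show ?thesis using AE_log_potential_eq
  proof eventually_elim
    case (elim z)
    then show ?case using kl by (auto simp: N_def h_def)
  qed
qed

end

section \<open>Convergence at almost every point of the support\<close>

context random_roots
begin

lemma pointwise_convergence:
  assumes cond: "(\<forall>k\<in>{1..m - 1}. \<not> supported_on_circle_centered_in (\<mu> k) (supp_fun \<phi>)) \<or>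
        (\<forall>k\<in>{1..m}. \<forall>l\<in>{1..m}. k < l \<longrightarrow> potential_gap (supp_fun \<phi>) (\<mu> k) (\<mu> l))"
  shows "AE z in lborel. z \<in> supp_fun \<phi> \<longrightarrow> (\<forall>\<delta>>0. (\<lambda>n. prob {\<omega> \<in> space M. \<bar>D n z \<omega>\<bar> > \<delta>}) \<longlonglongrightarrow> 0)"
proof -
  have K: "supp_fun \<phi> \<in> sets borel" by (simp add: supp_fun_def)
  have sq: "AE z in lborel. \<forall>k\<in>{1..m}. integrable (\<mu> k) (\<lambda>w. (ln (norm (z - w)))\<^sup>2)"
    using bounded_prob.AE_integrable_ln_square[OF bp] by (intro AE_finite_allI) auto
  have ne: "AE z in lborel. \<forall>k\<in>{1..m}. AE w in \<mu> k. norm (z - w) \<noteq> 0"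
    by (rule AE_finite_allI[OF finite_atLeastAtMost]) (rule bounded_prob.AE_AE_norm_neq[OF bp])
  have alt: "AE z in lborel. z \<in> supp_fun \<phi> \<longrightarrow> (\<exists>j\<in>{1..m}. pot (\<mu> j) z = U z \<and>
    ((\<forall>k\<in>{1..m} - {j}. pot (\<mu> k) z < U z) \<or> \<not> (\<exists>r. AE w in \<mu> j. norm (w - z) = r)))"
    using cond
  proof
    assume c1: "\<forall>k\<in>{1..m - 1}. \<not> supported_on_circle_centered_in (\<mu> k) (supp_fun \<phi>)"
    \<comment> \<open>If some index below \<open>m\<close> attains the maximum, its measure is not
      on a circle about \<open>z\<close>; if none does, \<open>m\<close> alone attains it and
      dominates. This explains the range up to \<open>m - 1\<close> in the first condition.\<close>
    have "\<exists>j\<in>{1..m}. pot (\<mu> j) z = U z \<and>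
      ((\<forall>k\<in>{1..m} - {j}. pot (\<mu> k) z < U z) \<or> \<not> (\<exists>r. AE w in \<mu> j. norm (w - z) = r))" if z: "z \<in> supp_fun \<phi>" for z
    proof (cases "\<exists>j\<in>{1..m - 1}. pot (\<mu> j) z = U z")
      case True
      then obtain j where j: "j \<in> {1..m - 1}" "pot (\<mu> j) z = U z" by blast
      then have jm: "j \<in> {1..m}" by auto
      interpret B: bounded_prob "\<mu> j" S by (rule bp[OF jm])
      have "\<not> (\<exists>r. AE w in \<mu> j. norm (w - z) = r)"
      proof
        assume "\<exists>r. AE w in \<mu> j. norm (w - z) = r"
        then obtain r where r: "AE w in \<mu> j. norm (w - z) = r" by blast
        then have sub: "supp_measure (\<mu> j) \<subseteq> {w. norm (w - z) = r}" by (rule supp_measure_subset_circle[OF B.sets_eq])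
        \<comment> \<open>Supports on circles are defined with \<open>r \<ge> 0\<close>; with a
          negative \<open>r\<close> a false statement would hold almost surely.\<close>
        have "r \<ge> 0"
        proof (rule ccontr)
          assume "\<not> r \<ge> 0"
          then have "norm (w - z) \<noteq> r" for w using norm_ge_zero[of "w - z"] by linarith
          then have "AE w in \<mu> j. False" using r by (auto elim: eventually_mono)
          then show False using B.prob_space_axioms by simp
        qed
        then have "supported_on_circle_centered_in (\<mu> j) (supp_fun \<phi>)"
          unfolding supported_on_circle_centered_in_def using sub z by blast
        then show False using c1 j(1) by blast
      qed
      then show ?thesis using jm j(2) by blast
    next
      case False
      obtain j where j: "j \<in> {1..m}" "U z = pot (\<mu> j) z" by (rule U_attained)
      have jm: "j = m" using False j by (cases "j = m") auto
      have "pot (\<mu> k) z < U z" if "k \<in> {1..m} - {j}" for k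
      proof -
        have "k \<in> {1..m - 1}" using that jm by auto
        then have "pot (\<mu> k) z \<noteq> U z" using False by blast
        moreover have "pot (\<mu> k) z \<le> U z" using that by (intro pot_le_U) auto
        ultimately show ?thesis by simp
      qed
      then show ?thesis using j by auto
    qed
    then show ?thesis by (intro AE_I2) blast
  next
    assume c2: "\<forall>k\<in>{1..m}. \<forall>l\<in>{1..m}. k < l \<longrightarrow> potential_gap (supp_fun \<phi>) (\<mu> k) (\<mu> l)"
    have "AE z in lborel. \<forall>k\<in>{1..m}. \<forall>l\<in>{1..m}. k < l \<longrightarrow> z \<in> supp_fun \<phi> \<longrightarrow> pot (\<mu> k) z \<noteq> pot (\<mu> l) z"
    proof (intro AE_finite_allI finite_atLeastAtMost)
      fix k l assume kl: "k \<in> {1..m}" "l \<in> {1..m}"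
      show "AE z in lborel. k < l \<longrightarrow> z \<in> supp_fun \<phi> \<longrightarrow> pot (\<mu> k) z \<noteq> pot (\<mu> l) z"
      proof (cases "k < l")
        case True
        then show ?thesis using potential_gap_AE_neq[OF K kl] c2 kl by simp
      qed simp
    qed
    then show ?thesis
    proof eventually_elim
      case (elim z)
      show ?case
      proof
        assume z: "z \<in> supp_fun \<phi>"
        obtain j where j: "j \<in> {1..m}" "U z = pot (\<mu> j) z" by (rule U_attained)
        have "pot (\<mu> k) z < U z" if k: "k \<in> {1..m} - {j}" for k
        proof -
          have "k < j \<or> j < k" using k by auto
          then have "pot (\<mu> k) z \<noteq> pot (\<mu> j) z" using elim z j(1) k by (metis DiffD1)
          moreover have "pot (\<mu> k) z \<le> U z" using k by (intro pot_le_U) auto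
          ultimately show ?thesis using j(2) by simp
        qed
        then show "\<exists>j\<in>{1..m}. pot (\<mu> j) z = U z \<and>
          ((\<forall>k\<in>{1..m} - {j}. pot (\<mu> k) z < U z) \<or> \<not> (\<exists>r. AE w in \<mu> j. norm (w - z) = r))"
          using j by auto
      qed
    qed
  qed
  show ?thesis
    using sq ne alt
  proof eventually_elim
    case (elim z)
    show ?case
    proof (intro impI allI)
      fix \<delta> :: real assume z: "z \<in> supp_fun \<phi>" and \<delta>: "\<delta> > 0"
      from elim(3) z obtain j where j: "j \<in> {1..m}" "pot (\<mu> j) z = U z"
        "(\<forall>k\<in>{1..m} - {j}. pot (\<mu> k) z < U z) \<or> \<not> (\<exists>r. AE w in \<mu> j. norm (w - z) = r)" by blast
      show "(\<lambda>n. prob {\<omega> \<in> space M. \<bar>D n z \<omega>\<bar> > \<delta>}) \<longlonglongrightarrow> 0"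
        unfolding D_def by (rule prob_log_sum_tendsto_0[OF _ _ j \<delta>]) (use elim(1,2) in auto)
    qed
  qed
qed

end

theorem theorem1p10:
  fixes m :: nat and \<mu> :: "nat \<Rightarrow> complex measure"
  assumes "m \<ge> 2"
    and "\<forall>k\<in>{1..m}. compact_prob (\<mu> k)"
  shows "\<exists>\<rho> :: complex measure.
    borel_prob \<rho> \<and>
    is_normalized_laplacian \<rho> (max_potential m \<mu>) \<and>
    (\<forall>\<rho>'. borel_prob \<rho>' \<and> is_normalized_laplacian \<rho>' (max_potential m \<mu>) \<longrightarrow> \<rho>' = \<rho>) \<and>
    (\<forall>(\<phi> :: complex \<Rightarrow> complex) (M :: 'a measure) (X :: nat \<Rightarrow> nat \<Rightarrow> 'a \<Rightarrow> complex).
      test_function \<phi> \<longrightarrow>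
      (\<forall>k\<in>{1..m - 1}. \<not> supported_on_circle_centered_in (\<mu> k) (supp_fun \<phi>)) \<or>
        (\<forall>k\<in>{1..m}. \<forall>l\<in>{1..m}. k < l \<longrightarrow> potential_gap (supp_fun \<phi>) (\<mu> k) (\<mu> l)) \<longrightarrow>
      prob_space M \<longrightarrow>
      prob_space.indep_vars M (\<lambda>_. borel) (\<lambda>(i, k). X i k) ({1..} \<times> {1..m}) \<longrightarrow>
      (\<forall>i\<ge>1. \<forall>k\<in>{1..m}. distr M borel (X i k) = \<mu> k) \<longrightarrow>
      converges_in_prob M
        (\<lambda>n \<omega>. zero_average \<phi> m n (\<lambda>i k. X i k \<omega>))
        (LINT z|\<rho>. \<phi> z))"
proof -
  have "\<exists>R>0. AE w in \<mu> k. norm w \<le> R" if "k \<in> {1..m}" for k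
    using compact_prob_bounded[of "\<mu> k"] assms(2) that by metis
  then obtain R where R: "\<And>k. k \<in> {1..m} \<Longrightarrow> R k > 0" "\<And>k. k \<in> {1..m} \<Longrightarrow> AE w in \<mu> k. norm w \<le> R k"
    by metis
  define S where "S = Max (R ` {1..m})"
  have RS: "R k \<le> S" if "k \<in> {1..m}" for k unfolding S_def using that by (intro Max_ge) auto
  have pot: "potentials m \<mu> S"
  proof (rule potentials.intro)
    show "m \<ge> 1" using assms(1) by simp
    fix k assume k: "k \<in> {1..m}"
    have b: "prob_space (\<mu> k)" "sets (\<mu> k) = sets borel"
      using assms(2) k by (auto simp: compact_prob_def borel_prob_def)
    have "S > 0" using R(1)[OF k] RS[OF k] by linarith
    moreover have "AE w in \<mu> k. norm w \<le> S" using R(2)[OF k] by eventually_elim (use RS[OF k] in linarith)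
    ultimately have "bounded_prob_axioms (\<mu> k) S" unfolding bounded_prob_axioms_def using b(2) by blast
    then show "bounded_prob (\<mu> k) S" by (rule bounded_prob.intro[OF b(1)])
  qed
  interpret potentials m \<mu> S by (rule pot)
  \<comment> \<open>\<open>\<rho>\<close> is obtained from \<open>U\<close> alone, before
    \<open>\<phi>\<close>, \<open>M\<close> and \<open>X\<close> are fixed; in this sense it depends
    only on the given measures.\<close>
  obtain \<rho> where \<rho>: "borel_prob \<rho>" "\<And>\<psi>. test_function \<psi> \<Longrightarrow> (LINT z|\<rho>. \<psi> z) = \<Lambda> \<psi>"
    using laplacian_measure by blast
  show ?thesis
  proof (intro exI[of _ \<rho>] conjI allI impI \<rho>(1))
    show "is_normalized_laplacian \<rho> (max_potential m \<mu>)" using \<rho>(2) is_normalized_laplacian_iff by blast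
    fix \<rho>' assume "borel_prob \<rho>' \<and> is_normalized_laplacian \<rho>' (max_potential m \<mu>)"
    then show "\<rho>' = \<rho>" using \<rho> is_normalized_laplacian_iff by (intro borel_prob_eqI) auto
  next
    fix \<phi> :: "complex \<Rightarrow> complex" and M :: "'a measure" and X :: "nat \<Rightarrow> nat \<Rightarrow> 'a \<Rightarrow> complex"
    assume \<phi>: "test_function \<phi>"
      and cond: "(\<forall>k\<in>{1..m - 1}. \<not> supported_on_circle_centered_in (\<mu> k) (supp_fun \<phi>)) \<or>
        (\<forall>k\<in>{1..m}. \<forall>l\<in>{1..m}. k < l \<longrightarrow> potential_gap (supp_fun \<phi>) (\<mu> k) (\<mu> l))"
      and M: "prob_space M" and ind: "prob_space.indep_vars M (\<lambda>_. borel) (\<lambda>(i, k). X i k) ({1..} \<times> {1..m})"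
      and d: "\<forall>i\<ge>1. \<forall>k\<in>{1..m}. distr M borel (X i k) = \<mu> k"
    interpret R: random_roots M m \<mu> S X
      by (intro random_roots.intro random_roots_axioms.intro M pot ind) (use d in auto)
    show "converges_in_prob M (\<lambda>n \<omega>. zero_average \<phi> m n (\<lambda>i k. X i k \<omega>)) (LINT z|\<rho>. \<phi> z)"
      unfolding \<rho>(2)[OF \<phi>] by (rule R.zero_average_converges[OF \<phi> R.pointwise_convergence[OF cond]])
  qed
qed

end
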